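(* Let $H$ be a computable Hilbert space over $\mathbb{C}$. For $y\in H$ let $\Lambda_y:H\to\mathbb{C}$ be $\Lambda_y(f)=\langle f,y\rangle$. Consider the map \[ \phi:\subseteq H^{\mathbb N}\to (H')^{\mathbb N},\qquad (f_i)_{i\in\mathbb N}\mapsto(\Lambda_{f_i})_{i\in\mathbb N}, \] with $\operatorname{dom}\phi=\{(f_i): (f_i)\text{ is a frame for }H\}$, which maps each frame $(f_i)$ to a $g$-frame for $H$ with respect to $\mathbb C$. Then $\phi$ is $(\delta_H^{\mathbb N},\delta_{H'}^{\mathbb N})$-computable, and $\phi^{-1}$ is $(\delta_{H'}^{\mathbb N},\delta_H^{\mathbb N})$-computable.
   Context: Computability is in the sense of representation-based computable analysis (Type-2 Turing machines). A function $f:\subseteq X\to Y$ between represented spaces $(X,\delta)$, $(Y,\delta')$ is $(\delta,\delta')$-computable if some Turing machine transforms every $\delta$-name of every $x\in\operatorname{dom} f$ into a $\delta'$-name of $f(x)$. $\delta_{\mathbb R}$, $\delta_{\mathbb C}$ are the Cauchy representations of $\mathbb R$, $\mathbb C$. A computable Hilbert space $(H,\langle\cdot,\cdot\rangle,e)$ is a separable Hilbert space together with a sequence $e:\mathbb N\to H$ whose linear span is dense, such that, with $\alpha_e$ a standard enumeration of the finite linear combinations of the $e_i$ with coefficients from a standard countable dense subset of the scalar field, the distances $\|\alpha_e(n)-\alpha_e(m)\|$ form a computable double sequence of reals. $H$ is represented by its Cauchy representation $\delta_H$: a name of $x$ encodes a sequence $(n_k)$ with $\|\alpha_e(n_k)-\alpha_e(n_l)\|<2^{-k}$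 for all $l>k$ and $x=\lim_k\alpha_e(n_k)$. For represented spaces, $[\delta\to\delta']$ is the standard representation of continuous functions (admitting evaluation and type conversion), and $X^{\mathbb N}$ is represented by $\delta^{\mathbb N}=[\delta_{\mathbb N}\to\delta]$. $H'$ is the dual space of bounded linear functionals on $H$, represented by $\delta_{H'}$: a name of $\ell\in H'$ consists of a $[\delta_H\to\delta_{\mathbb C}]$-name of $\ell$ together with a $\delta_{\mathbb R}$-name of $\|\ell\|$. A frame for $H$ is a sequence $(f_i)$ with constants $0<A\le B$ such that $A\|f\|^2\le\sum_i|\langle f,f_i\rangle|^2\le B\|f\|^2$ for all $f\in H$. For Hilbert spaces $H$, $H_i$, a sequence $\Lambda_i\in L(H,H_i)$ is a $g$-frame for $H$ with respect to $\{H_i\}$ if there are $0<A\le B<\infty$ with $A\|f\|^2\le\sum_i\|\Lambda_i f\|^2\le B\|f\|^2$ for all $f\in H$. *)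

theory Defs
  imports "HOL-Analysis.Analysis" "HOL-Library.Nat_Bijection"
begin

section \<open>Type-2 Turing machines\<close>

text \<open>
  A Type-2 machine is a Turing machine with a one-way read-only input tape, finitely many
  two-way infinite work tapes, and a one-way write-only output tape. It is given by a finite
  flowchart, i.e. a list of instructions whose positions serve as labels. Only the work tapes
  mentioned in the program are ever used, so there are finitely many of them.
  The tape alphabet is \<open>{0, 1}\<close> (as \<^typ>\<open>bool\<close>) plus, on the work tapes, the blank \<open>None\<close>.
\<close>

type_synonym symbol = "bool option"

datatype instr =
    In_Right
  | In_Test bool nat           \<comment> \<open>jump if the scanned input symbol is the given one\<close>
  | Work_Left nat
  | Work_Right nat
  | Work_Write nat symbol
  | Work_Test nat symbol nat   \<comment> \<open>tape, symbol, label: jump if the scanned symbol is the given one\<close>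
  | Out bool
  | Jump nat

type_synonym machine = "instr list"

record config =
  pc :: nat
  in_pos :: nat
  work :: "nat \<Rightarrow> int \<Rightarrow> symbol"
  head :: "nat \<Rightarrow> int"
  out_word :: "bool list"

definition init_config :: config where
  "init_config = \<lparr>pc = 0, in_pos = 0, work = (\<lambda>_ _. None), head = (\<lambda>_. 0), out_word = []\<rparr>"

fun exec :: "instr \<Rightarrow> (nat \<Rightarrow> bool) \<Rightarrow> config \<Rightarrow> config" where
  "exec In_Right x c = c\<lparr>pc := Suc (pc c), in_pos := Suc (in_pos c)\<rparr>"
| "exec (In_Test b l) x c = c\<lparr>pc := (if x (in_pos c) = b then l else Suc (pc c))\<rparr>"
| "exec (Work_Left t) x c = c\<lparr>pc := Suc (pc c), head := (head c)(t := head c t - 1)\<rparr>"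
| "exec (Work_Right t) x c = c\<lparr>pc := Suc (pc c), head := (head c)(t := head c t + 1)\<rparr>"
| "exec (Work_Write t s) x c =
     c\<lparr>pc := Suc (pc c), work := (work c)(t := (work c t)(head c t := s))\<rparr>"
| "exec (Work_Test t s l) x c =
     c\<lparr>pc := (if work c t (head c t) = s then l else Suc (pc c))\<rparr>"
| "exec (Out b) x c = c\<lparr>pc := Suc (pc c), out_word := out_word c @ [b]\<rparr>"
| "exec (Jump l) x c = c\<lparr>pc := l\<rparr>"

text \<open>The machine halts when the program counter leaves the program.\<close>

definition step :: "machine \<Rightarrow> (nat \<Rightarrow> bool) \<Rightarrow> config \<Rightarrow> config" where
  "step M x c = (if pc c < length M then exec (M ! pc c) x c else c)"

definition run :: "machine \<Rightarrow> (nat \<Rightarrow> bool) \<Rightarrow> nat \<Rightarrow> config" where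
  "run M x t = (step M x ^^ t) init_config"

definition writes :: "machine \<Rightarrow> (nat \<Rightarrow> bool) \<Rightarrow> (nat \<Rightarrow> bool) \<Rightarrow> bool" where
  "writes M x y \<longleftrightarrow>
     (\<forall>n. \<exists>t. n < length (out_word (run M x t)) \<and> out_word (run M x t) ! n = y n)"

text \<open>
  Names are points of Baire space. On a tape, \<open>p\<close> is written as the infinite binary word
  \<open>1\<^bsup>p(0)\<^esup> 0 1\<^bsup>p(1)\<^esup> 0 1\<^bsup>p(2)\<^esup> 0 \<dots>\<close>; the \<open>k\<close>-th zero is at position \<open>(\<Sum>j<k. p j + 1) + p k\<close>.
\<close>

type_synonym name = "nat \<Rightarrow> nat"

definition tape :: "name \<Rightarrow> nat \<Rightarrow> bool" where
  "tape p m \<longleftrightarrow> m \<notin> range (\<lambda>k. (\<Sum>j<k. Suc (p j)) + p k)"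

definition transforms :: "machine \<Rightarrow> name \<Rightarrow> name \<Rightarrow> bool" where
  "transforms M p q \<longleftrightarrow> writes M (tape p) (tape q)"


section \<open>Represented spaces and computable functions\<close>

text \<open>\<open>\<delta> p x\<close> means that \<open>p\<close> is a \<open>\<delta>\<close>-name of \<open>x\<close>.\<close>

type_synonym 'a rep = "name \<Rightarrow> 'a \<Rightarrow> bool"

text \<open>\<open>computable_on D \<delta> \<delta>' f\<close>: the partial function \<open>f\<close> with domain \<open>D\<close> is
  \<open>(\<delta>, \<delta>')\<close>-computable.\<close>

definition computable_on :: "'a set \<Rightarrow> 'a rep \<Rightarrow> 'b rep \<Rightarrow> ('a \<Rightarrow> 'b) \<Rightarrow> bool" where
  "computable_on D \<delta> \<delta>' f \<longleftrightarrow>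
     (\<exists>M. \<forall>x\<in>D. \<forall>p. \<delta> p x \<longrightarrow> (\<exists>q. transforms M p q \<and> \<delta>' q (f x)))"

definition nat_rep :: "nat rep" where
  "nat_rep p n \<longleftrightarrow> p 0 = n"

definition pair_rep :: "'a rep \<Rightarrow> 'b rep \<Rightarrow> ('a \<times> 'b) rep" where
  "pair_rep \<delta> \<delta>' p z \<longleftrightarrow> \<delta> (\<lambda>n. p (2 * n)) (fst z) \<and> \<delta>' (\<lambda>n. p (2 * n + 1)) (snd z)"

text \<open>
  The standard representation of the continuous partial functions on Baire space with
  \<open>G\<^sub>\<delta>\<close> domain, by (Kleene) associates: \<open>associate p q r\<close> means that the function with
  associate \<open>p\<close> maps \<open>q\<close> to \<open>r\<close>. The value \<open>p \<langle>n, w\<rangle>\<close> is \<open>0\<close> as long as the prefix \<open>w\<close> of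
  the argument does not yet determine the \<open>n\<close>-th entry of the result, and otherwise is that
  entry plus \<open>1\<close>.
\<close>

definition associate :: "name \<Rightarrow> name \<Rightarrow> name \<Rightarrow> bool" where
  "associate p q r \<longleftrightarrow>
     (\<forall>n. \<exists>k. p (prod_encode (n, list_encode (map q [0..<k]))) = Suc (r n) \<and>
              (\<forall>j<k. p (prod_encode (n, list_encode (map q [0..<j]))) = 0))"

text \<open>\<open>[\<delta> \<rightarrow> \<delta>']\<close>: a name of a total function is an associate of a realizer of it.\<close>

definition fun_rep :: "'a rep \<Rightarrow> 'b rep \<Rightarrow> ('a \<Rightarrow> 'b) rep" where
  "fun_rep \<delta> \<delta>' p f \<longleftrightarrow> (\<forall>q x. \<delta> q x \<longrightarrow> (\<exists>r. associate p q r \<and> \<delta>' r (f x)))"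

definition seq_rep :: "'a rep \<Rightarrow> (nat \<Rightarrow> 'a) rep" where
  "seq_rep \<delta> = fun_rep nat_rep \<delta>"

definition cauchy_rep :: "(nat \<Rightarrow> 'a::metric_space) \<Rightarrow> 'a rep" where
  "cauchy_rep \<alpha> p x \<longleftrightarrow>
     (\<forall>k l. k < l \<longrightarrow> dist (\<alpha> (p k)) (\<alpha> (p l)) < (1 / 2) ^ k) \<and>
     (\<lambda>k. \<alpha> (p k)) \<longlonglongrightarrow> x"

definition rational_enum :: "nat \<Rightarrow> real" where
  "rational_enum n = (case prod_decode n of (a, b) \<Rightarrow> of_int (int_decode a) / of_nat (Suc b))"

definition complex_rational_enum :: "nat \<Rightarrow> complex" where
  "complex_rational_enum n =
     (case prod_decode n of (a, b) \<Rightarrow> Complex (rational_enum a) (rational_enum b))"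

definition real_rep :: "real rep" where
  "real_rep = cauchy_rep rational_enum"

definition complex_rep :: "complex rep" where
  "complex_rep = cauchy_rep complex_rational_enum"


section \<open>Complex Hilbert spaces\<close>

text \<open>The inner product is linear in the first and conjugate linear in the second argument.\<close>

class complex_hilbert = banach +
  fixes scaleC :: "complex \<Rightarrow> 'a \<Rightarrow> 'a" (infixr "*\<^sub>C" 75)
    and cinner :: "'a \<Rightarrow> 'a \<Rightarrow> complex"
  assumes scaleC_of_real: "scaleC (complex_of_real r) x = r *\<^sub>R x"
    and scaleC_add_right: "scaleC c (x + y) = scaleC c x + scaleC c y"
    and scaleC_add_left: "scaleC (c + d) x = scaleC c x + scaleC d x"
    and scaleC_scaleC: "scaleC c (scaleC d x) = scaleC (c * d) x"
    and cinner_commute: "cinner x y = cnj (cinner y x)"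
    and cinner_add_left: "cinner (x + y) z = cinner x z + cinner y z"
    and cinner_scaleC_left: "cinner (scaleC c x) y = c * cinner x y"
    and cinner_ge_zero: "0 \<le> Re (cinner x x)"
    and cinner_eq_zero_iff: "cinner x x = 0 \<longleftrightarrow> x = 0"
    and norm_eq_sqrt_cinner: "norm x = sqrt (Re (cinner x x))"

instantiation complex :: complex_hilbert
begin

definition scaleC_complex :: "complex \<Rightarrow> complex \<Rightarrow> complex" where
  "scaleC_complex c x = c * x"

definition cinner_complex :: "complex \<Rightarrow> complex \<Rightarrow> complex" where
  "cinner_complex x y = x * cnj y"

instance
  by standard
    (auto simp: scaleC_complex_def cinner_complex_def algebra_simps scaleR_conv_of_real
      cmod_def power2_eq_square)

end

global_interpretation complex_hilbert: vector_space "scaleC :: complex \<Rightarrow> 'a \<Rightarrow> 'a::complex_hilbert"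
  defines cspan = complex_hilbert.span
  by unfold_locales
    (use scaleC_of_real[of 1] in \<open>simp_all add: scaleC_add_right scaleC_add_left scaleC_scaleC\<close>)

definition bounded_clinear :: "('a::complex_hilbert \<Rightarrow> 'b::complex_hilbert) \<Rightarrow> bool" where
  "bounded_clinear T \<longleftrightarrow> bounded_linear T \<and> (\<forall>c x. T (c *\<^sub>C x) = c *\<^sub>C T x)"

definition frame :: "(nat \<Rightarrow> 'a::complex_hilbert) \<Rightarrow> bool" where
  "frame F \<longleftrightarrow> (\<exists>A B. 0 < A \<and> A \<le> B \<and>
     (\<forall>f. summable (\<lambda>i. (cmod (cinner f (F i)))\<^sup>2) \<and>
          A * (norm f)\<^sup>2 \<le> (\<Sum>i. (cmod (cinner f (F i)))\<^sup>2) \<and>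
          (\<Sum>i. (cmod (cinner f (F i)))\<^sup>2) \<le> B * (norm f)\<^sup>2))"

text \<open>g-frames for the space \<open>'a\<close> with respect to the constant family of spaces \<open>'b\<close>.\<close>

definition g_frame :: "(nat \<Rightarrow> 'a::complex_hilbert \<Rightarrow> 'b::complex_hilbert) \<Rightarrow> bool" where
  "g_frame L \<longleftrightarrow> (\<forall>i. bounded_clinear (L i)) \<and> (\<exists>A B. 0 < A \<and> A \<le> B \<and>
     (\<forall>f. summable (\<lambda>i. (norm (L i f))\<^sup>2) \<and>
          A * (norm f)\<^sup>2 \<le> (\<Sum>i. (norm (L i f))\<^sup>2) \<and>
          (\<Sum>i. (norm (L i f))\<^sup>2) \<le> B * (norm f)\<^sup>2))"


section \<open>Computable Hilbert spaces and their duals\<close>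

definition lincomb_enum :: "(nat \<Rightarrow> 'a::complex_hilbert) \<Rightarrow> nat \<Rightarrow> 'a" where
  "lincomb_enum e n =
     (\<Sum>i<length (list_decode n). complex_rational_enum (list_decode n ! i) *\<^sub>C e i)"

definition computable_hilbert :: "(nat \<Rightarrow> 'a::complex_hilbert) \<Rightarrow> bool" where
  "computable_hilbert e \<longleftrightarrow>
     (\<exists>S :: 'a set. countable S \<and> closure S = UNIV) \<and>
     closure (cspan (range e)) = UNIV \<and>
     computable_on UNIV (pair_rep nat_rep nat_rep) real_rep
       (\<lambda>(n, m). norm (lincomb_enum e n - lincomb_enum e m))"

definition hilbert_rep :: "(nat \<Rightarrow> 'a::complex_hilbert) \<Rightarrow> 'a rep" where
  "hilbert_rep e = cauchy_rep (lincomb_enum e)"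

definition dual_space :: "('a::complex_hilbert \<Rightarrow> complex) set" where
  "dual_space = {l. bounded_clinear l}"

text \<open>The norm of a functional is its operator norm \<^const>\<open>onorm\<close>.\<close>

definition dual_rep :: "(nat \<Rightarrow> 'a::complex_hilbert) \<Rightarrow> ('a \<Rightarrow> complex) rep" where
  "dual_rep e p l \<longleftrightarrow>
     l \<in> dual_space \<and> pair_rep (fun_rep (hilbert_rep e) complex_rep) real_rep p (l, onorm l)"

definition riesz_functional :: "'a::complex_hilbert \<Rightarrow> 'a \<Rightarrow> complex" where
  "riesz_functional y = (\<lambda>f. cinner f y)"

text \<open>The map \<open>\<phi>\<close>, to be restricted to the domain \<open>Collect frame\<close>.\<close>

definition frame_map :: "(nat \<Rightarrow> 'a::complex_hilbert) \<Rightarrow> nat \<Rightarrow> 'a \<Rightarrow> complex" where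
  "frame_map F = (\<lambda>i. riesz_functional (F i))"

end

theory Submission
  imports Defs
begin

text \<open>
  Computable functionals on Baire space are described by primitive recursive functions acting on
  finite prefixes of the oracle. These are closed under composition and unbounded search and are
  executed by Type-2 machines, via a while language whose registers are work tapes in unary; the
  machine computing the distances \<open>\<parallel>\<alpha> n - \<alpha> m\<parallel>\<close> is in turn simulated step by step by such a function.

  A frame is irrelevant for the computation: each entry of the sequence is treated separately.
  From \<open>y\<close>, the functional \<open>\<langle>\<cdot>, y\<rangle>\<close> is evaluated by polarisation, which needs only the norms of
  rational linear combinations and of multiples of them by the imaginary unit; its norm is \<open>\<parallel>y\<parallel>\<close>.
  Conversely, given \<open>l = \<langle>\<cdot>, y\<rangle>\<close> and \<open>\<parallel>l\<parallel> = \<parallel>y\<parallel>\<close>, one searches for an index \<open>a\<close> for which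
  \<open>\<parallel>\<alpha> a - y\<parallel>\<^sup>2 = \<parallel>\<alpha> a\<parallel>\<^sup>2 + \<parallel>l\<parallel>\<^sup>2 - 2 Re (l (\<alpha> a))\<close> is small; this is a computable quantity, and the
  search succeeds by density.
\<close>

section \<open>A while language for Type-2 machines\<close>

text \<open>Two obstacles shape the encoding. The machine for the distances is known only to exist,
  yet it has to run as a subroutine on arguments found during the computation; hence its step
  function is made primitive recursive and a sufficient running time is searched for. Moreover, a
  name of a functional is an associate, a function of finite prefixes that must be 0 until the
  prefix suffices and correct at the first prefix where it is not 0. So evaluating an inner product
  needs a modulus known in advance: a precision that depends only on the first entries of the two
  names. These bound the norms, and the inner product is Lipschitz on bounded sets. In the converse
  direction, values of a functional determine its vector only weakly; its norm is what makes the
  distance to the vector computable. The constants come from scaling reals by \<open>2 ^ K\<close>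
  and calculating with natural numbers. A scaled norm is off by at most 2; squaring turns this into
  an error of order \<open>2 ^ K\<close> times a norm bound, negligible after division by
  \<open>4 ^ K\<close>.\<close>

datatype com =
    Inc nat
  | Dec nat
  | Seq com com (infixr ";;" 60)
  | IfPos nat com com
  | While nat com
  | Read nat
  | Emit bool

type_synonym state = "(nat \<Rightarrow> nat) \<times> nat \<times> bool list"

text \<open>\<open>Dec\<close> has no rule at zero: the compiled code would move the head off the
  start of the unary block. \<open>Read\<close> adds a whole entry instead of overwriting, because
  it appends a block of ones to the register.\<close>

inductive bigstep :: "name \<Rightarrow> com \<Rightarrow> state \<Rightarrow> state \<Rightarrow> bool" for p where
  Inc: "bigstep p (Inc r) (v, i, u) (v(r := Suc (v r)), i, u)"
| Dec: "0 < v r \<Longrightarrow> bigstep p (Dec r) (v, i, u) (v(r := v r - 1), i, u)"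
| Seq: "bigstep p c s s' \<Longrightarrow> bigstep p d s' s'' \<Longrightarrow> bigstep p (c ;; d) s s''"
| IfT: "0 < v r \<Longrightarrow> bigstep p c (v, i, u) s \<Longrightarrow> bigstep p (IfPos r c d) (v, i, u) s"
| IfF: "v r = 0 \<Longrightarrow> bigstep p d (v, i, u) s \<Longrightarrow> bigstep p (IfPos r c d) (v, i, u) s"
| WhileF: "v r = 0 \<Longrightarrow> bigstep p (While r c) (v, i, u) (v, i, u)"
| WhileT: "0 < v r \<Longrightarrow> bigstep p c (v, i, u) s \<Longrightarrow> bigstep p (While r c) s s' \<Longrightarrow>
    bigstep p (While r c) (v, i, u) s'"
| Read: "bigstep p (Read r) (v, i, u) (v(r := v r + p i), Suc i, u)"
| Emit: "bigstep p (Emit b) (v, i, u) (v, i, u @ [b])"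

text \<open>The second argument is the absolute address of the code, as jump targets are absolute. A
  zero test peeks at the cell left of the head, so either outcome must first move the head back to
  the right.\<close>

fun compile :: "com \<Rightarrow> nat \<Rightarrow> machine" where
  "compile (Inc r) a = [Work_Write r (Some True), Work_Right r]"
| "compile (Dec r) a = [Work_Left r, Work_Write r None]"
| "compile (c ;; d) a = compile c a @ compile d (a + length (compile c a))"
| "compile (IfPos r c d) a =
    (let C = compile c (Suc (Suc (Suc a))); l = Suc (Suc (Suc (Suc (a + length C)))); D = compile d (Suc l) in
      [Work_Left r, Work_Test r None l, Work_Right r] @ C @ [Jump (Suc l + length D), Work_Right r] @ D)"
| "compile (While r c) a =
    (let C = compile c (Suc (Suc (Suc a))) in
      [Work_Left r, Work_Test r None (Suc (Suc (Suc (Suc (a + length C))))), Work_Right r] @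
      C @ [Jump a, Work_Right r])"
| "compile (Read r) a =
    [In_Test False (Suc (Suc (Suc (Suc (Suc a))))), In_Right, Work_Write r (Some True), Work_Right r,
     Jump a, In_Right]"
| "compile (Emit b) a = [Out b]"

definition unary_tape :: "nat \<Rightarrow> int \<Rightarrow> symbol" where
  "unary_tape n z = (if 0 \<le> z \<and> z < int n then Some True else None)"

text \<open>Register \<open>t\<close> is kept in unary on tape \<open>t\<close>, with the head on the first blank after the block;
  it is zero iff the cell to the left of the head is blank, so no initialisation is needed.\<close>

definition conf :: "name \<Rightarrow> nat \<Rightarrow> state \<Rightarrow> config" where
  "conf p a s = (case s of (v, i, u) \<Rightarrow>
     \<lparr>pc = a, in_pos = (\<Sum>j<i. Suc (p j)), work = (\<lambda>t. unary_tape (v t)),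
      head = (\<lambda>t. int (v t)), out_word = u\<rparr>)"

section \<open>Reachability of configurations and correctness of the compiler\<close>

definition reach :: "machine \<Rightarrow> (nat \<Rightarrow> bool) \<Rightarrow> config \<Rightarrow> config \<Rightarrow> bool" where
  "reach M x c c' \<longleftrightarrow> (\<exists>t. (step M x ^^ t) c = c')"

lemma reach_refl: "reach M x c c"
  unfolding reach_def by (rule exI[of _ 0]) simp

lemma reach_trans [trans]:
  assumes "reach M x c c'" "reach M x c' c''"
  shows "reach M x c c''"
proof -
  obtain t t' where "(step M x ^^ t) c = c'" "(step M x ^^ t') c' = c''"
    using assms by (auto simp: reach_def)
  then have "(step M x ^^ (t' + t)) c = c''" by (simp add: funpow_add)
  then show ?thesis by (auto simp: reach_def)
qed

definition code_at :: "machine \<Rightarrow> nat \<Rightarrow> machine \<Rightarrow> bool" where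
  "code_at M a P \<longleftrightarrow> (\<forall>i<length P. a + i < length M \<and> M ! (a + i) = P ! i)"

lemma code_at_Nil [simp]: "code_at M a []"
  by (simp add: code_at_def)

lemma code_at_Cons [simp]:
  "code_at M a (I # P) \<longleftrightarrow> a < length M \<and> M ! a = I \<and> code_at M (Suc a) P"
proof -
  have "(\<forall>i<Suc (length P). a + i < length M \<and> M ! (a + i) = (I # P) ! i) \<longleftrightarrow>
    (a + 0 < length M \<and> M ! (a + 0) = I) \<and>
    (\<forall>i<length P. a + Suc i < length M \<and> M ! (a + Suc i) = P ! i)"
    by (subst All_less_Suc2) simp
  then show ?thesis by (simp add: code_at_def)
qed

lemma code_at_append [simp]:
  "code_at M a (P @ Q) \<longleftrightarrow> code_at M a P \<and> code_at M (a + length P) Q"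
  by (induction P arbitrary: a) auto

lemma reach_step:
  assumes "pc c < length M" "reach M x (exec (M ! pc c) x c) c'"
  shows "reach M x c c'"
proof -
  have "reach M x c (exec (M ! pc c) x c)"
    unfolding reach_def by (rule exI[of _ 1]) (simp add: step_def assms(1))
  then show ?thesis using assms(2) reach_trans by blast
qed

lemma reach_eq: "c = c' \<Longrightarrow> reach M x c c'"
  by (simp add: reach_refl)

lemma conf_record:
  "conf p a (v, i, u) = \<lparr>pc = a, in_pos = (\<Sum>j<i. Suc (p j)), work = (\<lambda>t. unary_tape (v t)),
      head = (\<lambda>t. int (v t)), out_word = u\<rparr>"
  by (simp add: conf_def)

lemma unary_tape_simps [simp]:
  "unary_tape n (- 1) = None"
  "unary_tape n (int n - 1) = (if n = 0 then None else Some True)"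
  by (auto simp: fun_eq_iff unary_tape_def)

text \<open>The positions of the zeros increase strictly with the index of the entry, so the only
  zero within the block of \<open>k\<close> is its last symbol.\<close>

lemma tape_in_block:
  assumes "i \<le> p k"
  shows "tape p ((\<Sum>j<k. Suc (p j)) + i) \<longleftrightarrow> i < p k"
proof -
  have mono: "(\<Sum>j<k. Suc (p j)) + p k < (\<Sum>j<l. Suc (p j)) + p l" if "k < l" for k l
  proof -
    have "(\<Sum>j<Suc k. Suc (p j)) \<le> (\<Sum>j<l. Suc (p j))"
      using that by (intro sum_mono2) auto
    then show ?thesis by simp
  qed
  show ?thesis
  proof (cases "i = p k")
    case True
    then show ?thesis by (auto simp: tape_def)
  next
    case False
    have "(\<Sum>j<k. Suc (p j)) + i \<noteq> (\<Sum>j<l. Suc (p j)) + p l" for l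
    proof (cases l k rule: linorder_cases)
      case less
      have "(\<Sum>j<Suc l. Suc (p j)) \<le> (\<Sum>j<k. Suc (p j))"
        using less by (intro sum_mono2) auto
      then show ?thesis by simp
    next
      case greater
      from mono[OF greater] show ?thesis using assms by simp
    qed (use False in simp)
    then show ?thesis using False assms by (auto simp: tape_def)
  qed
qed

lemma reach_read:
  assumes code: "code_at M a (compile (Read r) a)"
  shows "reach M (tape p) (conf p a (v, i, u))
    (conf p (a + length (compile (Read r) a)) (v(r := v r + p i), Suc i, u))"
proof -
  define b where "b = (\<Sum>j<i. Suc (p j))"
  let ?c = "\<lambda>k. \<lparr>pc = a, in_pos = b + k, work = (\<lambda>t. unary_tape ((v(r := v r + k)) t)),
      head = (\<lambda>t. int ((v(r := v r + k)) t)), out_word = u\<rparr>"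
  \<comment> \<open>\<open>?c k\<close> is the configuration at the loop head after \<open>k\<close>
    ones of the current block have been copied to the register.\<close>
  have loop: "k \<le> p i \<Longrightarrow> reach M (tape p) (?c 0) (?c k)" for k
  proof (induction k)
    case (Suc k)
    have t: "tape p (b + k)"
      using tape_in_block[of k p i] Suc.prems by (simp add: b_def)
    have "reach M (tape p) (?c k) (?c (Suc k))"
      using code t
      apply simp
      apply (rule reach_step, simp, simp)
      apply (rule reach_step, simp, simp)
      apply (rule reach_step, simp, simp)
      apply (rule reach_step, simp, simp)
      apply (rule reach_step, simp, simp)
      apply (rule reach_eq)
      apply (auto simp: fun_eq_iff unary_tape_def)
      done
    then show ?case using Suc reach_trans Suc_leD by blast
  qed (simp add: reach_refl)
  have "\<not> tape p (b + p i)"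
    using tape_in_block[of "p i" p i] by (simp add: b_def)
  then have "reach M (tape p) (?c (p i)) (conf p (Suc (Suc (Suc (Suc (Suc (Suc a)))))) (v(r := v r + p i), Suc i, u))"
    using code
    apply simp
    apply (rule reach_step, simp, simp)
    apply (rule reach_step, simp, simp)
    apply (rule reach_eq)
    apply (auto simp: fun_eq_iff conf_record b_def)
    done
  with loop[of "p i"] have "reach M (tape p) (?c 0)
    (conf p (Suc (Suc (Suc (Suc (Suc (Suc a)))))) (v(r := v r + p i), Suc i, u))"
    using reach_trans by blast
  moreover have "?c 0 = conf p a (v, i, u)"
    by (auto simp: conf_record b_def)
  ultimately show ?thesis by simp
qed

text \<open>Induction on the evaluation, not on the syntax: in the loop case the remaining
  iterations are again an evaluation of the same loop at the same address.\<close>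

lemma compile_correct:
  assumes "bigstep p c s s'" "code_at M a (compile c a)"
  shows "reach M (tape p) (conf p a s) (conf p (a + length (compile c a)) s')"
  using assms
proof (induction arbitrary: a)
  case (Inc r v i u)
  then show ?case
    apply (simp add: conf_record)
    apply (rule reach_step, simp, simp)
    apply (rule reach_step, simp, simp)
    apply (rule reach_eq)
    apply (auto simp: fun_eq_iff unary_tape_def)
    done
next
  case (Dec v r i u)
  then show ?case
    apply (simp add: conf_record)
    apply (rule reach_step, simp, simp)
    apply (rule reach_step, simp, simp)
    apply (rule reach_eq)
    apply (auto simp: fun_eq_iff unary_tape_def)
    done
next
  case (Seq c s s' d s'')
  from Seq.IH(1)[of a] Seq.IH(2)[of "a + length (compile c a)"] Seq.prems
  show ?case by (simp add: reach_trans add.assoc)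
next
  case (IfT v r c i u s d)
  let ?a = "Suc (Suc (Suc a))"
  have "reach M (tape p) (conf p a (v, i, u)) (conf p ?a (v, i, u))"
    using IfT.prems IfT.hyps(1)
    apply (simp add: conf_record Let_def)
    apply (rule reach_step, simp, simp)
    apply (rule reach_step, simp, simp)
    apply (rule reach_step, simp, simp)
    apply (rule reach_eq)
    apply (auto simp: fun_eq_iff)
    done
  also have "reach M (tape p) (conf p ?a (v, i, u)) (conf p (?a + length (compile c ?a)) s)"
    using IfT.prems by (intro IfT.IH) (simp_all add: Let_def)
  also have "reach M (tape p) (conf p (?a + length (compile c ?a)) s)
    (conf p (a + length (compile (IfPos r c d) a)) s)"
    using IfT.prems
    apply (cases s)
    apply (simp add: conf_record Let_def)
    apply (rule reach_step, simp, simp)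
    apply (rule reach_eq)
    apply (auto simp: fun_eq_iff)
    done
  finally show ?case .
next
  case (IfF v r d i u s c)
  let ?l = "Suc (Suc (Suc (Suc (Suc (a + length (compile c (Suc (Suc (Suc a)))))))))"
  have "reach M (tape p) (conf p a (v, i, u)) (conf p ?l (v, i, u))"
    using IfF.prems IfF.hyps(1)
    apply (simp add: conf_record Let_def)
    apply (rule reach_step, simp, simp)
    apply (rule reach_step, simp, simp)
    apply (rule reach_step, simp, simp)
    apply (rule reach_eq)
    apply (auto simp: fun_eq_iff)
    done
  also have "reach M (tape p) (conf p ?l (v, i, u)) (conf p (?l + length (compile d ?l)) s)"
    using IfF.prems by (intro IfF.IH) (simp_all add: Let_def)
  finally show ?case by (simp add: Let_def add.assoc)
next
  case (WhileF v r c i u)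
  then show ?case
    apply (simp add: conf_record Let_def)
    apply (rule reach_step, simp, simp)
    apply (rule reach_step, simp, simp)
    apply (rule reach_step, simp, simp)
    apply (rule reach_eq)
    apply (auto simp: fun_eq_iff)
    done
next
  case (WhileT v r c i u s s')
  let ?a = "Suc (Suc (Suc a))"
  have "reach M (tape p) (conf p a (v, i, u)) (conf p ?a (v, i, u))"
    using WhileT.prems WhileT.hyps(1)
    apply (simp add: conf_record Let_def)
    apply (rule reach_step, simp, simp)
    apply (rule reach_step, simp, simp)
    apply (rule reach_step, simp, simp)
    apply (rule reach_eq)
    apply (auto simp: fun_eq_iff)
    done
  also have "reach M (tape p) (conf p ?a (v, i, u)) (conf p (?a + length (compile c ?a)) s)"
    using WhileT.prems by (intro WhileT.IH) (simp_all add: Let_def)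
  also have "reach M (tape p) (conf p (?a + length (compile c ?a)) s) (conf p a s)"
    using WhileT.prems
    apply (cases s)
    apply (simp add: conf_record Let_def)
    apply (rule reach_step, simp, simp)
    apply (rule reach_eq)
    apply (auto simp: fun_eq_iff)
    done
  also have "reach M (tape p) (conf p a s) (conf p (a + length (compile (While r c) a)) s')"
    by (rule WhileT.IH) (rule WhileT.prems)
  finally show ?case .
next
  case (Read r v i u)
  then show ?case using reach_read by blast
next
  case (Emit b v i u)
  then show ?case
    apply (simp add: conf_record)
    apply (rule reach_step, simp, simp)
    apply (rule reach_eq)
    apply auto
    done
qed

section \<open>Primitive recursive functions\<close>

abbreviation "pfst n \<equiv> fst (prod_decode n)"
abbreviation "psnd n \<equiv> snd (prod_decode n)"

text \<open>A unary presentation of the primitive recursive functions: pairing replaces several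
  arguments, and iteration, with start value and count packed into a pair, replaces the recursion
  scheme.\<close>

inductive PR :: "(nat \<Rightarrow> nat) \<Rightarrow> bool" where
  PR_zero: "PR (\<lambda>_. 0)"
| PR_id: "PR (\<lambda>n. n)"
| PR_Suc: "PR Suc"
| PR_pfst: "PR (\<lambda>n. pfst n)"
| PR_psnd: "PR (\<lambda>n. psnd n)"
| PR_comp: "PR f \<Longrightarrow> PR g \<Longrightarrow> PR (\<lambda>n. f (g n))"
| PR_pair: "PR f \<Longrightarrow> PR g \<Longrightarrow> PR (\<lambda>n. prod_encode (f n, g n))"
| PR_iter: "PR f \<Longrightarrow> PR (\<lambda>n. (f ^^ psnd n) (pfst n))"

section \<open>Register programs for the primitive recursive functions\<close>

definition clear :: "nat \<Rightarrow> com" where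
  "clear r = While r (Dec r)"

definition move :: "nat \<Rightarrow> nat \<Rightarrow> com" where
  "move r s = While r (Dec r ;; Inc s)"

definition fork :: "nat \<Rightarrow> nat \<Rightarrow> nat \<Rightarrow> com" where
  "fork r s t = While r (Dec r ;; Inc s ;; Inc t)"

definition copy :: "nat \<Rightarrow> nat \<Rightarrow> nat \<Rightarrow> com" where
  "copy r s t = clear s ;; clear t ;; fork r s t ;; move t r"

text \<open>Uses \<open>prod_encode (x, y) = triangle (x + y) + x\<close>: the loop counts register
  \<open>k + 1\<close> down from \<open>x + y\<close> and adds every value it takes to register
  \<open>k + 2\<close>, which starts at \<open>x\<close>.\<close>

definition pack :: "nat \<Rightarrow> com" where
  "pack k = clear (k + 2) ;; clear (k + 3) ;; fork k (k + 1) (k + 2) ;;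
    While (k + 1) (fork (k + 1) (k + 2) (k + 3) ;; move (k + 3) (k + 1) ;; Dec (k + 1)) ;;
    move (k + 2) k"

text \<open>Avoids square roots by walking along the diagonals of the Cantor enumeration: starting
  from \<open>(0, 0)\<close>, the pair in registers \<open>k + 1\<close> and \<open>k + 2\<close> is
  advanced by \<open>prod_decode_Suc\<close> once for each unit of register
  \<open>k\<close>.\<close>

definition unpack :: "nat \<Rightarrow> com" where
  "unpack k = clear (k + 1) ;; clear (k + 2) ;;
    While k (Dec k ;; IfPos (k + 2) (Dec (k + 2) ;; Inc (k + 1)) (move (k + 1) (k + 2) ;; Inc (k + 2))) ;;
    move (k + 1) k ;; move (k + 2) (k + 1)"

lemma bigstep_eq: "bigstep p c s s' \<Longrightarrow> s' = s'' \<Longrightarrow> bigstep p c s s''"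
  by simp

lemma clear_correct: "bigstep p (clear r) (v, i, u) (v(r := 0), i, u)"
proof (induction "v r" arbitrary: v)
  case 0
  then show ?case
    unfolding clear_def by - (rule bigstep_eq[OF WhileF], auto)
next
  case (Suc n)
  have "bigstep p (clear r) (v(r := v r - 1), i, u) (v(r := 0), i, u)"
    using Suc(1)[of "v(r := v r - 1)"] Suc(2) by simp
  then show ?case
    unfolding clear_def using Suc(2) by - (rule WhileT[OF _ Dec], auto)
qed

lemma move_correct:
  assumes "r \<noteq> s"
  shows "bigstep p (move r s) (v, i, u) (v(r := 0, s := v s + v r), i, u)"
proof (induction "v r" arbitrary: v)
  case 0
  then show ?case
    unfolding move_def by - (rule bigstep_eq[OF WhileF], auto)
next
  case (Suc n)
  let ?v = "v(r := v r - 1, s := Suc (v s))"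
  have "bigstep p (move r s) (?v, i, u) (?v(r := 0, s := ?v s + ?v r), i, u)"
    using Suc(1)[of ?v] Suc(2) assms by simp
  also have "?v(r := 0, s := ?v s + ?v r) = v(r := 0, s := v s + v r)"
    using assms Suc(2) by (auto simp: fun_eq_iff)
  finally have IH: "bigstep p (move r s) (?v, i, u) (v(r := 0, s := v s + v r), i, u)" .
  show ?case
    unfolding move_def
    by (rule WhileT[OF _ Seq[OF Dec bigstep_eq[OF Inc]] IH[unfolded move_def]])
       (use Suc(2) assms in auto)
qed

lemma fork_correct:
  assumes "r \<noteq> s" "r \<noteq> t" "s \<noteq> t"
  shows "bigstep p (fork r s t) (v, i, u) (v(r := 0, s := v s + v r, t := v t + v r), i, u)"
proof (induction "v r" arbitrary: v)
  case 0
  then show ?case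
    unfolding fork_def using assms by - (rule bigstep_eq[OF WhileF], auto)
next
  case (Suc n)
  let ?v = "v(r := v r - 1, s := Suc (v s), t := Suc (v t))"
  let ?w = "\<lambda>v. v(r := 0, s := v s + v r, t := v t + v r)"
  have "bigstep p (fork r s t) (?v, i, u) (?w ?v, i, u)"
    using Suc(1)[of ?v] Suc(2) assms by simp
  also have "?w ?v = ?w v"
    using assms Suc(2) by (auto simp: fun_eq_iff)
  finally have IH: "bigstep p (fork r s t) (?v, i, u) (?w v, i, u)" .
  show ?case
    unfolding fork_def
    by (rule WhileT[OF _ Seq[OF Dec Seq[OF Inc bigstep_eq[OF Inc]]] IH[unfolded fork_def]])
       (use Suc(2) assms in auto)
qed

lemma copy_correct:
  assumes "r \<noteq> s" "r \<noteq> t" "s \<noteq> t"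
  shows "bigstep p (copy r s t) (v, i, u) (v(s := v r, t := 0), i, u)"
  unfolding copy_def
  apply (rule bigstep_eq)
   apply (rule Seq, rule clear_correct)
   apply (rule Seq, rule clear_correct)
   apply (rule Seq, rule fork_correct, (fact assms)+)
   apply (rule move_correct)
  using assms by (auto simp: fun_eq_iff)

lemma pack_correct:
  "bigstep p (pack k) (v, i, u)
    (v(k := prod_encode (v k, v (k + 1)), k + 1 := 0, k + 2 := 0, k + 3 := 0), i, u)"
proof -
  let ?W = "While (k + 1) (fork (k + 1) (k + 2) (k + 3) ;; move (k + 3) (k + 1) ;; Dec (k + 1))"
  have loop: "v (k + 3) = 0 \<Longrightarrow> bigstep p ?W (v, i, u)
    (v(k + 1 := 0, k + 2 := v (k + 2) + triangle (v (k + 1))), i, u)" for v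
  proof (induction "v (k + 1)" arbitrary: v)
    case 0
    then show ?case by - (rule bigstep_eq[OF WhileF], auto)
  next
    case (Suc n)
    let ?v = "v(k + 1 := v (k + 1) - 1, k + 2 := v (k + 2) + v (k + 1))"
    let ?w = "\<lambda>v. v(k + 1 := 0, k + 2 := v (k + 2) + triangle (v (k + 1)))"
    have "bigstep p ?W (?v, i, u) (?w ?v, i, u)"
      using Suc(1)[of ?v] Suc(2,3) by (simp add: numeral_eq_Suc)
    also have "?w ?v = ?w v"
      using Suc(2)[symmetric] by (auto simp: fun_eq_iff)
    finally have IH: "bigstep p ?W (?v, i, u) (?w v, i, u)" .
    show ?case
      apply (rule WhileT[OF _ _ IH])
      using Suc(2) apply simp
      apply (rule Seq, rule fork_correct, simp, simp, simp)
      apply (rule Seq, rule move_correct, simp)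
      apply (rule bigstep_eq, rule Dec)
      using Suc(2,3) apply (auto simp: fun_eq_iff)
      done
  qed
  show ?thesis
    unfolding pack_def
    apply (rule bigstep_eq)
     apply (rule Seq, rule clear_correct)
     apply (rule Seq, rule clear_correct)
     apply (rule Seq, rule fork_correct, simp, simp, simp)
     apply (rule Seq, rule loop, simp)
     apply (rule move_correct, simp)
    apply (auto simp: fun_eq_iff prod_encode_def add.commute)
    done
qed

lemma prod_decode_Suc:
  "prod_decode (Suc n) = (case prod_decode n of (a, b) \<Rightarrow> if 0 < b then (Suc a, b - 1) else (0, Suc a))"
proof -
  obtain a b where "prod_decode n = (a, b)" by fastforce
  then have n: "n = prod_encode (a, b)" by (metis prod_decode_inverse)
  have "Suc n = prod_encode (if 0 < b then (Suc a, b - 1) else (0, Suc a))"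
    by (cases b) (simp_all add: n prod_encode_def)
  then have "prod_decode (Suc n) = (if 0 < b then (Suc a, b - 1) else (0, Suc a))"
    by (simp del: if_split)
  then show ?thesis by (simp add: n)
qed

lemma prod_decode_0: "prod_decode 0 = (0, 0)"
  by (simp add: prod_decode_def prod_decode_aux.simps)

lemma unpack_correct:
  "bigstep p (unpack k) (v, i, u) (v(k := pfst (v k), k + 1 := psnd (v k), k + 2 := 0), i, u)"
proof -
  let ?W = "While k (Dec k ;; IfPos (k + 2) (Dec (k + 2) ;; Inc (k + 1)) (move (k + 1) (k + 2) ;; Inc (k + 2)))"
  let ?w = "\<lambda>v m. v(k := 0, k + 1 := pfst (m + v k), k + 2 := psnd (m + v k))"
  \<comment> \<open>\<open>m\<close> is the number of steps already made along the enumeration;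
    generalising over it makes the induction on the remaining count possible.\<close>
  have loop: "v (k + 1) = pfst m \<Longrightarrow> v (k + 2) = psnd m \<Longrightarrow> bigstep p ?W (v, i, u) (?w v m, i, u)" for v m
  proof (induction "v k" arbitrary: v m)
    case 0
    then show ?case by (intro bigstep_eq[OF WhileF]) (auto simp: fun_eq_iff)
  next
    case (Suc n)
    let ?v = "v(k := v k - 1, k + 1 := pfst (Suc m), k + 2 := psnd (Suc m))"
    have "bigstep p ?W (?v, i, u) (?w ?v (Suc m), i, u)"
      using Suc(1)[of ?v "Suc m"] Suc(2) by simp
    also have "?w ?v (Suc m) = ?w v m"
      using Suc(2)[symmetric] by (auto simp: fun_eq_iff)
    finally have IH: "bigstep p ?W (?v, i, u) (?w v m, i, u)" .
    show ?case
    proof (rule WhileT[OF _ Seq[OF Dec] IH])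
      show "bigstep p (IfPos (k + 2) (Dec (k + 2) ;; Inc (k + 1)) (move (k + 1) (k + 2) ;; Inc (k + 2)))
        (v(k := v k - 1), i, u) (?v, i, u)"
      proof (cases "0 < v (k + 2)")
        case True
        then show ?thesis
          apply -
          apply (rule IfT, simp)
          apply (rule Seq, rule Dec, simp)
          apply (rule bigstep_eq, rule Inc)
          using Suc(3,4) apply (auto simp: fun_eq_iff prod_decode_Suc split: prod.splits)
          done
      next
        case False
        then show ?thesis
          apply -
          apply (rule IfF, simp)
          apply (rule Seq, rule move_correct, simp)
          apply (rule bigstep_eq, rule Inc)
          using Suc(3,4) apply (auto simp: fun_eq_iff prod_decode_Suc split: prod.splits)
          done
      qed
    qed (use Suc(2) in simp_all)
  qed
  show ?thesis
    unfolding unpack_def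
    apply (rule bigstep_eq)
     apply (rule Seq, rule clear_correct)
     apply (rule Seq, rule clear_correct)
     apply (rule Seq, rule loop[of _ 0], simp add: prod_decode_0, simp add: prod_decode_0)
     apply (rule Seq, rule move_correct, simp)
     apply (rule move_correct, simp)
    apply (auto simp: fun_eq_iff)
    done
qed

text \<open>\<open>P k\<close> finds its argument in register \<open>k\<close>, leaves its result there, and may only use the
  registers above \<open>k\<close>, whose initial contents are arbitrary.\<close>

definition computes :: "(nat \<Rightarrow> com) \<Rightarrow> (nat \<Rightarrow> nat) \<Rightarrow> bool" where
  "computes P f \<longleftrightarrow> (\<forall>p k v i u. \<exists>v'. bigstep p (P k) (v, i, u) (v', i, u) \<and>
     v' k = f (v k) \<and> (\<forall>j<k. v' j = v j))"

lemma computesI: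
  assumes "\<And>p k v i u. \<exists>v'. bigstep p (P k) (v, i, u) (v', i, u) \<and>
     v' k = f (v k) \<and> (\<forall>j<k. v' j = v j)"
  shows "computes P f"
  using assms unfolding computes_def by blast

lemma computesE:
  assumes "computes P f"
  obtains v' where "bigstep p (P k) (v, i, u) (v', i, u)" "v' k = f (v k)" "\<And>j. j < k \<Longrightarrow> v' j = v j"
  using assms unfolding computes_def by metis

lemma PR_program: "PR f \<Longrightarrow> \<exists>P. computes P f"
proof (induction rule: PR.induct)
  case PR_zero
  have "computes clear (\<lambda>_. 0)"
    by (rule computesI, rule exI, rule conjI[OF clear_correct]) auto
  then show ?case by blast
next
  case PR_id
  have "computes (\<lambda>k. clear (k + 1)) (\<lambda>n. n)"
    by (rule computesI, rule exI, rule conjI[OF clear_correct]) auto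
  then show ?case by blast
next
  case PR_Suc
  have "computes Inc Suc"
    by (rule computesI, rule exI, rule conjI[OF bigstep.Inc]) auto
  then show ?case by blast
next
  case PR_pfst
  have "computes unpack (\<lambda>n. pfst n)"
    by (rule computesI, rule exI, rule conjI[OF unpack_correct]) auto
  then show ?case by blast
next
  case PR_psnd
  have "computes (\<lambda>k. unpack k ;; clear k ;; move (k + 1) k) (\<lambda>n. psnd n)"
    by (rule computesI, rule exI, rule conjI,
        rule Seq[OF unpack_correct Seq[OF clear_correct move_correct]]) auto
  then show ?case by blast
next
  case (PR_comp f g)
  then obtain P Q where P: "computes P f" and Q: "computes Q g" by blast
  have "computes (\<lambda>k. Q k ;; P k) (\<lambda>n. f (g n))"
  proof (rule computesI)
    fix p :: name and k i :: nat and v :: "nat \<Rightarrow> nat" and u :: "bool list"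
    obtain v' where v': "bigstep p (Q k) (v, i, u) (v', i, u)" "v' k = g (v k)" "\<And>j. j < k \<Longrightarrow> v' j = v j"
      by (rule computesE[OF Q, where p = p and k = k and v = v and i = i and u = u]) (rule that)
    obtain v'' where v'': "bigstep p (P k) (v', i, u) (v'', i, u)" "v'' k = f (v' k)" "\<And>j. j < k \<Longrightarrow> v'' j = v' j"
      by (rule computesE[OF P, where p = p and k = k and v = "v'" and i = i and u = u]) (rule that)
    show "\<exists>v'. bigstep p (Q k ;; P k) (v, i, u) (v', i, u) \<and> v' k = f (g (v k)) \<and> (\<forall>j<k. v' j = v j)"
      using Seq[OF v'(1) v''(1)] v' v'' by auto
  qed
  then show ?case by blast
next
  case (PR_pair f g)
  then obtain P Q where P: "computes P f" and Q: "computes Q g" by blast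
  \<comment> \<open>The argument stays in register \<open>k\<close>, out of reach of both
    subprograms. The values of \<open>g\<close> and \<open>f\<close> arise in registers
    \<open>k + 1\<close> and \<open>k + 2\<close>; the latter is moved to \<open>k\<close>, where
    \<open>pack\<close> expects the first component.\<close>
  have "computes (\<lambda>k. copy k (k + 1) (k + 2) ;; Q (k + 1) ;; copy k (k + 2) (k + 3) ;; P (k + 2) ;;
    clear k ;; move (k + 2) k ;; pack k) (\<lambda>n. prod_encode (f n, g n))" (is "computes ?R _")
  proof (rule computesI)
    fix p :: name and k i :: nat and v :: "nat \<Rightarrow> nat" and u :: "bool list"
    let ?v1 = "v(k + 1 := v k, k + 2 := 0)"
    obtain v2 where v2: "bigstep p (Q (k + 1)) (?v1, i, u) (v2, i, u)" "v2 (k + 1) = g (?v1 (k + 1))"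
      "\<And>j. j < k + 1 \<Longrightarrow> v2 j = ?v1 j"
      by (rule computesE[OF Q, where p = p and k = "k + 1" and v = "?v1" and i = "i" and u = "u"]) (rule that)
    let ?v3 = "v2(k + 2 := v2 k, k + 3 := 0)"
    obtain v4 where v4: "bigstep p (P (k + 2)) (?v3, i, u) (v4, i, u)" "v4 (k + 2) = f (?v3 (k + 2))"
      "\<And>j. j < k + 2 \<Longrightarrow> v4 j = ?v3 j"
      by (rule computesE[OF P, where p = p and k = "k + 2" and v = "?v3" and i = "i" and u = "u"]) (rule that)
    show "\<exists>v'. bigstep p (?R k) (v, i, u) (v', i, u) \<and> v' k = prod_encode (f (v k), g (v k)) \<and>
      (\<forall>j<k. v' j = v j)"
      apply (rule exI, rule conjI)
       apply (rule Seq, rule copy_correct, simp, simp, simp)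
       apply (rule Seq, rule v2(1))
       apply (rule Seq, rule copy_correct, simp, simp, simp)
       apply (rule Seq, rule v4(1))
       apply (rule Seq, rule clear_correct)
       apply (rule Seq, rule move_correct, simp)
       apply (rule pack_correct)
      using v2(2) v2(3)[of k] v4(2) v4(3)[of "k + 1"] v2(3) v4(3) by auto
  qed
  then show ?case by blast
next
  case (PR_iter f)
  then obtain P where P: "computes P f" by blast
  \<comment> \<open>The counter sits below the iterated value, so the body, which runs at
    \<open>k + 1\<close>, cannot change it.\<close>
  let ?W = "\<lambda>k. While k (Dec k ;; P (k + 1))"
  have loop: "\<exists>v'. bigstep p (?W k) (v, i, u) (v', i, u) \<and> v' k = 0 \<and>
    v' (k + 1) = (f ^^ v k) (v (k + 1)) \<and> (\<forall>j<k. v' j = v j)" for p k v i u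
  proof (induction "v k" arbitrary: v)
    case 0
    then show ?case
      by (intro exI[of _ v]) (auto intro: WhileF)
  next
    case (Suc n)
    let ?v1 = "v(k := v k - 1)"
    obtain v2 where v2: "bigstep p (P (k + 1)) (?v1, i, u) (v2, i, u)" "v2 (k + 1) = f (?v1 (k + 1))"
      "\<And>j. j < k + 1 \<Longrightarrow> v2 j = ?v1 j"
      by (rule computesE[OF P, where p = p and k = "k + 1" and v = "?v1" and i = "i" and u = "u"]) (rule that)
    have v2k: "v2 k = n" using v2(3)[of k] Suc(2) by simp
    obtain v3 where v3: "bigstep p (?W k) (v2, i, u) (v3, i, u)" "v3 k = 0"
      "v3 (k + 1) = (f ^^ v2 k) (v2 (k + 1))" "\<And>j. j < k \<Longrightarrow> v3 j = v2 j"
      using Suc(1)[of v2] v2k by blast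
    have "bigstep p (?W k) (v, i, u) (v3, i, u)"
      using Suc(2) by - (rule WhileT[OF _ Seq[OF Dec v2(1)] v3(1)], auto)
    moreover have "v3 (k + 1) = (f ^^ v k) (v (k + 1))"
      using v3(3) v2k v2(2) Suc(2)[symmetric] by (simp add: funpow_swap1)
    ultimately show ?case using v2(3) v3 by auto
  qed
  have "computes (\<lambda>k. (unpack k ;; move k (k + 2) ;; move (k + 1) k ;; move (k + 2) (k + 1)) ;; ?W k ;; move (k + 1) k)
    (\<lambda>n. (f ^^ psnd n) (pfst n))" (is "computes ?R _")
  proof (rule computesI)
    fix p :: name and k i :: nat and v :: "nat \<Rightarrow> nat" and u :: "bool list"
    let ?v = "v(k := psnd (v k), k + 1 := pfst (v k), k + 2 := 0)"
    obtain v' where v': "bigstep p (?W k) (?v, i, u) (v', i, u)" "v' k = 0"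
      "v' (k + 1) = (f ^^ ?v k) (?v (k + 1))" "\<And>j. j < k \<Longrightarrow> v' j = ?v j"
      using loop[of p k ?v] by blast
    have init: "bigstep p (unpack k ;; move k (k + 2) ;; move (k + 1) k ;; move (k + 2) (k + 1)) (v, i, u) (?v, i, u)"
      apply (rule bigstep_eq)
       apply (rule Seq, rule unpack_correct)
       apply (rule Seq, rule move_correct, simp)
       apply (rule Seq, rule move_correct, simp)
       apply (rule move_correct, simp)
      apply (auto simp: fun_eq_iff)
      done
    have "bigstep p (?R k) (v, i, u) (v'(k + 1 := 0, k := v' k + v' (k + 1)), i, u)"
      by (rule Seq[OF init Seq[OF v'(1) move_correct]]) simp
    then show "\<exists>v'. bigstep p (?R k) (v, i, u) (v', i, u) \<and> v' k = (f ^^ psnd (v k)) (pfst (v k)) \<and>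
      (\<forall>j<k. v' j = v j)"
      using v' by (intro exI[of _ "v'(k + 1 := 0, k := v' k + v' (k + 1))"]) auto
  qed
  then show ?case by blast
qed

subsection \<open>Transducers\<close>

text \<open>\<open>g\<close> maps a pair of state and next input entry to a pair of new state and
  output value; the output value 0 means that nothing is written, \<open>Suc n\<close> that the
  entry \<open>n\<close> is.\<close>

primrec trans_state :: "(nat \<Rightarrow> nat) \<Rightarrow> name \<Rightarrow> nat \<Rightarrow> nat" where
  "trans_state g p 0 = 0"
| "trans_state g p (Suc s) = pfst (g (prod_encode (trans_state g p s, p s)))"

definition trans_val :: "(nat \<Rightarrow> nat) \<Rightarrow> name \<Rightarrow> nat \<Rightarrow> nat" where
  "trans_val g p s = psnd (g (prod_encode (trans_state g p s, p s)))"

definition unary_word :: "nat \<Rightarrow> bool list" where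
  "unary_word n = replicate n True @ [False]"

primrec trans_out :: "(nat \<Rightarrow> nat) \<Rightarrow> name \<Rightarrow> nat \<Rightarrow> bool list" where
  "trans_out g p 0 = []"
| "trans_out g p (Suc s) = trans_out g p s @
    (case trans_val g p s of 0 \<Rightarrow> [] | Suc n \<Rightarrow> unary_word n)"

lemma emit_correct:
  "bigstep p (While r (Dec r ;; Emit True)) (v, i, u) (v(r := 0), i, u @ replicate (v r) True)"
proof (induction "v r" arbitrary: v u)
  case 0
  then show ?case by - (rule bigstep_eq[OF WhileF], auto)
next
  case (Suc n)
  have "bigstep p (While r (Dec r ;; Emit True)) (v(r := v r - 1), i, u @ [True])
     (v(r := 0), i, u @ replicate (v r) True)"
    using Suc(1)[of "v(r := v r - 1)" "u @ [True]"] Suc(2)[symmetric] by simp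
  then show ?case
    using Suc(2) by - (rule WhileT[OF _ Seq[OF Dec Emit]], auto)
qed

text \<open>Register 0 keeps the state, register 1 first the entry read and then the value to be
  written. The start state 0 is what blank tapes represent, and the final jump turns the body into
  an endless loop.\<close>

lemma transducer_machine:
  assumes "PR g"
  shows "\<exists>M. \<forall>p s. \<exists>t. out_word (run M (tape p) t) = trans_out g p s"
proof -
  obtain P where P: "computes P g" using PR_program[OF assms] by blast
  define emit where "emit = IfPos 1 (Dec 1 ;; While 1 (Dec 1 ;; Emit True) ;; Emit False) (clear 1)"
  define body where "body = (clear 1 ;; Read 1 ;; pack 0) ;; P 0 ;; unpack 0 ;; emit"
  define M where "M = compile body 0 @ [Jump 0]"
  have emit: "bigstep p emit (v, i, u)
    (v(1 := 0), i, u @ (case v 1 of 0 \<Rightarrow> [] | Suc n \<Rightarrow> unary_word n))" for p v i u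
  proof (cases "v 1")
    case 0
    then show ?thesis
      unfolding emit_def by (intro IfF) (auto intro: bigstep_eq[OF clear_correct])
  next
    case (Suc n)
    then show ?thesis
      unfolding emit_def
      apply -
          apply (rule IfT, simp)
      apply (rule bigstep_eq)
       apply (rule Seq, rule Dec, simp)
       apply (rule Seq, rule emit_correct, rule Emit)
      apply (auto simp: unary_word_def)
      done
  qed
  have "\<exists>v. v 0 = trans_state g p s \<and>
    reach M (tape p) (conf p 0 (\<lambda>_. 0, 0, [])) (conf p 0 (v, s, trans_out g p s))" for p s
  proof (induction s)
    case 0
    show ?case by (rule exI[of _ "\<lambda>_. 0"]) (simp add: reach_refl)
  next
    case (Suc s)
    then obtain v where v: "v 0 = trans_state g p s"
      "reach M (tape p) (conf p 0 (\<lambda>_. 0, 0, [])) (conf p 0 (v, s, trans_out g p s))" by blast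
    let ?u = "trans_out g p s"
    let ?v1 = "v(0 := prod_encode (v 0, p s), 1 := 0, 2 := 0, 3 := 0)"
    obtain v2 where v2: "bigstep p (P 0) (?v1, Suc s, ?u) (v2, Suc s, ?u)" "v2 0 = g (?v1 0)"
      by (rule computesE[OF P, where p = p and k = "0" and v = "?v1" and i = "Suc s" and u = "?u"]) (rule that)
    let ?v3 = "v2(0 := pfst (v2 0), 1 := psnd (v2 0), 2 := 0)"
    have init: "bigstep p (clear 1 ;; Read 1 ;; pack 0) (v, s, ?u) (?v1, Suc s, ?u)"
      by (rule bigstep_eq, rule Seq[OF clear_correct Seq[OF Read pack_correct]])
         (auto simp: fun_eq_iff numeral_eq_Suc)
    have unpack: "bigstep p (unpack 0) (v2, Suc s, ?u) (?v3, Suc s, ?u)"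
      by (rule bigstep_eq, rule unpack_correct) (auto simp: fun_eq_iff numeral_eq_Suc)
    have "bigstep p body (v, s, ?u) (?v3(1 := 0), Suc s, trans_out g p (Suc s))"
      unfolding body_def
      apply (rule bigstep_eq)
       apply (rule Seq[OF init Seq[OF v2(1) Seq[OF unpack emit]]])
      using v2(2) apply (simp add: v(1) trans_val_def)
      done
    moreover have "code_at M 0 (compile body 0)"
      by (simp add: M_def code_at_def nth_append)
    ultimately have "reach M (tape p) (conf p 0 (v, s, ?u))
        (conf p (0 + length (compile body 0)) (?v3(1 := 0), Suc s, trans_out g p (Suc s)))"
      by (rule compile_correct)
    also have "reach M (tape p) \<dots> (conf p 0 (?v3(1 := 0), Suc s, trans_out g p (Suc s)))"
      by (rule reach_step) (auto simp: M_def conf_record reach_refl)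
    finally have "reach M (tape p) (conf p 0 (\<lambda>_. 0, 0, []))
        (conf p 0 (?v3(1 := 0), Suc s, trans_out g p (Suc s)))"
      using v(2) reach_trans by blast
    moreover have "(?v3(1 := 0)) 0 = trans_state g p (Suc s)"
      using v2(2) v(1) by simp
    ultimately show ?case by blast
  qed
  moreover have "conf p 0 (\<lambda>_. 0, 0, []) = init_config" for p
    by (auto simp: conf_record init_config_def unary_tape_def fun_eq_iff)
  ultimately have "\<exists>t. out_word (run M (tape p) t) = trans_out g p s" for p s
    unfolding reach_def run_def by (metis conf_record config.select_convs(5))
  then show ?thesis by blast
qed

section \<open>Closure properties of the primitive recursive functions\<close>

named_theorems PR_intro

lemma PR_const [PR_intro]: "PR (\<lambda>_. c)"
proof (induction c)
  case (Suc c)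
  then show ?case using PR_comp[OF PR_Suc, of "\<lambda>_. c"] by simp
qed (rule PR_zero)

lemma PR_Suc' [PR_intro]: "PR f \<Longrightarrow> PR (\<lambda>n. Suc (f n))"
  by (rule PR_comp[OF PR_Suc])

lemma PR_pfst' [PR_intro]: "PR f \<Longrightarrow> PR (\<lambda>n. pfst (f n))"
  by (rule PR_comp[OF PR_pfst])

lemma PR_psnd' [PR_intro]: "PR f \<Longrightarrow> PR (\<lambda>n. psnd (f n))"
  by (rule PR_comp[OF PR_psnd])

declare PR_id [PR_intro] PR_pair [PR_intro]

text \<open>The basic iteration has no parameter; here \<open>n\<close> is carried along unchanged
  in the first component of the iterated pair.\<close>

lemma PR_funpow [PR_intro]:
  assumes "PR (\<lambda>n. f (pfst n) (psnd n))" "PR g" "PR h"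
  shows "PR (\<lambda>n. (f n ^^ g n) (h n))"
proof -
  let ?F = "\<lambda>z. prod_encode (pfst z, f (pfst z) (psnd z))"
  have "(?F ^^ m) (prod_encode (n, x)) = prod_encode (n, (f n ^^ m) x)" for n m x
    by (induction m) auto
  then have "(\<lambda>n. (f n ^^ g n) (h n)) =
    (\<lambda>n. psnd ((\<lambda>z. (?F ^^ psnd z) (pfst z)) (prod_encode (prod_encode (n, h n), g n))))"
    by simp
  moreover have "PR \<dots>"
    by (rule PR_psnd'[OF PR_comp[OF PR_iter]]) (intro PR_intro assms)+
  ultimately show ?thesis by (simp only:)
qed

lemma PR_rec_nat [PR_intro]:
  assumes "PR h" "PR (\<lambda>n. f (pfst n) (pfst (psnd n)) (psnd (psnd n)))" "PR g"
  shows "PR (\<lambda>n. rec_nat (h n) (f n) (g n))"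
proof -
  let ?F = "\<lambda>n z. prod_encode (Suc (pfst z), f n (pfst z) (psnd z))"
  have "(?F n ^^ m) (prod_encode (0, h n)) = prod_encode (m, rec_nat (h n) (f n) m)" for n m
    by (induction m) auto
  then have "(\<lambda>n. rec_nat (h n) (f n) (g n)) = (\<lambda>n. psnd ((?F n ^^ g n) (prod_encode (0, h n))))"
    by simp
  moreover have "PR \<dots>"
    by (intro PR_intro assms)
  ultimately show ?thesis by (simp only:)
qed

lemma PR_subst2:
  assumes "PR (\<lambda>n. f (pfst n) (psnd n))" "PR g" "PR h"
  shows "PR (\<lambda>n. f (g n) (h n))"
  using PR_comp[OF assms(1) PR_pair[OF assms(2,3)]] by simp

lemma PR_add [PR_intro]: "PR f \<Longrightarrow> PR g \<Longrightarrow> PR (\<lambda>n. f n + g n)"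
proof (rule PR_subst2[where f = "(+)"])
  have "(\<lambda>n. pfst n + psnd n) = (\<lambda>n. (Suc ^^ psnd n) (pfst n))"
    by (simp add: Suc_funpow add.commute)
  moreover have "PR \<dots>" by (intro PR_intro)
  ultimately show "PR (\<lambda>n. pfst n + psnd n)" by (simp only:)
qed

lemma PR_pred: "PR f \<Longrightarrow> PR (\<lambda>n. f n - Suc 0)"
proof -
  assume f: "PR f"
  have "(\<lambda>n. f n - Suc 0) = (\<lambda>n. rec_nat 0 (\<lambda>k _. k) (f n))"
  proof
    show "f n - Suc 0 = rec_nat 0 (\<lambda>k _. k) (f n)" for n by (cases "f n") auto
  qed
  moreover have "PR \<dots>" by (intro PR_intro f)
  ultimately show ?thesis by (simp only:)
qed

lemma PR_diff [PR_intro]: "PR f \<Longrightarrow> PR g \<Longrightarrow> PR (\<lambda>n. f n - g n)"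
proof (rule PR_subst2[where f = "(-)"])
  have "((\<lambda>x. x - Suc 0) ^^ k) m = m - k" for k m :: nat
    by (induction k) auto
  then have "(\<lambda>n. pfst n - psnd n) = (\<lambda>n. ((\<lambda>x. x - Suc 0) ^^ psnd n) (pfst n))"
    by simp
  moreover have "PR \<dots>" by (intro PR_intro PR_pred)
  ultimately show "PR (\<lambda>n. pfst n - psnd n)" by (simp only:)
qed

lemma PR_mult [PR_intro]: "PR f \<Longrightarrow> PR g \<Longrightarrow> PR (\<lambda>n. f n * g n)"
proof (rule PR_subst2[where f = "(\<lambda>x y. x * y)"])
  have "((\<lambda>x. x + m) ^^ k) 0 = m * k" for k m :: nat
    by (induction k) auto
  then have "(\<lambda>n. pfst n * psnd n) = (\<lambda>n. ((\<lambda>x. x + pfst n) ^^ psnd n) 0)"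
    by simp
  moreover have "PR \<dots>" by (intro PR_intro)
  ultimately show "PR (\<lambda>n. pfst n * psnd n)" by (simp only:)
qed

lemma PR_power [PR_intro]: "PR f \<Longrightarrow> PR g \<Longrightarrow> PR (\<lambda>n. f n ^ g n)"
proof (rule PR_subst2[where f = "(^)"])
  have "((\<lambda>x. x * m) ^^ k) 1 = m ^ k" for k m :: nat
    by (induction k) auto
  then have "(\<lambda>n. pfst n ^ psnd n) = (\<lambda>n. ((\<lambda>x. x * pfst n) ^^ psnd n) 1)"
    by simp
  moreover have "PR \<dots>" by (intro PR_intro)
  ultimately show "PR (\<lambda>n. pfst n ^ psnd n)" by (simp only:)
qed

text \<open>Truth is coded by 0, in accordance with searches that look for a zero.\<close>

definition PRp :: "(nat \<Rightarrow> bool) \<Rightarrow> bool" where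
  "PRp P \<longleftrightarrow> PR (\<lambda>n. if P n then 0 else 1)"

lemma PR_if [PR_intro]:
  assumes "PRp P" "PR f" "PR g"
  shows "PR (\<lambda>n. if P n then f n else g n)"
proof -
  have "(\<lambda>n. if P n then f n else g n) = (\<lambda>n. rec_nat (f n) (\<lambda>_ _. g n) (if P n then 0 else 1))"
    by (auto simp: fun_eq_iff)
  moreover have "PR \<dots>" using assms(1) unfolding PRp_def by (intro PR_intro PR_comp[OF assms(3)] assms(2))
  ultimately show ?thesis by (simp only:)
qed

lemma PRp_le [PR_intro]: "PR f \<Longrightarrow> PR g \<Longrightarrow> PRp (\<lambda>n. f n \<le> g n)"
proof -
  assume fg: "PR f" "PR g"
  have "(\<lambda>n. if f n \<le> g n then 0 else 1) = (\<lambda>n. 1 - (1 - (f n - g n)))"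
    by (auto simp: fun_eq_iff)
  moreover have "PR \<dots>" using fg by (intro PR_intro)
  ultimately show ?thesis by (simp only: PRp_def)
qed

lemma PRp_less [PR_intro]: "PR f \<Longrightarrow> PR g \<Longrightarrow> PRp (\<lambda>n. f n < g n)"
  using PRp_le[of "\<lambda>n. Suc (f n)" g] PR_Suc'[of f] by (simp add: Suc_le_eq)

lemma PRp_not [PR_intro]:
  assumes "PRp P"
  shows "PRp (\<lambda>n. \<not> P n)"
proof -
  have "(\<lambda>n. if \<not> P n then 0 else 1 :: nat) = (\<lambda>n. if P n then 1 else 0)"
    by (auto simp: fun_eq_iff)
  moreover have "PR \<dots>" by (intro PR_intro assms)
  ultimately show ?thesis by (simp only: PRp_def)
qed

lemma PRp_conj [PR_intro]:
  assumes "PRp P" "PRp Q"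
  shows "PRp (\<lambda>n. P n \<and> Q n)"
proof -
  have "(\<lambda>n. if P n \<and> Q n then 0 else 1 :: nat) = (\<lambda>n. if P n then if Q n then 0 else 1 else 1)"
    by (auto simp: fun_eq_iff)
  moreover have "PR \<dots>" by (intro PR_intro assms)
  ultimately show ?thesis by (simp only: PRp_def)
qed

lemma PRp_eq [PR_intro]: "PR f \<Longrightarrow> PR g \<Longrightarrow> PRp (\<lambda>n. f n = g n)"
  unfolding order_eq_iff by (intro PR_intro)

text \<open>The candidate advances until it satisfies \<open>P\<close> and then stays put, so
  \<open>b\<close> rounds yield the least witness below \<open>b\<close>, or \<open>b\<close> itself
  if there is none.\<close>

definition bsearch :: "(nat \<Rightarrow> bool) \<Rightarrow> nat \<Rightarrow> nat" where
  "bsearch P b = ((\<lambda>m. if P m then m else Suc m) ^^ b) 0"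

lemma PR_bsearch [PR_intro]:
  "PRp (\<lambda>n. P (pfst n) (psnd n)) \<Longrightarrow> PR b \<Longrightarrow> PR (\<lambda>n. bsearch (P n) (b n))"
  unfolding bsearch_def by (intro PR_intro)

lemma bsearch_props:
  "bsearch P b \<le> b" "j < bsearch P b \<Longrightarrow> \<not> P j" "bsearch P b < b \<Longrightarrow> P (bsearch P b)"
proof -
  have "bsearch P b \<le> b \<and> (\<forall>j<bsearch P b. \<not> P j) \<and> (bsearch P b < b \<longrightarrow> P (bsearch P b))"
  proof (induction b)
    case (Suc b)
    have "bsearch P (Suc b) = (if P (bsearch P b) then bsearch P b else Suc (bsearch P b))"
      by (simp add: bsearch_def)
    then show ?case using Suc by (auto simp: less_Suc_eq)
  qed (simp add: bsearch_def)
  then show "bsearch P b \<le> b" "j < bsearch P b \<Longrightarrow> \<not> P j" "bsearch P b < b \<Longrightarrow> P (bsearch P b)"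
    by auto
qed

lemma bsearch_eqI:
  assumes "m < b" "P m" "\<And>j. j < m \<Longrightarrow> \<not> P j"
  shows "bsearch P b = m"
proof (rule antisym)
  show le: "bsearch P b \<le> m"
    using assms(2) bsearch_props(2)[of m P b] not_less by blast
  show "m \<le> bsearch P b"
    using le assms bsearch_props(3)[of P b] by (meson le_less_trans not_le)
qed

lemma PR_div_Suc [PR_intro]:
  assumes "PR f" "PR g"
  shows "PR (\<lambda>n. f n div Suc (g n))"
proof -
  \<comment> \<open>The quotient is the least \<open>q\<close> whose successor multiplied by the
    divisor exceeds \<open>m\<close>; it is at most \<open>m\<close>, which bounds the
    search.\<close>
  have "m div Suc d = bsearch (\<lambda>q. m < Suc q * Suc d) (Suc m)" for m d
  proof (rule bsearch_eqI[symmetric])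
    show "m div Suc d < Suc m" by (simp add: le_imp_less_Suc)
    show "m < Suc (m div Suc d) * Suc d" 
      using dividend_less_div_times[of "Suc d" m] by simp
    show "\<not> m < Suc j * Suc d" if "j < m div Suc d" for j
    proof -
      have "Suc j * Suc d \<le> m div Suc d * Suc d" using that by (intro mult_le_mono1) simp
      also have "\<dots> \<le> m" by (rule div_times_less_eq_dividend)
      finally show ?thesis by simp
    qed
  qed
  then have "(\<lambda>n. f n div Suc (g n)) = (\<lambda>n. bsearch (\<lambda>q. f n < Suc q * Suc (g n)) (Suc (f n)))"
    by simp
  moreover have "PR \<dots>"
    by (intro PR_intro PR_comp[OF assms(1)] PR_comp[OF assms(2)])
  ultimately show ?thesis by (simp only:)
qed

lemma PR_half [PR_intro]: "PR f \<Longrightarrow> PR (\<lambda>n. f n div 2)"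
  using PR_div_Suc[of f "\<lambda>_. 1"] PR_const by (simp add: numeral_2_eq_2)

lemma PRp_even [PR_intro]: "PR f \<Longrightarrow> PRp (\<lambda>n. even (f n))"
proof -
  assume "PR f"
  moreover have "(\<lambda>n. even (f n)) = (\<lambda>n. 2 * (f n div 2) = f n)"
    by (auto simp: fun_eq_iff) (metis dvd_triv_left)
  ultimately show ?thesis by (auto intro!: PR_intro)
qed

section \<open>Computable functionals on Baire space\<close>

text \<open>Newest entry first, so that reading one more entry is a single pairing on top of the old
  code. The length is stored separately in \<open>prefix_code\<close> to make older entries
  addressable.\<close>

primrec prefix_list :: "name \<Rightarrow> nat \<Rightarrow> nat" where
  "prefix_list p 0 = 0"
| "prefix_list p (Suc s) = Suc (prod_encode (p s, prefix_list p s))"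

definition prefix_code :: "name \<Rightarrow> nat \<Rightarrow> nat" where
  "prefix_code p s = prod_encode (s, prefix_list p s)"

text \<open>The primitive recursive \<open>\<phi>\<close> plays the role of an associate of \<open>f\<close>, except that its values on
  longer prefixes may become undetermined (\<open>0\<close>) again finitely often.\<close>

definition cmp :: "name set \<Rightarrow> (name \<Rightarrow> nat \<Rightarrow> nat) \<Rightarrow> bool" where
  "cmp D f \<longleftrightarrow> (\<exists>\<phi>. PR \<phi> \<and> (\<forall>p\<in>D. \<forall>n.
     (\<forall>s. \<phi> (prod_encode (prefix_code p s, n)) = 0 \<or> \<phi> (prod_encode (prefix_code p s, n)) = Suc (f p n)) \<and>
     (\<forall>\<^sub>F s in sequentially. \<phi> (prod_encode (prefix_code p s, n)) = Suc (f p n))))"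

named_theorems cmp_intro

lemma cmp_PR:
  assumes "PR g"
  shows "cmp D (\<lambda>p n. g n)"
proof -
  have "PR (\<lambda>z. Suc (g (psnd z)))"
    by (intro PR_intro PR_comp[OF assms])
  then show ?thesis unfolding cmp_def by (intro exI[of _ "\<lambda>z. Suc (g (psnd z))"]) auto
qed

lemma cmp_comp:
  assumes "cmp D f" "cmp D g"
  shows "cmp D (\<lambda>p n. f p (g p n))"
proof -
  obtain \<phi> where \<phi>: "PR \<phi>" "\<And>p n s. p \<in> D \<Longrightarrow> \<phi> (prod_encode (prefix_code p s, n)) = 0 \<or>
      \<phi> (prod_encode (prefix_code p s, n)) = Suc (f p n)"
    "\<And>p n. p \<in> D \<Longrightarrow> \<forall>\<^sub>F s in sequentially. \<phi> (prod_encode (prefix_code p s, n)) = Suc (f p n)"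
    using assms(1) unfolding cmp_def by blast
  obtain \<psi> where \<psi>: "PR \<psi>" "\<And>p n s. p \<in> D \<Longrightarrow> \<psi> (prod_encode (prefix_code p s, n)) = 0 \<or>
      \<psi> (prod_encode (prefix_code p s, n)) = Suc (g p n)"
    "\<And>p n. p \<in> D \<Longrightarrow> \<forall>\<^sub>F s in sequentially. \<psi> (prod_encode (prefix_code p s, n)) = Suc (g p n)"
    using assms(2) unfolding cmp_def by blast
  let ?\<chi> = "\<lambda>z. if \<psi> z = 0 then 0 else \<phi> (prod_encode (pfst z, \<psi> z - 1))"
  have "PR ?\<chi>" by (intro PR_intro PR_comp[OF \<phi>(1)] PR_comp[OF \<psi>(1)])
  moreover have "?\<chi> (prod_encode (prefix_code p s, n)) = 0 \<or>
      ?\<chi> (prod_encode (prefix_code p s, n)) = Suc (f p (g p n))" if "p \<in> D" for p n s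
    using \<psi>(2)[of p s n] \<phi>(2)[of p s "g p n"] that by auto
  moreover have "\<forall>\<^sub>F s in sequentially. ?\<chi> (prod_encode (prefix_code p s, n)) = Suc (f p (g p n))"
    if "p \<in> D" for p n
    using \<psi>(3)[of p n, OF that] \<phi>(3)[of p "g p n", OF that] by eventually_elim simp
  ultimately show ?thesis unfolding cmp_def by (intro exI[of _ ?\<chi>]) blast
qed

lemma cmp_pair [cmp_intro]:
  assumes "cmp D f" "cmp D g"
  shows "cmp D (\<lambda>p n. prod_encode (f p n, g p n))"
proof -
  obtain \<phi> where \<phi>: "PR \<phi>" "\<And>p n s. p \<in> D \<Longrightarrow> \<phi> (prod_encode (prefix_code p s, n)) = 0 \<or>
      \<phi> (prod_encode (prefix_code p s, n)) = Suc (f p n)"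
    "\<And>p n. p \<in> D \<Longrightarrow> \<forall>\<^sub>F s in sequentially. \<phi> (prod_encode (prefix_code p s, n)) = Suc (f p n)"
    using assms(1) unfolding cmp_def by blast
  obtain \<psi> where \<psi>: "PR \<psi>" "\<And>p n s. p \<in> D \<Longrightarrow> \<psi> (prod_encode (prefix_code p s, n)) = 0 \<or>
      \<psi> (prod_encode (prefix_code p s, n)) = Suc (g p n)"
    "\<And>p n. p \<in> D \<Longrightarrow> \<forall>\<^sub>F s in sequentially. \<psi> (prod_encode (prefix_code p s, n)) = Suc (g p n)"
    using assms(2) unfolding cmp_def by blast
  let ?\<chi> = "\<lambda>z. if \<phi> z = 0 then 0 else if \<psi> z = 0 then 0 else Suc (prod_encode (\<phi> z - 1, \<psi> z - 1))"
  have "PR ?\<chi>" by (intro PR_intro PR_comp[OF \<phi>(1)] PR_comp[OF \<psi>(1)])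
  moreover have "?\<chi> (prod_encode (prefix_code p s, n)) = 0 \<or>
      ?\<chi> (prod_encode (prefix_code p s, n)) = Suc (prod_encode (f p n, g p n))" if "p \<in> D" for p n s
    using \<psi>(2)[of p s n] \<phi>(2)[of p s n] that by auto
  moreover have "\<forall>\<^sub>F s in sequentially. ?\<chi> (prod_encode (prefix_code p s, n)) = Suc (prod_encode (f p n, g p n))"
    if "p \<in> D" for p n
    using \<psi>(3)[of p n, OF that] \<phi>(3)[of p n, OF that] by eventually_elim simp
  ultimately show ?thesis unfolding cmp_def by (intro exI[of _ ?\<chi>]) blast
qed

lemma prefix_list_drop: "((\<lambda>l. psnd (l - 1)) ^^ d) (prefix_list p (d + s)) = prefix_list p s"
  by (induction d) (simp_all add: funpow_Suc_right del: funpow.simps(2))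

lemma cmp_oracle: "cmp D (\<lambda>p n. p n)"
proof -
  \<comment> \<open>With the newest entry in front, entry \<open>n\<close> of a prefix of length
    \<open>s\<close> is the head after dropping \<open>s - Suc n\<close> entries.\<close>
  let ?\<phi> = "\<lambda>z. if psnd z < pfst (pfst z)
    then Suc (pfst (((\<lambda>l. psnd (l - 1)) ^^ (pfst (pfst z) - Suc (psnd z))) (psnd (pfst z)) - 1)) else 0"
  have "PR ?\<phi>" by (intro PR_intro)
  moreover have *: "?\<phi> (prod_encode (prefix_code p s, n)) = (if n < s then Suc (p n) else 0)" for p s n
  proof (cases "n < s")
    case True
    then obtain d where "s = d + Suc n" by (metis less_iff_Suc_add add.commute add_Suc_right)
    then show ?thesis using prefix_list_drop[of d p "Suc n"] by (simp add: prefix_code_def)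
  qed (simp add: prefix_code_def)
  moreover have "\<forall>\<^sub>F s in sequentially. n < s" for n
    by (rule eventually_gt_at_top)
  ultimately show ?thesis unfolding cmp_def
    by (intro exI[of _ ?\<phi>]) (auto elim: eventually_mono)
qed

text \<open>The search is bounded by the length of the prefix and stops at the first
  \<open>m\<close> whose value is undetermined (0) or known to vanish (1 = \<open>Suc 0\<close>).
  Only the second outcome is reported, so an undetermined smaller candidate can never be
  skipped.\<close>

lemma cmp_Least:
  assumes "cmp D (\<lambda>p n. f p (pfst n) (psnd n))" "\<And>p n. p \<in> D \<Longrightarrow> \<exists>m. f p n m = 0"
  shows "cmp D (\<lambda>p n. LEAST m. f p n m = 0)"
proof -
  obtain \<phi> where \<phi>: "PR \<phi>" "\<And>p n m s. p \<in> D \<Longrightarrow> \<phi> (prod_encode (prefix_code p s, prod_encode (n, m))) = 0 \<or>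
      \<phi> (prod_encode (prefix_code p s, prod_encode (n, m))) = Suc (f p n m)"
    "\<And>p n m. p \<in> D \<Longrightarrow> \<forall>\<^sub>F s in sequentially.
      \<phi> (prod_encode (prefix_code p s, prod_encode (n, m))) = Suc (f p n m)"
    using assms(1) unfolding cmp_def
    by (metis prod_encode_inverse fst_conv snd_conv)
  let ?b = "\<lambda>z. bsearch (\<lambda>m. \<phi> (prod_encode (pfst z, prod_encode (psnd z, m))) < 2) (pfst (pfst z))"
  let ?\<chi> = "\<lambda>z. if ?b z < pfst (pfst z) \<and> \<phi> (prod_encode (pfst z, prod_encode (psnd z, ?b z))) = 1
    then Suc (?b z) else 0"
  have "PR ?\<chi>" by (intro PR_intro PR_comp[OF \<phi>(1)])
  moreover have "?\<chi> (prod_encode (prefix_code p s, n)) = 0 \<or>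
      ?\<chi> (prod_encode (prefix_code p s, n)) = Suc (LEAST m. f p n m = 0)" if D: "p \<in> D" for p n s
  proof -
    let ?z = "prod_encode (prefix_code p s, n)"
    let ?m = "?b ?z"
    have "?m = (LEAST m. f p n m = 0)" if m: "?m < s" "\<phi> (prod_encode (prefix_code p s, prod_encode (n, ?m))) = 1"
    proof (rule Least_equality[symmetric])
      show "f p n ?m = 0" using \<phi>(2)[OF D, of s n ?m] m(2) by simp
      show "?m \<le> j" if "f p n j = 0" for j
      proof (rule ccontr)
        assume "\<not> ?m \<le> j"
        then have "j < ?m" by simp
        then have "\<not> \<phi> (prod_encode (pfst ?z, prod_encode (psnd ?z, j))) < 2"
          by (rule bsearch_props(2))
        then show False using \<phi>(2)[OF D, of s n j] that by auto
      qed
    qed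
    then show ?thesis by (auto simp: prefix_code_def)
  qed
  moreover have "\<forall>\<^sub>F s in sequentially. ?\<chi> (prod_encode (prefix_code p s, n)) = Suc (LEAST m. f p n m = 0)"
    if D: "p \<in> D" for p n
  proof -
    define L where "L = (LEAST m. f p n m = 0)"
    have L: "f p n L = 0" unfolding L_def using assms(2)[OF D, of n] by (rule LeastI_ex)
    have less: "f p n j \<noteq> 0" if "j < L" for j using not_less_Least that unfolding L_def by blast
    \<comment> \<open>Only finitely many candidates matter, so one sufficiently long prefix
      determines all of them at once.\<close>
    have "\<forall>\<^sub>F s in sequentially. \<forall>j\<in>{..L}. \<phi> (prod_encode (prefix_code p s, prod_encode (n, j))) = Suc (f p n j)"
      using \<phi>(3)[OF D] by (intro eventually_ball_finite) auto
    moreover have "\<forall>\<^sub>F s in sequentially. L < s" by (rule eventually_gt_at_top)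
    ultimately have "\<forall>\<^sub>F s in sequentially. ?\<chi> (prod_encode (prefix_code p s, n)) = Suc L"
    proof eventually_elim
      case (elim s)
      have "bsearch (\<lambda>m. \<phi> (prod_encode (prefix_code p s, prod_encode (n, m))) < 2) s = L"
        using elim L less by (intro bsearch_eqI) auto
      then show ?case using elim L by (simp add: prefix_code_def)
    qed
    then show ?thesis by (simp add: L_def)
  qed
  ultimately show ?thesis unfolding cmp_def by (intro exI[of _ ?\<chi>]) blast
qed

section \<open>Machines for computable functionals\<close>

definition word_of :: "name \<Rightarrow> nat \<Rightarrow> bool list" where
  "word_of q k = concat (map (\<lambda>j. unary_word (q j)) [0..<k])"

lemma length_word_of: "length (word_of q k) = (\<Sum>j<k. Suc (q j))"
  by (induction k) (simp_all add: word_of_def unary_word_def)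

lemma nth_word_of: "n < length (word_of q k) \<Longrightarrow> word_of q k ! n = tape q n"
proof (induction k)
  case (Suc k)
  have eq: "word_of q (Suc k) = word_of q k @ unary_word (q k)" by (simp add: word_of_def)
  show ?case
  proof (cases "n < length (word_of q k)")
    case False
    then obtain i where i: "n = (\<Sum>j<k. Suc (q j)) + i"
      by (metis length_word_of not_less le_Suc_ex)
    then have "i \<le> q k" using Suc.prems by (simp add: length_word_of)
    then show ?thesis
      using tape_in_block[of i q k] unfolding eq i
      by (auto simp: nth_append length_word_of unary_word_def)
  qed (simp add: eq nth_append Suc.IH)
qed (simp add: word_of_def)

text \<open>The transducer keeps the prefix read so far and the number \<open>K\<close> of entries
  already written. After each new input entry it asks \<open>\<phi>\<close> for entry
  \<open>K\<close> and writes it if it is determined; an undetermined value merely delays the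
  output.\<close>

theorem cmp_machine:
  assumes "cmp D f"
  shows "\<exists>M. \<forall>p\<in>D. transforms M p (f p)"
proof -
  obtain \<phi> where \<phi>: "PR \<phi>" "\<And>p n s. p \<in> D \<Longrightarrow> \<phi> (prod_encode (prefix_code p s, n)) = 0 \<or>
      \<phi> (prod_encode (prefix_code p s, n)) = Suc (f p n)"
    "\<And>p n. p \<in> D \<Longrightarrow> \<forall>\<^sub>F s in sequentially. \<phi> (prod_encode (prefix_code p s, n)) = Suc (f p n)"
    using assms unfolding cmp_def by blast
  define c where "c z = prod_encode (Suc (pfst (pfst (pfst z))),
    Suc (prod_encode (psnd z, psnd (pfst (pfst z)))))" for z
  define v where "v z = \<phi> (prod_encode (c z, psnd (pfst z)))" for z
  define g where "g z = prod_encode (prod_encode (c z,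
    if v z = 0 then psnd (pfst z) else Suc (psnd (pfst z))), v z)" for z
  have "PR c" unfolding c_def by (intro PR_intro)
  then have "PR v" unfolding v_def by (intro PR_comp[OF \<phi>(1)] PR_intro)
  then have "PR g" unfolding g_def using \<open>PR c\<close> by (intro PR_intro)
  then obtain M where M: "\<And>p s. \<exists>t. out_word (run M (tape p) t) = trans_out g p s"
    using transducer_machine by blast
  define K where "K p s = psnd (trans_state g p s)" for p s
  have "pfst (trans_state g p s) = prefix_code p s" for p s
  proof (induction s)
    case 0
    then show ?case by (simp add: prefix_code_def prod_encode_def prod_decode_0)
  next
    case (Suc s)
    then show ?case by (simp add: g_def c_def) (simp add: prefix_code_def)
  qed
  then have state: "trans_state g p s = prod_encode (prefix_code p s, K p s)" for p s
    unfolding K_def by (metis prod.collapse prod_decode_inverse)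
  have K_0: "K p 0 = 0" for p
    by (simp add: K_def prod_decode_0)
  have val: "trans_val g p s = \<phi> (prod_encode (prefix_code p (Suc s), K p s))" for p s
    by (simp add: trans_val_def state g_def v_def c_def) (simp add: prefix_code_def)
  have K_Suc: "K p (Suc s) = (if trans_val g p s = 0 then K p s else Suc (K p s))" for p s
    unfolding K_def[of p "Suc s"] by (simp add: state g_def trans_val_def)
  have out: "trans_out g p s = word_of (f p) (K p s)" if "p \<in> D" for p s
  proof (induction s)
    case 0
    then show ?case by (simp add: K_0 word_of_def)
  next
    case (Suc s)
    then show ?case
      using \<phi>(2)[OF that, of "Suc s" "K p s"] 
      by (auto simp: K_Suc val word_of_def)
  qed
  \<comment> \<open>If \<open>K\<close> stopped at \<open>k\<close>, the transducer would query
    entry \<open>k\<close> on all longer prefixes, and from some point on \<open>\<phi>\<close>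
    answers.\<close>
  have unbounded: "\<exists>s. k \<le> K p s" if "p \<in> D" for p k
  proof (induction k)
    case (Suc k)
    then obtain s where s: "k \<le> K p s" by blast
    have mono: "K p s \<le> K p t" if "s \<le> t" for t
      using that by (induction t rule: dec_induct) (auto simp: K_Suc)
    show ?case
    proof (rule ccontr)
      assume neg: "\<nexists>s. Suc k \<le> K p s"
      then have K: "K p t = k" if "s \<le> t" for t
        using mono[OF that] s by (metis le_antisym le_trans not_less_eq_eq)
      obtain N where N: "\<And>s. N \<le> s \<Longrightarrow> \<phi> (prod_encode (prefix_code p s, k)) = Suc (f p k)"
        using \<phi>(3)[OF \<open>p \<in> D\<close>, of k] unfolding eventually_sequentially by blast
      define t where "t = max s N"
      have "K p (Suc t) = Suc k"
        using K[of t] N[of "Suc t"] by (simp add: K_Suc val t_def)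
      then show False using neg by (metis le_refl)
    qed
  qed simp
  have "transforms M p (f p)" if "p \<in> D" for p
    unfolding transforms_def writes_def
  proof
    fix n
    obtain s where s: "Suc n \<le> K p s" using unbounded[OF \<open>p \<in> D\<close>] by blast
    obtain t where t: "out_word (run M (tape p) t) = word_of (f p) (K p s)"
      using M[of p s] out[OF \<open>p \<in> D\<close>] by metis
    have "Suc n \<le> length (word_of (f p) (K p s))"
      using s sum_mono[of "{..<K p s}" "\<lambda>_. 1" "\<lambda>j. Suc (f p j)"] by (simp add: length_word_of)
    then show "\<exists>t. n < length (out_word (run M (tape p) t)) \<and> out_word (run M (tape p) t) ! n = tape (f p) n"
      using t nth_word_of[of n "f p" "K p s"] by (intro exI[of _ t]) simp
  qed
  then show ?thesis by blast
qed

subsection \<open>Closure properties\<close>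

lemma cmp_lift1: "PR g \<Longrightarrow> cmp D f \<Longrightarrow> cmp D (\<lambda>p n. g (f p n))"
  by (rule cmp_comp[OF cmp_PR])

lemma cmp_subst2:
  assumes "cmp D (\<lambda>p n. F p (pfst n) (psnd n))" "cmp D f" "cmp D g"
  shows "cmp D (\<lambda>p n. F p (f p n) (g p n))"
  using cmp_comp[OF assms(1) cmp_pair[OF assms(2,3)]] by simp

lemma cmp_lift2:
  "PR (\<lambda>n. h (pfst n) (psnd n)) \<Longrightarrow> cmp D f \<Longrightarrow> cmp D g \<Longrightarrow> cmp D (\<lambda>p n. h (f p n) (g p n))"
  by (rule cmp_subst2[OF cmp_PR])

lemma cmp_const [cmp_intro]: "cmp D (\<lambda>_ _. c)"
  by (rule cmp_PR) (intro PR_intro)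

lemma cmp_id [cmp_intro]: "cmp D (\<lambda>_ n. n)"
  by (rule cmp_PR) (intro PR_intro)

lemma cmp_pfst [cmp_intro]: "cmp D f \<Longrightarrow> cmp D (\<lambda>p n. pfst (f p n))"
  by (rule cmp_lift1[OF PR_pfst])

lemma cmp_psnd [cmp_intro]: "cmp D f \<Longrightarrow> cmp D (\<lambda>p n. psnd (f p n))"
  by (rule cmp_lift1[OF PR_psnd])

lemma cmp_Suc [cmp_intro]: "cmp D f \<Longrightarrow> cmp D (\<lambda>p n. Suc (f p n))"
  by (rule cmp_lift1[OF PR_Suc])

lemma cmp_half [cmp_intro]: "cmp D f \<Longrightarrow> cmp D (\<lambda>p n. f p n div 2)"
  by (rule cmp_lift1) (intro PR_intro)

lemma cmp_arith [cmp_intro]: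
  assumes "cmp D f" "cmp D g"
  shows "cmp D (\<lambda>p n. f p n + g p n)" "cmp D (\<lambda>p n. f p n - g p n)"
    "cmp D (\<lambda>p n. f p n * g p n)" "cmp D (\<lambda>p n. f p n ^ g p n)"
    "cmp D (\<lambda>p n. f p n div Suc (g p n))"
  by (rule cmp_lift2[OF _ assms], intro PR_intro)+

definition cmpp :: "name set \<Rightarrow> (name \<Rightarrow> nat \<Rightarrow> bool) \<Rightarrow> bool" where
  "cmpp D P \<longleftrightarrow> cmp D (\<lambda>p n. if P p n then 0 else 1)"

lemma cmpp_le [cmp_intro]: "cmp D f \<Longrightarrow> cmp D g \<Longrightarrow> cmpp D (\<lambda>p n. f p n \<le> g p n)"
  unfolding cmpp_def by (rule cmp_lift2) (intro PR_intro)

lemma cmpp_eq [cmp_intro]: "cmp D f \<Longrightarrow> cmp D g \<Longrightarrow> cmpp D (\<lambda>p n. f p n = g p n)"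
  unfolding cmpp_def by (rule cmp_lift2) (intro PR_intro)

lemma cmpp_even [cmp_intro]: "cmp D f \<Longrightarrow> cmpp D (\<lambda>p n. even (f p n))"
  unfolding cmpp_def by (rule cmp_lift1[of "\<lambda>m. if even m then 0 else 1"]) (intro PR_intro)

lemma cmp_if [cmp_intro]:
  assumes "cmpp D P" "cmp D f" "cmp D g"
  shows "cmp D (\<lambda>p n. if P p n then f p n else g p n)"
proof -
  have "PR (\<lambda>n. if pfst n = 0 then pfst (psnd n) else psnd (psnd n))"
    by (intro PR_intro)
  note cmp_lift2[where h = "\<lambda>c z. if c = 0 then pfst z else psnd z", OF this
      assms(1)[unfolded cmpp_def] cmp_pair[OF assms(2,3)]]
  moreover have "((if b then 0 else 1 :: nat) = 0) = b" for b
    by simp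
  ultimately show ?thesis by (simp only: prod_encode_inverse fst_conv snd_conv)
qed

section \<open>Simulation of Type-2 machines\<close>

lemma psnd_le: "psnd n \<le> n"
  using le_prod_encode_2[of "psnd n" "pfst n"] by simp

text \<open>Finite maps are association lists in which newer entries shadow older ones. The default
  0 codes both the blank symbol and the head position 0, so the empty list describes blank tapes
  with heads at the origin.\<close>

function alook :: "nat \<Rightarrow> nat \<Rightarrow> nat" where
  "alook k 0 = 0"
| "alook k (Suc n) = (if pfst (pfst n) = k then psnd (pfst n) else alook k (psnd n))"
  by pat_completeness auto
termination
  by (relation "Wellfounded.measure snd") (auto simp: psnd_le le_imp_less_Suc)

definition aupd :: "nat \<Rightarrow> nat \<Rightarrow> nat \<Rightarrow> nat" where
  "aupd k v A = Suc (prod_encode (prod_encode (k, v), A))"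

lemma alook_aupd [simp]: "alook k' (aupd k v A) = (if k' = k then v else alook k' A)"
  by (simp add: aupd_def)

lemma PR_aupd [PR_intro]: "PR f \<Longrightarrow> PR g \<Longrightarrow> PR h \<Longrightarrow> PR (\<lambda>n. aupd (f n) (g n) (h n))"
  unfolding aupd_def by (intro PR_intro)

lemma PR_alook [PR_intro]: "PR f \<Longrightarrow> PR g \<Longrightarrow> PR (\<lambda>n. alook (f n) (g n))"
proof (rule PR_subst2[where f = alook])
  let ?s = "\<lambda>k l. if 0 < l \<and> \<not> pfst (pfst (l - Suc 0)) = k then psnd (l - Suc 0) else l"
  have stop: "?s k l = l \<Longrightarrow> (?s k ^^ m) l = l" for k l m
    by (induction m) auto
  \<comment> \<open>The code of a list strictly exceeds that of its tail, so the code itself is a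
    sufficient number of rounds; once the key or the end is reached, the list no longer
    changes.\<close>
  have "l \<le> m \<Longrightarrow> psnd (pfst ((?s k ^^ m) l - Suc 0)) = alook k l" for k l m
  proof (induction k l arbitrary: m rule: alook.induct)
    case (1 k)
    have "(?s k ^^ m) 0 = 0" by (rule stop) simp
    then show ?case by (simp add: prod_decode_0)
  next
    case (2 k n)
    show ?case
    proof (cases "pfst (pfst n) = k")
      case True
      then have "(?s k ^^ m) (Suc n) = Suc n" by (intro stop) simp
      then show ?thesis using True by simp
    next
      case False
      obtain m' where m: "m = Suc m'" using "2.prems" by (cases m) auto
      then have "psnd n \<le> m'" using "2.prems" psnd_le[of n] by simp
      from "2.IH"[OF False this] False show ?thesis
        unfolding m by (simp add: funpow_Suc_right del: funpow.simps(2))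
    qed
  qed
  then have "(\<lambda>n. alook (pfst n) (psnd n)) =
    (\<lambda>n. psnd (pfst ((?s (pfst n) ^^ psnd n) (psnd n) - Suc 0)))"
    by (simp add: fun_eq_iff)
  moreover have "PR \<dots>" by (intro PR_intro)
  ultimately show "PR (\<lambda>n. alook (pfst n) (psnd n))" by (simp only:)
qed

text \<open>A nonnegative \<open>z\<close> has code \<open>2 * z\<close> and a negative one
  \<open>- 2 * z - 1\<close>; codes move by two, except between -1 (code 1) and 0 (code 0).\<close>

definition int_succ_code :: "nat \<Rightarrow> nat" where
  "int_succ_code n = (if even n then n + 2 else if n = 1 then 0 else n - 2)"

definition int_pred_code :: "nat \<Rightarrow> nat" where
  "int_pred_code n = (if even n then if n = 0 then 1 else n - 2 else n + 2)"

lemma int_code_simps: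
  "int_encode (z + 1) = int_succ_code (int_encode z)"
  "int_encode (z - 1) = int_pred_code (int_encode z)"
  by (auto simp: int_encode_def sum_encode_def int_succ_code_def int_pred_code_def nat_diff_distrib
      nat_add_distrib)

lemma PR_int_code [PR_intro]:
  "PR f \<Longrightarrow> PR (\<lambda>n. int_succ_code (f n))" "PR f \<Longrightarrow> PR (\<lambda>n. int_pred_code (f n))"
  unfolding int_succ_code_def int_pred_code_def by (intro PR_intro; assumption)+

definition sym_code :: "symbol \<Rightarrow> nat" where
  "sym_code s = (case s of None \<Rightarrow> 0 | Some False \<Rightarrow> 1 | Some True \<Rightarrow> 2)"

lemma sym_code_eq_iff [simp]: "sym_code s = sym_code s' \<longleftrightarrow> s = s'"
  by (auto simp: sym_code_def split: option.splits bool.splits)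

text \<open>Program counter, input position, cells (keyed by tape and coded position) and heads. In
  place of the output word only three numbers are kept: \<open>cur\<close>, the ones written since
  the last zero, \<open>cnt\<close>, the number of complete entries, and the wanted entry
  \<open>res\<close>.\<close>

fun sim_code :: "nat \<times> nat \<times> nat \<times> nat \<times> nat \<times> nat \<times> nat \<Rightarrow> nat" where
  "sim_code (l, ip, W, H, cur, cnt, res) = prod_encode (l, prod_encode (ip, prod_encode (W,
     prod_encode (H, prod_encode (cur, prod_encode (cnt, res))))))"

definition "sim_pc c = pfst c"
definition "sim_ip c = pfst (psnd c)"
definition "sim_W c = pfst (psnd (psnd c))"
definition "sim_H c = pfst (psnd (psnd (psnd c)))"
definition "sim_cur c = pfst (psnd (psnd (psnd (psnd c))))"
definition "sim_cnt c = pfst (psnd (psnd (psnd (psnd (psnd c)))))"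
definition "sim_res c = psnd (psnd (psnd (psnd (psnd (psnd c)))))"

lemmas sim_fields = sim_pc_def sim_ip_def sim_W_def sim_H_def sim_cur_def sim_cnt_def sim_res_def

lemma sim_code_fields [simp]:
  "sim_pc (sim_code (l, ip, W, H, cur, cnt, res)) = l"
  "sim_ip (sim_code (l, ip, W, H, cur, cnt, res)) = ip"
  "sim_W (sim_code (l, ip, W, H, cur, cnt, res)) = W"
  "sim_H (sim_code (l, ip, W, H, cur, cnt, res)) = H"
  "sim_cur (sim_code (l, ip, W, H, cur, cnt, res)) = cur"
  "sim_cnt (sim_code (l, ip, W, H, cur, cnt, res)) = cnt"
  "sim_res (sim_code (l, ip, W, H, cur, cnt, res)) = res"
  by (simp_all add: sim_fields)

text \<open>The parameter \<open>n\<close> is \<open>\<langle>\<langle>a, b\<rangle>, k\<rangle>\<close>: the input tape holds the name \<open>a, b, 0, 0, \<dots>\<close>, and the entry of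
  the output with index \<open>k\<close> is to be recorded, increased by one, in the last field.\<close>

definition input_bit :: "nat \<Rightarrow> nat \<Rightarrow> bool" where
  "input_bit n i \<longleftrightarrow> \<not> i = pfst (pfst n) \<and> i < Suc (pfst (pfst n) + psnd (pfst n))"

fun sim_exec :: "instr \<Rightarrow> nat \<Rightarrow> nat \<Rightarrow> nat" where
  "sim_exec In_Right n c = sim_code (Suc (sim_pc c), Suc (sim_ip c), sim_W c, sim_H c, sim_cur c, sim_cnt c, sim_res c)"
| "sim_exec (In_Test b l) n c = sim_code (if input_bit n (sim_ip c) then (if b then l else Suc (sim_pc c))
     else (if b then Suc (sim_pc c) else l), sim_ip c, sim_W c, sim_H c, sim_cur c, sim_cnt c, sim_res c)"
| "sim_exec (Work_Left t) n c = sim_code (Suc (sim_pc c), sim_ip c, sim_W c,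
     aupd t (int_pred_code (alook t (sim_H c))) (sim_H c), sim_cur c, sim_cnt c, sim_res c)"
| "sim_exec (Work_Right t) n c = sim_code (Suc (sim_pc c), sim_ip c, sim_W c,
     aupd t (int_succ_code (alook t (sim_H c))) (sim_H c), sim_cur c, sim_cnt c, sim_res c)"
| "sim_exec (Work_Write t s) n c = sim_code (Suc (sim_pc c), sim_ip c,
     aupd (prod_encode (t, alook t (sim_H c))) (sym_code s) (sim_W c), sim_H c, sim_cur c, sim_cnt c, sim_res c)"
| "sim_exec (Work_Test t s l) n c = sim_code
     (if alook (prod_encode (t, alook t (sim_H c))) (sim_W c) = sym_code s then l else Suc (sim_pc c),
      sim_ip c, sim_W c, sim_H c, sim_cur c, sim_cnt c, sim_res c)"
| "sim_exec (Out b) n c = (if b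
     then sim_code (Suc (sim_pc c), sim_ip c, sim_W c, sim_H c, Suc (sim_cur c), sim_cnt c, sim_res c)
     else sim_code (Suc (sim_pc c), sim_ip c, sim_W c, sim_H c, 0, Suc (sim_cnt c),
       if sim_cnt c = psnd n then Suc (sim_cur c) else sim_res c))"
| "sim_exec (Jump l) n c = sim_code (l, sim_ip c, sim_W c, sim_H c, sim_cur c, sim_cnt c, sim_res c)"

lemma PR_sim_exec: "PR (\<lambda>z. sim_exec I (pfst z) (psnd z))"
proof (cases I)
  case (In_Test b l)
  show ?thesis
    unfolding In_Test
    by (cases b) (simp_all only: sim_exec.simps sim_code.simps sim_fields input_bit_def if_True if_False,
        (intro PR_intro)+)
next
  case (Out b)
  show ?thesis
    unfolding Out
    by (cases b) (simp_all only: sim_exec.simps sim_code.simps sim_fields if_True if_False,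
        (intro PR_intro)+)
qed (simp_all only: sim_exec.simps sim_code.simps sim_fields, (intro PR_intro)+)

primrec sim_step :: "machine \<Rightarrow> nat \<Rightarrow> nat \<Rightarrow> nat \<Rightarrow> nat" where
  "sim_step [] k n c = c"
| "sim_step (I # M) k n c = (if sim_pc c = k then sim_exec I n c else sim_step M (Suc k) n c)"

lemma PR_sim_step: "PR (\<lambda>z. sim_step M k (pfst z) (psnd z))"
proof (induction M arbitrary: k)
  case (Cons I M)
  then show ?case by (simp add: sim_pc_def) (intro PR_intro PR_sim_exec)
qed (simp, intro PR_intro)

lemma sim_step_eq:
  "sim_step M k n c = (if k \<le> sim_pc c \<and> sim_pc c < k + length M then sim_exec (M ! (sim_pc c - k)) n c else c)"
proof (induction M arbitrary: k)
  case (Cons I M)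
  show ?case
  proof (cases "k \<le> sim_pc c \<and> sim_pc c < k + length (I # M)")
    case True
    then show ?thesis using Cons by (cases "sim_pc c = k") (auto simp: nth_Cons' Suc_le_eq)
  qed (use Cons in auto)
qed simp

text \<open>0 is the code of the initial configuration, because every component of it decodes to
  0.\<close>

definition sim_run :: "machine \<Rightarrow> nat \<Rightarrow> nat \<Rightarrow> nat" where
  "sim_run M n t = (sim_step M 0 n ^^ t) 0"

lemma PR_sim_run: "PR (\<lambda>z. sim_run M (pfst z) (psnd z))"
  unfolding sim_run_def by (intro PR_intro PR_subst2[where f = "sim_step M 0", OF PR_sim_step])

section \<open>Correctness of the simulation\<close>

definition pair_name :: "nat \<Rightarrow> nat \<Rightarrow> name" where
  "pair_name a b i = (if i = 0 then a else if i = 1 then b else 0)"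

lemma tape_pair_name: "tape (pair_name a b) i \<longleftrightarrow> input_bit (prod_encode (prod_encode (a, b), k)) i"
proof -
  define f where "f k = (\<Sum>j<k. Suc (pair_name a b j)) + pair_name a b k" for k
  have f: "f 0 = a" "f (Suc 0) = Suc (a + b)" "f (Suc (Suc l)) = a + b + 2 + l" for l
    by (simp_all add: f_def pair_name_def, induction l) simp_all
  have "i \<in> range f \<longleftrightarrow> i = a \<or> Suc (a + b) \<le> i"
  proof
    assume "i \<in> range f"
    then obtain k where k: "i = f k" by blast
    show "i = a \<or> Suc (a + b) \<le> i"
    proof (cases k)
      case (Suc k')
      then show ?thesis using k f by (cases k') simp_all
    qed (use k f in simp)
  next
    assume "i = a \<or> Suc (a + b) \<le> i"
    then consider "i = f 0" | "i = f (Suc 0)" | "Suc (Suc (a + b)) \<le> i"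
      using f by fastforce
    then show "i \<in> range f"
    proof cases
      case 3
      then have "i = f (Suc (Suc (i - (a + b + 2))))" using f(3) by simp
      then show ?thesis by blast
    qed blast+
  qed
  then show ?thesis
    unfolding tape_def input_bit_def f_def by (simp add: not_le)
qed

definition parse_ok :: "nat \<Rightarrow> bool list \<Rightarrow> nat list \<Rightarrow> nat \<Rightarrow> nat \<Rightarrow> nat \<Rightarrow> bool" where
  "parse_ok k u ns cur cnt res \<longleftrightarrow> u = concat (map unary_word ns) @ replicate cur True \<and>
     cnt = length ns \<and> res = (if k < length ns then Suc (ns ! k) else 0)"

definition sim_rel :: "nat \<Rightarrow> config \<Rightarrow> nat \<Rightarrow> bool" where
  "sim_rel n c s \<longleftrightarrow> pc c = sim_pc s \<and> in_pos c = sim_ip s \<and>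
     (\<forall>t z. alook (prod_encode (t, int_encode z)) (sim_W s) = sym_code (work c t z)) \<and>
     (\<forall>t. alook t (sim_H s) = int_encode (head c t)) \<and>
     (\<exists>ns. parse_ok (psnd n) (out_word c) ns (sim_cur s) (sim_cnt s) (sim_res s))"

lemma sim_rel_exec:
  assumes "sim_rel n c s" "\<And>i. x i = input_bit n i"
  shows "sim_rel n (exec I x c) (sim_exec I n s)"
proof (cases I)
  case (Out b)
  obtain ns where ns: "parse_ok (psnd n) (out_word c) ns (sim_cur s) (sim_cnt s) (sim_res s)"
    using assms(1) by (auto simp: sim_rel_def)
  show ?thesis
  proof (cases b)
    case True
    have "parse_ok (psnd n) (out_word c @ [True]) ns (Suc (sim_cur s)) (sim_cnt s) (sim_res s)"
      using ns by (simp add: parse_ok_def replicate_append_same)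
    then show ?thesis using assms(1) Out True
      by (auto simp: sim_rel_def simp del: sim_code.simps)
  next
    case False
    have "parse_ok (psnd n) (out_word c @ [False]) (ns @ [sim_cur s]) 0 (Suc (sim_cnt s))
        (if sim_cnt s = psnd n then Suc (sim_cur s) else sim_res s)"
      using ns by (auto simp: parse_ok_def unary_word_def nth_append)
    then show ?thesis using assms(1) Out False
      by (auto simp: sim_rel_def simp del: sim_code.simps)
  qed
qed (use assms in \<open>auto simp: sim_rel_def int_code_simps int_encode_eq simp del: sim_code.simps\<close>)

lemma sim_rel_run:
  assumes "\<And>i. x i = input_bit n i"
  shows "sim_rel n (run M x t) (sim_run M n t)"
proof (induction t)
  case 0
  have "parse_ok (psnd n) [] [] 0 0 0" by (simp add: parse_ok_def)
  then show ?case
    by (auto simp: sim_rel_def sim_run_def run_def sim_fields prod_decode_0 init_config_def sym_code_def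
        int_encode_def sum_encode_def)
next
  case (Suc t)
  have "sim_rel n (step M x (run M x t)) (sim_step M 0 n (sim_run M n t))"
  proof (cases "pc (run M x t) < length M")
    case True
    then show ?thesis
      using sim_rel_exec[OF Suc assms, of "M ! pc (run M x t)"] Suc
      by (simp add: sim_step_eq step_def sim_rel_def)
  next
    case False
    then show ?thesis using Suc by (simp add: sim_step_eq step_def sim_rel_def)
  qed
  then show ?case by (simp add: sim_run_def run_def)
qed

lemma out_word_run_mono:
  assumes "t \<le> t'"
  shows "\<exists>v. out_word (run M x t') = out_word (run M x t) @ v"
  using assms
proof (induction t' rule: dec_induct)
  case (step t')
  have "\<exists>v. out_word (exec I x c) = out_word c @ v" for I c
    by (cases I) auto
  then have "\<exists>v. out_word (step M x c) = out_word c @ v" for c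
    by (simp add: step_def)
  then obtain v where "out_word (run M x (Suc t')) = out_word (run M x t') @ v"
    unfolding run_def by auto
  then show ?case using step by auto
qed simp

text \<open>\<open>writes\<close> promises each symbol only at some time; the output is never
  erased, so any time at which the position is filled shows the same symbol.\<close>

lemma writes_prefix:
  assumes "writes M x y" "n < length (out_word (run M x t))"
  shows "out_word (run M x t) ! n = y n"
proof -
  obtain t' where t': "n < length (out_word (run M x t'))" "out_word (run M x t') ! n = y n"
    using assms(1) unfolding writes_def by blast
  show ?thesis
  proof (cases "t \<le> t'")
    case True
    then show ?thesis using t' assms(2) out_word_run_mono[OF True, of M x] by (auto simp: nth_append)
  next
    case False
    then show ?thesis using t' assms(2) out_word_run_mono[of t' t M x] by (auto simp: nth_append)
  qed
qed

lemma unary_word_simps: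
  "length (unary_word a) = Suc a" "i \<le> a \<Longrightarrow> unary_word a ! i = (i < a)"
  by (auto simp: unary_word_def nth_append)

lemma concat_unary_word: "concat (map unary_word (map q [0..<k])) = word_of q k"
  by (simp add: word_of_def comp_def)

text \<open>Induction from the right: the earlier blocks fix where the last one begins, and its
  first zero then fixes its length.\<close>

lemma parse_unique:
  assumes "\<And>m. m < length (concat (map unary_word ns)) \<Longrightarrow> concat (map unary_word ns) ! m = tape q m"
  shows "ns = map q [0..<length ns]"
  using assms
proof (induction ns rule: rev_induct)
  case (snoc a ns)
  let ?w = "concat (map unary_word ns)" and ?l = "length ns"
  have ns: "ns = map q [0..<?l]"
  proof (rule snoc.IH)
    show "?w ! m = tape q m" if "m < length ?w" for m
      using snoc.prems[of m] that by (simp add: nth_append)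
  qed
  then have "?w = word_of q ?l"
    by (metis concat_unary_word)
  then have len: "length ?w = (\<Sum>j<?l. Suc (q j))"
    by (simp add: length_word_of)
  have tape: "(i < a) = tape q ((\<Sum>j<?l. Suc (q j)) + i)" if "i \<le> a" for i
  proof -
    have "(?w @ unary_word a) ! (length ?w + i) = tape q (length ?w + i)"
      using snoc.prems[of "length ?w + i"] that by (simp add: unary_word_simps)
    moreover have "(?w @ unary_word a) ! (length ?w + i) = (i < a)"
      using that by (subst nth_append_length_plus) (simp add: unary_word_simps)
    ultimately show ?thesis by (simp only: len)
  qed
  have "a = q ?l"
  proof (rule antisym)
    show "a \<le> q ?l"
      using tape[of "q ?l"] tape_in_block[of "q ?l" q ?l] by (meson less_irrefl linear not_le)
    show "q ?l \<le> a"
      using tape[of a] tape_in_block[of a q ?l] by (meson less_irrefl linear not_le order_refl)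
  qed
  then show ?case using ns by simp
qed simp

lemma sim_run_res:
  fixes a b k :: nat
  assumes "transforms M (pair_name a b) q"
  defines "n \<equiv> prod_encode (prod_encode (a, b), k)"
  shows "sim_res (sim_run M n t) = 0 \<or> sim_res (sim_run M n t) = Suc (q k)"
    "\<exists>t. sim_res (sim_run M n t) \<noteq> 0"
proof -
  let ?x = "tape (pair_name a b)"
  have "sim_rel n (run M ?x t) (sim_run M n t)" for t
    by (rule sim_rel_run) (simp add: tape_pair_name[of _ _ _ k] n_def)
  then have "\<exists>ns. parse_ok k (out_word (run M ?x t)) ns (sim_cur (sim_run M n t)) (sim_cnt (sim_run M n t))
    (sim_res (sim_run M n t))" for t
    by (auto simp: sim_rel_def n_def)
  then obtain ns where ns: "\<And>t. parse_ok k (out_word (run M ?x t)) (ns t) (sim_cur (sim_run M n t))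
    (sim_cnt (sim_run M n t)) (sim_res (sim_run M n t))"
    by metis
  have w: "writes M ?x (tape q)" using assms by (simp add: transforms_def)
  have ns_eq: "ns t = map q [0..<length (ns t)]" for t
  proof (rule parse_unique)
    show "concat (map unary_word (ns t)) ! m = tape q m" if "m < length (concat (map unary_word (ns t)))" for m
      using writes_prefix[OF w, of m t] ns[of t] that by (simp add: parse_ok_def nth_append)
  qed
  have res: "sim_res (sim_run M n t) = (if k < length (ns t) then Suc (q k) else 0)" for t
    using ns[of t] ns_eq[of t] by (auto simp: parse_ok_def) (metis nth_map_upt add_0 diff_zero)
  then show "sim_res (sim_run M n t) = 0 \<or> sim_res (sim_run M n t) = Suc (q k)" by simp
  \<comment> \<open>The position of the zero that ends entry \<open>k\<close>; once it has been
    written, that entry must be complete.\<close>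
  define m where "m = (\<Sum>j<k. Suc (q j)) + q k"
  obtain t where t: "m < length (out_word (run M ?x t))"
    using w unfolding writes_def by blast
  have "k < length (ns t)"
  proof (rule ccontr)
    assume *: "\<not> k < length (ns t)"
    let ?l = "length (ns t)" and ?w = "concat (map unary_word (ns t))"
    \<comment> \<open>The zero that ends the first incomplete entry \<open>?l\<close>. As
      \<open>?l \<le> k\<close>, it lies no later than \<open>m\<close> and has been written,
      whereas beyond the complete entries the word contains only ones.\<close>
    define m' where "m' = (\<Sum>j<?l. Suc (q j)) + q ?l"
    have "?w = word_of q ?l"
      by (metis concat_unary_word ns_eq)
    then have len: "length ?w = (\<Sum>j<?l. Suc (q j))"
      by (simp add: length_word_of)
    have "m' \<le> m"
    proof (cases "?l = k")
      case False
      then have "(\<Sum>j<Suc ?l. Suc (q j)) \<le> (\<Sum>j<k. Suc (q j))"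
        using * by (intro sum_mono2) auto
      then show ?thesis by (simp add: m_def m'_def)
    qed (simp add: m_def m'_def)
    then have "m' < length (out_word (run M ?x t))" using t by simp
    moreover from this have "out_word (run M ?x t) ! m'"
      using ns[of t] by (auto simp: parse_ok_def nth_append len m'_def)
    ultimately have "tape q m'" using writes_prefix[OF w] by simp
    then show False using tape_in_block[of "q ?l" q ?l] by (simp add: m'_def)
  qed
  then show "\<exists>t. sim_res (sim_run M n t) \<noteq> 0" using res[of t] by (intro exI[of _ t]) simp
qed

text \<open>The outputs \<open>q a b\<close> are arbitrary functions tied to \<open>M\<close> alone.
  An unbounded search finds a time at which the simulated machine has completed the wanted entry;
  \<open>1 - x = 0\<close> expresses that \<open>x\<close> is positive.\<close>

theorem cmp_machine_value:
  assumes "\<And>a b. transforms M (pair_name a b) (q a b)" "cmp D f" "cmp D g" "cmp D h"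
  shows "cmp D (\<lambda>p n. q (f p n) (g p n) (h p n))"
proof -
  let ?t = "\<lambda>n. LEAST t. 1 - sim_res (sim_run M n t) = 0"
  have ex: "\<exists>t. 1 - sim_res (sim_run M n t) = 0" for n
  proof -
    obtain t where "sim_res (sim_run M n t) \<noteq> 0"
      using sim_run_res(2)[OF assms(1), where k = "psnd n" and a = "pfst (pfst n)" and b = "psnd (pfst n)"]
      by auto
    then show ?thesis by (intro exI[of _ t]) simp
  qed
  have "cmp D (\<lambda>p n. ?t n)"
  proof (rule cmp_Least)
    show "cmp D (\<lambda>p n. 1 - sim_res (sim_run M (pfst n) (psnd n)))"
      unfolding sim_res_def by (rule cmp_PR) (intro PR_intro PR_comp[OF PR_sim_run])
  qed (rule ex)
  then have "cmp D (\<lambda>p n. sim_res (sim_run M n (?t n)) - Suc 0)"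
    unfolding sim_res_def
    by (intro cmp_intro cmp_lift2[where h = "sim_run M", OF PR_sim_run])
  then have "cmp D (\<lambda>p n. (\<lambda>n. sim_res (sim_run M n (?t n)) - Suc 0)
     (prod_encode (prod_encode (f p n, g p n), h p n)))"
    by (rule cmp_comp) (intro cmp_intro assms)
  moreover have "sim_res (sim_run M n (?t n)) - Suc 0 = q a b k" if "n = prod_encode (prod_encode (a, b), k)" for a b k n
  proof -
    have "1 - sim_res (sim_run M n (?t n)) = 0" by (rule LeastI_ex[OF ex])
    then show ?thesis using sim_run_res(1)[OF assms(1)[of a b], where k = k and t = "?t n"] that by auto
  qed
  ultimately show ?thesis by simp
qed

section \<open>Complex Hilbert spaces\<close>

lemma scaleC_minus_one: "(- 1) *\<^sub>C x = - (x :: 'a::complex_hilbert)"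
  using scaleC_of_real[of "-1" x] by simp

lemma cinner_minus_left: "cinner (- x) y = - cinner (x :: 'a::complex_hilbert) y"
  using cinner_scaleC_left[of "- 1" x y] by (simp add: scaleC_minus_one)

lemma cinner_diff_left: "cinner (x - y) z = cinner x z - cinner (y :: 'a::complex_hilbert) z"
  using cinner_add_left[of x "- y" z] by (simp add: cinner_minus_left)

lemma cinner_diff_right: "cinner x (y - z) = cinner x y - cinner (x :: 'a::complex_hilbert) z"
  by (metis cinner_diff_left cinner_commute complex_cnj_diff)

lemma cinner_scaleC_right: "cinner x (c *\<^sub>C y) = cnj c * cinner (x :: 'a::complex_hilbert) y"
  by (metis cinner_scaleC_left cinner_commute complex_cnj_mult)

lemma cinner_zero_right [simp]: "cinner x 0 = (0 :: complex)" for x :: "'a::complex_hilbert"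
  using cinner_diff_right[of x 0 0] by simp

lemma Re_cinner_self: "Re (cinner x x) = (norm (x :: 'a::complex_hilbert))\<^sup>2"
  using cinner_ge_zero[of x] norm_eq_sqrt_cinner[of x] by simp

lemma cinner_self: "cinner x x = complex_of_real ((norm (x :: 'a::complex_hilbert))\<^sup>2)"
proof -
  have "Im (cinner x x) = 0"
    using arg_cong[OF cinner_commute[of x x], of Im] by simp
  then show ?thesis by (simp add: complex_eq_iff Re_cinner_self)
qed

lemma norm_diff_sq:
  "(norm (x - y))\<^sup>2 = (norm x)\<^sup>2 + (norm y)\<^sup>2 - 2 * Re (cinner x (y :: 'a::complex_hilbert))"
proof -
  have "Re (cinner y x) = Re (cinner x y)"
    using arg_cong[OF cinner_commute[of y x], of Re] by simp
  then show ?thesis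
    by (simp flip: Re_cinner_self add: cinner_diff_left cinner_diff_right)
qed

lemma cnj_mult_self: "cnj c * c = (complex_of_real (cmod c))\<^sup>2" "c * cnj c = (complex_of_real (cmod c))\<^sup>2"
  by (metis complex_norm_square of_real_power mult.commute)+

lemma norm_scaleC: "norm (c *\<^sub>C x) = cmod c * norm (x :: 'a::complex_hilbert)"
proof -
  have "complex_of_real ((norm (c *\<^sub>C x))\<^sup>2) = complex_of_real ((cmod c * norm x)\<^sup>2)"
    unfolding cinner_self[symmetric] cinner_scaleC_left cinner_scaleC_right
    by (simp add: cinner_self power_mult_distrib mult.assoc[symmetric] cnj_mult_self)
  then show ?thesis by (simp only: of_real_eq_iff) (simp add: power2_eq_iff_nonneg)
qed

lemma cinner_Cauchy_Schwarz: "cmod (cinner x y) \<le> norm x * norm (y :: 'a::complex_hilbert)"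
proof (cases "y = 0")
  case False
  \<comment> \<open>The coefficient of the orthogonal projection of \<open>x\<close> to the line
    spanned by \<open>y\<close>; the residual has nonnegative squared norm.\<close>
  define c where "c = cinner x y / complex_of_real ((norm y)\<^sup>2)"
  have cc: "cnj c * cinner x y = complex_of_real ((cmod (cinner x y))\<^sup>2 / (norm y)\<^sup>2)"
    by (simp add: c_def cnj_mult_self)
  have "norm (c *\<^sub>C y) = cmod (cinner x y) / norm y"
    using False by (simp add: norm_scaleC c_def norm_divide norm_mult power2_eq_square)
  then have "(norm (x - c *\<^sub>C y))\<^sup>2 = (norm x)\<^sup>2 - (cmod (cinner x y))\<^sup>2 / (norm y)\<^sup>2"
    by (simp add: norm_diff_sq cinner_scaleC_right cc power_divide)
  then have "(cmod (cinner x y))\<^sup>2 / (norm y)\<^sup>2 \<le> (norm x)\<^sup>2"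
    by (metis diff_ge_0_iff_ge zero_le_power2)
  then have "(cmod (cinner x y))\<^sup>2 \<le> (norm x * norm y)\<^sup>2"
    using False by (simp add: divide_simps power_mult_distrib)
  then show ?thesis by (rule power2_le_imp_le) simp
qed simp

lemma bounded_clinear_riesz: "bounded_clinear (riesz_functional y)" for y :: "'a::complex_hilbert"
proof -
  have "bounded_linear (riesz_functional y)"
    unfolding riesz_functional_def
  proof
    show "cinner (r *\<^sub>R b) y = r *\<^sub>R cinner b y" for r b
      using cinner_scaleC_left[of "complex_of_real r" b y]
      by (simp add: scaleC_of_real scaleR_conv_of_real)
    show "\<exists>K. \<forall>x. norm (cinner x y) \<le> norm x * K"
      using cinner_Cauchy_Schwarz by blast
  qed (rule cinner_add_left)
  then show ?thesis
    by (simp add: bounded_clinear_def riesz_functional_def cinner_scaleC_left scaleC_complex_def)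
qed

text \<open>Cauchy-Schwarz bounds the norm from above, and the functional attains the bound at
  \<open>y\<close> itself.\<close>

lemma onorm_riesz: "onorm (riesz_functional y) = norm (y :: 'a::complex_hilbert)"
proof (rule antisym)
  show "onorm (riesz_functional y) \<le> norm y"
    by (rule onorm_bound) (simp_all add: riesz_functional_def cinner_Cauchy_Schwarz mult.commute[of "norm y"])
  have "bounded_linear (riesz_functional y)"
    using bounded_clinear_riesz[of y] by (simp add: bounded_clinear_def)
  then have "norm (riesz_functional y y) \<le> onorm (riesz_functional y) * norm y"
    by (rule onorm)
  moreover have "norm (riesz_functional y y) = norm y * norm y"
    by (simp add: riesz_functional_def cinner_self norm_power power2_eq_square norm_mult)
  ultimately show "norm y \<le> onorm (riesz_functional y)"
    by (cases "y = 0") (use onorm_pos_le[OF \<open>bounded_linear _\<close>] in auto)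
qed

lemma riesz_functional_inject: "riesz_functional y = riesz_functional z \<longleftrightarrow> y = (z :: 'a::complex_hilbert)"
proof
  assume "riesz_functional y = riesz_functional z"
  then have "cinner (y - z) y = cinner (y - z) z"
    by (metis riesz_functional_def)
  then have "cinner (y - z) (y - z) = 0"
    by (simp add: cinner_diff_right)
  then show "y = z" by (simp add: cinner_eq_zero_iff)
qed simp

lemma frame_map_inject: "frame_map F = frame_map G \<longleftrightarrow> F = (G :: nat \<Rightarrow> 'a::complex_hilbert)"
  by (auto simp: frame_map_def fun_eq_iff[of _ "\<lambda>i. riesz_functional (G i)"] riesz_functional_inject)

lemma g_frame_frame_map:
  assumes "frame (F :: nat \<Rightarrow> 'a::complex_hilbert)"
  shows "g_frame (frame_map F)"
  using assms unfolding g_frame_def frame_def frame_map_def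
  by (simp add: bounded_clinear_riesz) (simp add: riesz_functional_def)

lemma Re_cinner_polar:
  "Re (cinner x y) = ((norm x)\<^sup>2 + (norm y)\<^sup>2 - (norm (x - y))\<^sup>2) / 2" for x y :: "'a::complex_hilbert"
  by (simp add: norm_diff_sq)

lemma Im_cinner: "Im (cinner x y) = Re (cinner x (\<i> *\<^sub>C y))" for x y :: "'a::complex_hilbert"
  by (simp add: cinner_scaleC_right)

subsection \<open>Density of the rational linear combinations\<close>

lemma rational_enum_code: "rational_enum (prod_encode (int_encode z, d)) = of_int z / of_nat (Suc d)"
  by (simp add: rational_enum_def)

lemma rational_enum_dense:
  assumes "0 < \<epsilon>"
  shows "\<exists>n. \<bar>rational_enum n - x\<bar> < \<epsilon>"
proof -
  obtain d where d: "1 / real (Suc d) < \<epsilon>"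
    using assms by (rule nat_approx_posE)
  let ?z = "\<lfloor>x * real (Suc d)\<rfloor>"
  have "\<bar>of_int ?z - x * real (Suc d)\<bar> \<le> 1" by linarith
  then have "\<bar>of_int ?z - x * real (Suc d)\<bar> / real (Suc d) \<le> 1 / real (Suc d)"
    by (rule divide_right_mono) simp
  moreover have "of_int ?z / real (Suc d) - x = (of_int ?z - x * real (Suc d)) / real (Suc d)"
    by (simp add: diff_divide_distrib)
  ultimately have "\<bar>of_int ?z / real (Suc d) - x\<bar> \<le> 1 / real (Suc d)"
    by (simp only: abs_divide abs_of_nat)
  then show ?thesis
    using d by (intro exI[of _ "prod_encode (int_encode ?z, d)"]) (simp add: rational_enum_code)
qed

lemma complex_rational_enum_code:
  "complex_rational_enum (prod_encode (a, b)) = Complex (rational_enum a) (rational_enum b)"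
  by (simp add: complex_rational_enum_def)

lemma complex_rational_enum_dense:
  assumes "0 < \<epsilon>"
  shows "\<exists>n. cmod (complex_rational_enum n - c) < \<epsilon>"
proof -
  obtain a b where "\<bar>rational_enum a - Re c\<bar> < \<epsilon> / 2" "\<bar>rational_enum b - Im c\<bar> < \<epsilon> / 2"
    using rational_enum_dense[of "\<epsilon> / 2"] assms by (meson half_gt_zero)
  moreover have "cmod (complex_rational_enum (prod_encode (a, b)) - c) \<le>
    \<bar>rational_enum a - Re c\<bar> + \<bar>rational_enum b - Im c\<bar>"
    using cmod_le[of "complex_rational_enum (prod_encode (a, b)) - c"]
    by (simp add: complex_rational_enum_code)
  ultimately show ?thesis by (intro exI[of _ "prod_encode (a, b)"]) simp
qed

text \<open>\<open>lincomb_enum\<close> uses initial segments of \<open>e\<close>, so sums of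
  different lengths are padded with zero coefficients to a common one.\<close>

lemma cspan_range_eq_sum:
  assumes "x \<in> cspan (range (e :: nat \<Rightarrow> 'a::complex_hilbert))"
  shows "\<exists>N c. x = (\<Sum>i<N. c i *\<^sub>C e i)"
  using assms
proof (induction rule: complex_hilbert.span_induct_alt)
  case base
  show ?case by (rule exI[of _ 0]) simp
next
  case (step a x y)
  then obtain j N c where x: "x = e j" and y: "y = (\<Sum>i<N. c i *\<^sub>C e i)" by blast
  define c' where "c' i = (if i < N then c i else 0)" for i
  let ?M = "max N (Suc j)"
  have zero: "(0 :: complex) *\<^sub>C e i = 0" for i
    by (rule complex_hilbert.scale_zero_left)
  have "y = (\<Sum>i<?M. c' i *\<^sub>C e i)"
    unfolding y by (rule sum.mono_neutral_cong_left) (auto simp: c'_def zero)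
  moreover have "a *\<^sub>C x = (\<Sum>i<?M. (if i = j then a else 0) *\<^sub>C e i)"
    by (simp add: x if_distrib[of "\<lambda>c. c *\<^sub>C _"] zero sum.delta less_max_iff_disj cong: if_cong)
  ultimately have "a *\<^sub>C x + y = (\<Sum>i<?M. ((if i = j then a else 0) + c' i) *\<^sub>C e i)"
    by (simp add: scaleC_add_left sum.distrib)
  then show ?case by (intro exI)
qed

lemma lincomb_enum_dense:
  assumes "closure (cspan (range (e :: nat \<Rightarrow> 'a::complex_hilbert))) = UNIV" "0 < \<epsilon>"
  shows "\<exists>n. norm (lincomb_enum e n - y) < \<epsilon>"
proof -
  obtain x where x: "x \<in> cspan (range e)" "norm (x - y) < \<epsilon> / 2"
  proof -
    have "y \<in> closure (cspan (range e))" "0 < \<epsilon> / 2" using assms by auto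
    then have "\<exists>x\<in>cspan (range e). dist x y < \<epsilon> / 2" by (simp only: closure_approachable)
    then show ?thesis using that by (auto simp only: dist_norm)
  qed
  obtain N c where c: "x = (\<Sum>i<N. c i *\<^sub>C e i)" using cspan_range_eq_sum[OF x(1)] by blast
  \<comment> \<open>The summand 1 keeps \<open>S\<close> positive; coefficient errors below
    \<open>\<epsilon> / (2 * S)\<close> then add up to at most
    \<open>\<epsilon> / 2\<close>.\<close>
  define S where "S = (\<Sum>i<N. norm (e i)) + 1"
  have S: "S > 0" unfolding S_def by (intro add_nonneg_pos sum_nonneg) auto
  have "\<forall>i. \<exists>n. cmod (complex_rational_enum n - c i) < \<epsilon> / (2 * S)"
    using complex_rational_enum_dense[of "\<epsilon> / (2 * S)"] assms(2) S by simp
  then obtain r where r: "\<And>i. cmod (complex_rational_enum (r i) - c i) < \<epsilon> / (2 * S)"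
    by metis
  let ?n = "list_encode (map r [0..<N])"
  have "lincomb_enum e ?n - x = (\<Sum>i<N. (complex_rational_enum (r i) - c i) *\<^sub>C e i)"
    by (simp add: lincomb_enum_def c complex_hilbert.scale_left_diff_distrib sum_subtractf)
  then have "norm (lincomb_enum e ?n - x) \<le> (\<Sum>i<N. cmod (complex_rational_enum (r i) - c i) * norm (e i))"
    using norm_sum[of "\<lambda>i. (complex_rational_enum (r i) - c i) *\<^sub>C e i" "{..<N}"]
    by (simp add: norm_scaleC)
  also have "\<dots> \<le> (\<Sum>i<N. \<epsilon> / (2 * S) * norm (e i))"
    using r by (intro sum_mono mult_right_mono) (auto intro: less_imp_le)
  also have "\<dots> = \<epsilon> / (2 * S) * (S - 1)"
    by (simp add: S_def sum_distrib_left)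
  also have "\<dots> \<le> \<epsilon> / (2 * S) * S"
    using assms(2) S by (intro mult_left_mono) auto
  also have "\<dots> = \<epsilon> / 2" using S by simp
  finally have "norm (lincomb_enum e ?n - y) < \<epsilon>"
    using x(2) norm_triangle_ineq[of "lincomb_enum e ?n - x" "x - y"] by simp
  then show ?thesis by blast
qed

subsection \<open>Cauchy names and approximations by integers\<close>

lemma cauchy_rep_dist:
  assumes "cauchy_rep \<alpha> p x"
  shows "dist (\<alpha> (p k)) x \<le> (1 / 2) ^ k"
proof (rule tendsto_upperbound)
  show "(\<lambda>l. dist (\<alpha> (p k)) (\<alpha> (p l))) \<longlonglongrightarrow> dist (\<alpha> (p k)) x"
    using assms by (intro tendsto_intros) (simp add: cauchy_rep_def)
  show "\<forall>\<^sub>F l in sequentially. dist (\<alpha> (p k)) (\<alpha> (p l)) \<le> (1 / 2) ^ k"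
    using eventually_gt_at_top[of k]
    by eventually_elim (use assms in \<open>auto simp: cauchy_rep_def less_imp_le\<close>)
qed simp

text \<open>The margin of two binary digits pays for two terms in the triangle inequality and for
  the strict inequality.\<close>

lemma cauchy_repI:
  assumes "\<And>k. dist (\<alpha> (p k)) x \<le> (1 / 2) ^ (k + 2)"
  shows "cauchy_rep \<alpha> p x"
  unfolding cauchy_rep_def
proof (intro conjI allI impI)
  fix k l :: nat
  assume "k < l"
  have "dist (\<alpha> (p k)) (\<alpha> (p l)) \<le> dist (\<alpha> (p k)) x + dist (\<alpha> (p l)) x"
    by (rule dist_triangle2)
  also have "\<dots> \<le> (1 / 2) ^ (k + 2) + (1 / 2) ^ (l + 2)"
    using assms by (intro add_mono)
  also have "\<dots> \<le> (1 / 2) ^ (k + 2) + (1 / 2) ^ (k + 2)"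
    using \<open>k < l\<close> by (intro add_left_mono power_decreasing) auto
  also have "\<dots> < (1 / 2) ^ k" by simp
  finally show "dist (\<alpha> (p k)) (\<alpha> (p l)) < (1 / 2) ^ k" .
next
  have "(\<lambda>k. (1 / 2 :: real) ^ (k + 2)) \<longlonglongrightarrow> 0"
    by (rule LIMSEQ_ignore_initial_segment[OF LIMSEQ_realpow_zero]) auto
  then show "(\<lambda>k. \<alpha> (p k)) \<longlonglongrightarrow> x"
    by (rule metric_tendsto_imp_tendsto) (use assms in auto)
qed

text \<open>With \<open>neg_approx\<close> the positive and negative part of \<open>2 ^ K\<close>
  times the rational coded by \<open>c\<close>, rounded down. Two natural numbers replace a signed
  one; an odd numerator code stands for a negative numerator.\<close>

definition pos_approx :: "nat \<Rightarrow> nat \<Rightarrow> nat" where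
  "pos_approx c K = (if even (pfst c) then pfst c div 2 * 2 ^ K div Suc (psnd c) else 0)"

definition neg_approx :: "nat \<Rightarrow> nat \<Rightarrow> nat" where
  "neg_approx c K = (if even (pfst c) then 0 else Suc (pfst c div 2) * 2 ^ K div Suc (psnd c))"

lemma cmp_approx [cmp_intro]:
  assumes "cmp D f" "cmp D g"
  shows "cmp D (\<lambda>p n. pos_approx (f p n) (g p n))" "cmp D (\<lambda>p n. neg_approx (f p n) (g p n))"
  unfolding pos_approx_def neg_approx_def by (intro cmp_intro assms)+

lemma real_div_Suc: "real (m div Suc d) \<le> real m / real (Suc d)" "real m / real (Suc d) < real (m div Suc d) + 1"
proof -
  have "real (m div Suc d) = of_int \<lfloor>real m / real (Suc d)\<rfloor>"
    by (simp only: floor_divide_of_nat_eq of_int_of_nat_eq)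
  then show "real (m div Suc d) \<le> real m / real (Suc d)" "real m / real (Suc d) < real (m div Suc d) + 1"
    by linarith+
qed

lemma approx_rational:
  "\<bar>real (pos_approx c K) - real (neg_approx c K) - 2 ^ K * rational_enum c\<bar> \<le> 1"
proof -
  obtain z d where c: "c = prod_encode (z, d)" by (metis prod_decode_inverse surj_pair)
  show ?thesis
  proof (cases "even z")
    case True
    then have "2 ^ K * rational_enum c = real (z div 2 * 2 ^ K) / real (Suc d)"
      by (simp add: c rational_enum_def int_decode_def sum_decode_def)
    then show ?thesis
      using True real_div_Suc[of "z div 2 * 2 ^ K" d] by (simp add: c pos_approx_def neg_approx_def)
  next
    case False
    then have "2 ^ K * rational_enum c = - (real (Suc (z div 2) * 2 ^ K) / real (Suc d))"
      by (simp add: c rational_enum_def int_decode_def sum_decode_def field_simps)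
    then show ?thesis
      using False real_div_Suc[of "Suc (z div 2) * 2 ^ K" d] by (simp add: c pos_approx_def neg_approx_def)
  qed
qed

text \<open>One unit of error comes from rounding, one from the rational. For nonnegative
  \<open>x\<close> the negative part may be dropped: if it is positive, \<open>pos_approx\<close>
  vanishes and \<open>2 ^ K * x\<close> is itself at most 2.\<close>

lemma pos_approx_nonneg:
  assumes "\<bar>rational_enum c - x\<bar> \<le> (1 / 2) ^ K" "0 \<le> x"
  shows "\<bar>real (pos_approx c K) - 2 ^ K * x\<bar> \<le> 2"
proof -
  have "\<bar>2 ^ K * rational_enum c - 2 ^ K * x\<bar> = 2 ^ K * \<bar>rational_enum c - x\<bar>"
    by (simp add: abs_mult flip: right_diff_distrib)
  also have "\<dots> \<le> 2 ^ K * (1 / 2) ^ K"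
    using assms(1) by (intro mult_left_mono) auto
  also have "\<dots> = 1" by (simp flip: power_mult_distrib)
  finally have 1: "\<bar>2 ^ K * rational_enum c - 2 ^ K * x\<bar> \<le> 1" .
  have "pos_approx c K = 0 \<or> neg_approx c K = 0"
    by (simp add: pos_approx_def neg_approx_def)
  moreover have "0 \<le> 2 ^ K * x" using assms(2) by simp
  ultimately show ?thesis using 1 approx_rational[of c K] by (auto simp: abs_le_iff)
qed

definition rat_code :: "nat \<Rightarrow> nat \<Rightarrow> nat \<Rightarrow> nat" where
  "rat_code u v m = prod_encode (if v \<le> u then 2 * (u - v) else 2 * (v - u) - 1, m - 1)"

lemma cmp_rat_code [cmp_intro]:
  "cmp D f \<Longrightarrow> cmp D g \<Longrightarrow> cmp D h \<Longrightarrow> cmp D (\<lambda>p n. rat_code (f p n) (g p n) (h p n))"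
  unfolding rat_code_def by (intro cmp_intro)

lemma rational_enum_rat_code:
  assumes "0 < m"
  shows "rational_enum (rat_code u v m) = (real u - real v) / real m"
proof (cases "v \<le> u")
  case True
  then show ?thesis using assms
    by (simp add: rat_code_def rational_enum_def int_decode_def sum_decode_def of_nat_diff)
next
  case False
  define w where "w = v - u - 1"
  have v: "v = u + w + 1" using False by (simp add: w_def)
  have "2 * (v - u) - 1 = 2 * w + 1" by (simp add: v)
  then show ?thesis using assms False
    by (simp add: rat_code_def rational_enum_def int_decode_def sum_decode_def v)
qed

text \<open>The difference of squares is factored; one factor is at most 2, the other at most
  \<open>2 * s * x + 2\<close>.\<close>

lemma sq_approx:
  fixes X s x :: real
  assumes "\<bar>X - s * x\<bar> \<le> 2" "0 \<le> s" "0 \<le> x"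
  shows "\<bar>X\<^sup>2 - s\<^sup>2 * x\<^sup>2\<bar> \<le> 4 * s * x + 4"
proof -
  have "\<bar>X + s * x\<bar> \<le> 2 * (s * x) + 2"
    using assms mult_nonneg_nonneg[OF assms(2,3)] by linarith
  then have "\<bar>X - s * x\<bar> * \<bar>X + s * x\<bar> \<le> 2 * (2 * (s * x) + 2)"
    using assms by (intro mult_mono) auto
  moreover have "X\<^sup>2 - s\<^sup>2 * x\<^sup>2 = (X - s * x) * (X + s * x)"
    by (simp add: power2_eq_square algebra_simps)
  ultimately show ?thesis by (simp add: abs_mult)
qed

section \<open>The Riesz map on names\<close>

subsection \<open>Lists and sequences of names\<close>

definition rep_list :: "nat \<Rightarrow> nat \<Rightarrow> nat" where
  "rep_list x k = ((\<lambda>l. Suc (prod_encode (x, l))) ^^ k) 0"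

lemma rep_list_eq: "rep_list x k = list_encode (map (\<lambda>_. x) [0..<k])"
proof -
  have "rep_list x k = list_encode (replicate k x)"
    by (induction k) (simp_all add: rep_list_def)
  then show ?thesis by (simp add: map_replicate_const)
qed

text \<open>The empty list has code 0 and its tail is again 0, so dropping past the end is harmless
  and a nonzero result means that more than \<open>d\<close> entries were present.\<close>

definition ldrop :: "nat \<Rightarrow> nat \<Rightarrow> nat" where
  "ldrop d v = ((\<lambda>l. psnd (l - 1)) ^^ d) v"

definition lhd :: "nat \<Rightarrow> nat" where
  "lhd v = pfst (v - 1)"

lemma ldrop_list_encode: "ldrop d (list_encode xs) = list_encode (drop d xs)"
proof (induction d)
  case (Suc d)
  have "psnd (list_encode ys - 1) = list_encode (tl ys)" for ys
    by (cases ys) (simp_all add: prod_decode_0)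
  then show ?case using Suc by (simp add: ldrop_def drop_Suc tl_drop)
qed (simp add: ldrop_def)

lemma cmp_list [cmp_intro]:
  assumes "cmp D f" "cmp D g"
  shows "cmp D (\<lambda>p n. rep_list (f p n) (g p n))" "cmp D (\<lambda>p n. ldrop (f p n) (g p n))"
  unfolding rep_list_def ldrop_def
  by (rule cmp_lift2[OF _ assms], intro PR_intro)+

lemma cmp_lhd [cmp_intro]: "cmp D f \<Longrightarrow> cmp D (\<lambda>p n. lhd (f p n))"
  unfolding lhd_def by (intro cmp_intro)

text \<open>The name of an entry of a sequence is evaluated at the index \<open>i\<close> with name \<open>i, i, i, \<dots>\<close>; the same
  function evaluates a functional at the point with index \<open>i\<close> in the dense sequence.\<close>

definition const_eval :: "name \<Rightarrow> nat \<Rightarrow> nat \<Rightarrow> nat" where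
  "const_eval A i n = A (prod_encode (n, rep_list i (LEAST k. 1 - A (prod_encode (n, rep_list i k)) = 0))) - 1"

lemma const_eval_eq:
  assumes "associate A (\<lambda>_. i) r"
  shows "const_eval A i n = r n"
proof -
  obtain k where k: "A (prod_encode (n, rep_list i k)) = Suc (r n)"
    "\<And>j. j < k \<Longrightarrow> A (prod_encode (n, rep_list i j)) = 0"
    using assms unfolding associate_def rep_list_eq by blast
  have "(LEAST k. 1 - A (prod_encode (n, rep_list i k)) = 0) = k"
  proof (rule Least_equality)
    show "k \<le> j" if "1 - A (prod_encode (n, rep_list i j)) = 0" for j
      using k(2)[of j] that by (cases "j < k") auto
  qed (simp add: k)
  then show ?thesis by (simp add: const_eval_def k)
qed

text \<open>The associate may itself be computed from the oracle, which permits nested evaluation.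
  Its being defined at constant names makes the search for the prefix length terminate.\<close>

lemma cmp_const_eval:
  assumes "cmp D (\<lambda>p n. A p (pfst n) (psnd n))"
    and ex: "\<And>p c i. p \<in> D \<Longrightarrow> \<exists>r. associate (A p c) (\<lambda>_. i) r"
    and "cmp D f" "cmp D g" "cmp D h"
  shows "cmp D (\<lambda>p n. const_eval (A p (f p n)) (g p n) (h p n))"
proof -
  let ?L = "\<lambda>p z. LEAST k. 1 - A p (pfst z) (prod_encode (psnd (psnd z), rep_list (pfst (psnd z)) k)) = 0"
  have "cmp D ?L"
  proof (rule cmp_Least)
    show "cmp D (\<lambda>p n. 1 - A p (pfst (pfst n))
      (prod_encode (psnd (psnd (pfst n)), rep_list (pfst (psnd (pfst n))) (psnd n))))"
      by (intro cmp_intro cmp_subst2[where F = A, OF assms(1)])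
    show "\<exists>k. 1 - A p (pfst z) (prod_encode (psnd (psnd z), rep_list (pfst (psnd z)) k)) = 0"
      if "p \<in> D" for p z
    proof -
      obtain r where "associate (A p (pfst z)) (\<lambda>_. pfst (psnd z)) r" using ex[OF \<open>p \<in> D\<close>] by blast
      then obtain k where "A p (pfst z) (prod_encode (psnd (psnd z), rep_list (pfst (psnd z)) k)) = Suc (r (psnd (psnd z)))"
        unfolding associate_def rep_list_eq by blast
      then show ?thesis by (intro exI[of _ k]) simp
    qed
  qed
  then have "cmp D (\<lambda>p z. const_eval (A p (pfst z)) (pfst (psnd z)) (psnd (psnd z)))"
    unfolding const_eval_def by (intro cmp_intro cmp_subst2[where F = A, OF assms(1)])
  from cmp_comp[OF this cmp_pair[OF assms(3) cmp_pair[OF assms(4,5)]]]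
  show ?thesis by simp
qed

text \<open>\<open>nat_rep\<close> looks only at the first entry of a name, so this associate is
  undetermined on the empty prefix and determined as soon as one entry is known.\<close>

definition seq_name :: "(nat \<Rightarrow> name) \<Rightarrow> name" where
  "seq_name r z = (if psnd z = 0 then 0 else Suc (r (lhd (psnd z)) (pfst z)))"

lemma seq_rep_seq_name:
  assumes "\<And>i. \<delta> (r i) (F i)"
  shows "seq_rep \<delta> (seq_name r) F"
  unfolding seq_rep_def fun_rep_def
proof (intro allI impI)
  fix q :: name and i
  assume "nat_rep q i"
  then have q: "q 0 = i" by (simp add: nat_rep_def)
  have "seq_name r (prod_encode (n, list_encode (map q [0..<1]))) = Suc (r i n)"
    "seq_name r (prod_encode (n, list_encode (map q [0..<0]))) = 0" for n
    by (simp_all add: seq_name_def lhd_def q)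
  then have "associate (seq_name r) q (r i)"
    unfolding associate_def by (metis less_one)
  then show "\<exists>r'. associate (seq_name r) q r' \<and> \<delta> r' (F i)" using assms by blast
qed

lemma seq_rep_const_eval:
  assumes "seq_rep \<delta> p F"
  shows "\<exists>r. associate p (\<lambda>_. i) r" "\<delta> (const_eval p i) (F i)"
proof -
  have "nat_rep (\<lambda>_. i) i" by (simp add: nat_rep_def)
  then obtain r where r: "associate p (\<lambda>_. i) r" "\<delta> r (F i)"
    using assms unfolding seq_rep_def fun_rep_def by blast
  then show "\<exists>r. associate p (\<lambda>_. i) r" by blast
  have "const_eval p i = r" using const_eval_eq[OF r(1)] by blast
  then show "\<delta> (const_eval p i) (F i)" using r(2) by simp
qed

lemma cmp_seq_eval:
  assumes "\<And>p. p \<in> D \<Longrightarrow> \<exists>F. seq_rep \<delta> p F" "cmp D f" "cmp D g"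
  shows "cmp D (\<lambda>p n. const_eval p (f p n) (g p n))"
proof (rule cmp_const_eval[where A = "\<lambda>p c. p" and f = "\<lambda>_ _. 0"])
  show "cmp D (\<lambda>p n. p (psnd n))"
    by (rule cmp_comp[OF cmp_oracle]) (intro cmp_intro)
  show "\<exists>r. associate p (\<lambda>_. i) r" if "p \<in> D" for p i
    using assms(1)[OF that] seq_rep_const_eval(1) by blast
qed (intro cmp_intro assms)+

subsection \<open>Multiplication by the imaginary unit\<close>

text \<open>Sends the numerator codes \<open>2 * m\<close> and \<open>2 * m - 1\<close> to each
  other; truncated subtraction leaves the code 0 of zero fixed.\<close>

definition rat_neg :: "nat \<Rightarrow> nat" where
  "rat_neg c = prod_encode (if even (pfst c) then pfst c - 1 else pfst c + 1, psnd c)"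

lemma rational_enum_rat_neg: "rational_enum (rat_neg c) = - rational_enum c"
proof -
  obtain z d where c: "c = prod_encode (z, d)" by (metis prod_decode_inverse surj_pair)
  have "int_decode (if even z then z - 1 else z + 1) = - int_decode z"
  proof (cases "even z")
    case True
    then obtain m where z: "z = 2 * m" by blast
    show ?thesis
    proof (cases m)
      case (Suc l)
      then show ?thesis by (simp add: z int_decode_def sum_decode_def)
    qed (simp add: z int_decode_def sum_decode_def)
  qed (auto simp: int_decode_def sum_decode_def elim!: oddE)
  then show ?thesis
    by (auto simp: rat_neg_def c rational_enum_def)
qed

definition i_mult :: "nat \<Rightarrow> nat" where
  "i_mult c = prod_encode (rat_neg (psnd c), pfst c)"

lemma complex_rational_enum_i_mult: "complex_rational_enum (i_mult c) = \<i> * complex_rational_enum c"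
  by (cases "prod_decode c") (simp add: i_mult_def complex_rational_enum_def rational_enum_rat_neg complex_eq_iff)

text \<open>Entries move one by one to an accumulator, hence the reversal; the code of a list bounds
  its length, so \<open>v\<close> rounds suffice. \<open>i_mult_list\<close> reverses a second
  time.\<close>

definition map_rev :: "(nat \<Rightarrow> nat) \<Rightarrow> nat \<Rightarrow> nat" where
  "map_rev f v = psnd (((\<lambda>z. if pfst z = 0 then z
     else prod_encode (psnd (pfst z - 1), Suc (prod_encode (f (lhd (pfst z)), psnd z)))) ^^ v) (prod_encode (v, 0)))"

lemma map_rev_list_encode: "map_rev f (list_encode xs) = list_encode (rev (map f xs))"
proof -
  let ?s = "\<lambda>z. if pfst z = 0 then z
     else prod_encode (psnd (pfst z - 1), Suc (prod_encode (f (lhd (pfst z)), psnd z)))"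
  have *: "length xs \<le> m \<Longrightarrow> (?s ^^ m) (prod_encode (list_encode xs, list_encode ys)) =
    prod_encode (0, list_encode (rev (map f xs) @ ys))" for m xs ys
  proof (induction m arbitrary: xs ys)
    case (Suc m)
    show ?case
    proof (cases xs)
      case Nil
      have "(?s ^^ n) (prod_encode (0, list_encode ys)) = prod_encode (0, list_encode ys)" for n
        by (induction n) auto
      then show ?thesis using Nil by (simp del: funpow.simps)
    next
      case (Cons a xs')
      then have "?s (prod_encode (list_encode xs, list_encode ys)) =
        prod_encode (list_encode xs', list_encode (f a # ys))"
        by (simp add: lhd_def)
      then show ?thesis
        using Suc.IH[of xs' "f a # ys"] Suc.prems Cons by (simp add: funpow_Suc_right del: funpow.simps(2))
    qed
  qed simp
  have "length xs \<le> list_encode xs" for xs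
  proof (induction xs)
    case (Cons a xs)
    then show ?case using le_prod_encode_2[of "list_encode xs" a] by simp
  qed simp
  from *[OF this, of xs "[]"] show ?thesis
    by (simp add: map_rev_def)
qed

definition i_mult_list :: "nat \<Rightarrow> nat" where
  "i_mult_list v = map_rev (\<lambda>c. c) (map_rev i_mult v)"

lemma list_decode_i_mult_list: "list_decode (i_mult_list v) = map i_mult (list_decode v)"
proof -
  obtain xs where v: "v = list_encode xs" by (metis list_decode_inverse)
  show ?thesis unfolding v i_mult_list_def map_rev_list_encode by (simp add: rev_map)
qed

lemma lincomb_enum_i_mult_list:
  "lincomb_enum e (i_mult_list v) = \<i> *\<^sub>C lincomb_enum e v" for e :: "nat \<Rightarrow> 'a::complex_hilbert"
  unfolding lincomb_enum_def list_decode_i_mult_list complex_hilbert.scale_sum_right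
  by (simp add: complex_rational_enum_i_mult scaleC_scaleC)

lemma cmp_i_mult_list [cmp_intro]: "cmp D f \<Longrightarrow> cmp D (\<lambda>p n. i_mult_list (f p n))"
proof (rule cmp_lift1[where g = i_mult_list])
  show "PR i_mult_list"
    unfolding i_mult_list_def map_rev_def i_mult_def rat_neg_def lhd_def by (intro PR_intro)
qed

subsection \<open>Computing with norms of rational linear combinations\<close>

lemma half_power: "(1 / 2 :: real) ^ k = 1 / 2 ^ k"
  by (simp add: power_one_over)

text \<open>With \<open>s = 2 ^ K\<close> and \<open>N = A + B\<close>, the errors of the three
  squares add up to at most \<open>20 * s * N\<close>. Division by \<open>2 * s\<^sup>2\<close>
  leaves at most \<open>16 * 2 ^ N / s\<close>, which is \<open>(1 / 2) ^ k\<close> by the choice of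
  \<open>K\<close>.\<close>

lemma polar_approx:
  fixes x y z :: real and X Y Z A B k K :: nat
  assumes X: "\<bar>real X - 2 ^ K * x\<bar> \<le> 2" "0 \<le> x" "x \<le> real A"
    and Y: "\<bar>real Y - 2 ^ K * y\<bar> \<le> 2" "0 \<le> y" "y \<le> real B"
    and Z: "\<bar>real Z - 2 ^ K * z\<bar> \<le> 2" "0 \<le> z" "z \<le> x + y"
    and A: "1 \<le> A" and K: "K = k + A + B + 4"
  shows "\<bar>(real (X\<^sup>2 + Y\<^sup>2) - real (Z\<^sup>2)) / real (2 * (2 ^ K * 2 ^ K)) - (x\<^sup>2 + y\<^sup>2 - z\<^sup>2) / 2\<bar> \<le> (1 / 2) ^ k"
proof -
  define s :: real where "s = 2 ^ K"
  define N where "N = A + B"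
  have s: "1 \<le> s" "0 < s" by (simp_all add: s_def)
  have N: "1 \<le> real N" "x + y \<le> real N" using assms by (simp_all add: N_def)
  have "\<bar>(real X)\<^sup>2 - s\<^sup>2 * x\<^sup>2\<bar> \<le> 4 * s * x + 4" "\<bar>(real Y)\<^sup>2 - s\<^sup>2 * y\<^sup>2\<bar> \<le> 4 * s * y + 4"
    "\<bar>(real Z)\<^sup>2 - s\<^sup>2 * z\<^sup>2\<bar> \<le> 4 * s * z + 4"
    using assms s by (intro sq_approx; simp add: s_def)+
  then have "\<bar>((real X)\<^sup>2 + (real Y)\<^sup>2 - (real Z)\<^sup>2) - s\<^sup>2 * (x\<^sup>2 + y\<^sup>2 - z\<^sup>2)\<bar> \<le>
    4 * s * (x + y + z) + 12"
    by (simp add: algebra_simps abs_le_iff)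
  also have "4 * s * (x + y + z) \<le> 4 * s * (2 * real N)"
    using s N Z by (intro mult_left_mono) auto
  \<comment> \<open>The additive constant is absorbed because both \<open>s\<close> and
    \<open>N\<close> are at least 1; this is where \<open>1 \<le> A\<close> enters.\<close>
  also have "4 * s * (2 * real N) + 12 \<le> 20 * (s * real N)"
    using mult_mono[of 1 s 1 "real N"] s N by simp
  finally have num: "\<bar>((real X)\<^sup>2 + (real Y)\<^sup>2 - (real Z)\<^sup>2) - s\<^sup>2 * (x\<^sup>2 + y\<^sup>2 - z\<^sup>2)\<bar> \<le> 20 * (s * real N)"
    by simp
  have "real N \<le> 2 ^ N"
    by (rule less_imp_le[OF of_nat_less_two_power])
  then have "20 * (s * real N) \<le> 32 * (s * 2 ^ N)"
    using s N by (intro mult_mono) auto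
  also have "\<dots> = 2 * s\<^sup>2 * (1 / 2) ^ k"
    by (simp add: s_def K N_def half_power power_add power2_eq_square)
  finally have fin: "20 * (s * real N) \<le> 2 * s\<^sup>2 * (1 / 2) ^ k" .
  have "(real (X\<^sup>2 + Y\<^sup>2) - real (Z\<^sup>2)) / real (2 * (2 ^ K * 2 ^ K)) - (x\<^sup>2 + y\<^sup>2 - z\<^sup>2) / 2 =
    (((real X)\<^sup>2 + (real Y)\<^sup>2 - (real Z)\<^sup>2) - s\<^sup>2 * (x\<^sup>2 + y\<^sup>2 - z\<^sup>2)) / (2 * s\<^sup>2)"
    by (simp add: diff_divide_distrib s_def power2_eq_square)
  then have "\<bar>(real (X\<^sup>2 + Y\<^sup>2) - real (Z\<^sup>2)) / real (2 * (2 ^ K * 2 ^ K)) - (x\<^sup>2 + y\<^sup>2 - z\<^sup>2) / 2\<bar> =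
    \<bar>((real X)\<^sup>2 + (real Y)\<^sup>2 - (real Z)\<^sup>2) - s\<^sup>2 * (x\<^sup>2 + y\<^sup>2 - z\<^sup>2)\<bar> / (2 * s\<^sup>2)"
    by (simp add: abs_divide)
  also have "\<dots> \<le> (2 * s\<^sup>2 * (1 / 2) ^ k) / (2 * s\<^sup>2)"
    using num fin by (intro divide_right_mono) auto
  also have "\<dots> = (1 / 2) ^ k" using s by simp
  finally show ?thesis .
qed

text \<open>What the reductions use of the space: names of the distances, the computability of these
  names relative to any oracle, and density.\<close>

locale norm_oracle =
  fixes e :: "nat \<Rightarrow> 'a::complex_hilbert" and q :: "nat \<Rightarrow> nat \<Rightarrow> name"
  assumes norm_name: "real_rep (q a b) (norm (lincomb_enum e a - lincomb_enum e b))"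
    and cmp_norm_name [cmp_intro]: "cmp D f \<Longrightarrow> cmp D g \<Longrightarrow> cmp D h \<Longrightarrow> cmp D (\<lambda>p n. q (f p n) (g p n) (h p n))"
    and dense: "0 < \<epsilon> \<Longrightarrow> \<exists>n. norm (lincomb_enum e n - y) < \<epsilon>"
begin

abbreviation "\<alpha> \<equiv> lincomb_enum e"

definition norm_approx :: "nat \<Rightarrow> nat \<Rightarrow> nat \<Rightarrow> nat" where
  "norm_approx a b K = pos_approx (q a b K) K"

lemma cmp_norm_approx [cmp_intro]:
  "cmp D f \<Longrightarrow> cmp D g \<Longrightarrow> cmp D h \<Longrightarrow> cmp D (\<lambda>p n. norm_approx (f p n) (g p n) (h p n))"
  unfolding norm_approx_def by (intro cmp_intro)

lemma norm_approx: "\<bar>real (norm_approx a b K) - 2 ^ K * norm (\<alpha> a - \<alpha> b)\<bar> \<le> 2"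
  unfolding norm_approx_def
  using cauchy_rep_dist[OF norm_name[unfolded real_rep_def], of a b K]
  by (intro pos_approx_nonneg) (auto simp: dist_real_def)

lemma lincomb_enum_0 [simp]: "\<alpha> 0 = 0"
  by (simp add: lincomb_enum_def)

text \<open>Index 0 codes the zero vector, and adding the error 2 of the unscaled approximation
  gives a natural upper bound of the norm.\<close>

definition norm_bound :: "nat \<Rightarrow> nat" where
  "norm_bound a = norm_approx a 0 0 + 2"

lemma cmp_norm_bound [cmp_intro]: "cmp D f \<Longrightarrow> cmp D (\<lambda>p n. norm_bound (f p n))"
  unfolding norm_bound_def by (intro cmp_intro)

lemma norm_bound: "norm (\<alpha> a) \<le> real (norm_bound a)" "1 \<le> norm_bound a"
  using norm_approx[of a 0 0] by (auto simp: norm_bound_def)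

text \<open>The imaginary part is the real part of the inner product with \<open>\<i>\<close> times
  the second vector. That vector has the same norm, so one precision \<open>K\<close> serves both
  parts.\<close>

definition inner_code :: "nat \<Rightarrow> nat \<Rightarrow> nat \<Rightarrow> nat" where
  "inner_code a b k = (let K = k + norm_bound a + norm_bound b + 4;
       n = (norm_approx a 0 K)\<^sup>2 + (norm_approx b 0 K)\<^sup>2; m = 2 * (2 ^ K * 2 ^ K);
       n' = (norm_approx a 0 K)\<^sup>2 + (norm_approx (i_mult_list b) 0 K)\<^sup>2
     in prod_encode (rat_code n ((norm_approx a b K)\<^sup>2) m,
          rat_code n' ((norm_approx a (i_mult_list b) K)\<^sup>2) m))"

lemma cmp_inner_code [cmp_intro]:
  "cmp D f \<Longrightarrow> cmp D g \<Longrightarrow> cmp D h \<Longrightarrow> cmp D (\<lambda>p n. inner_code (f p n) (g p n) (h p n))"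
  unfolding inner_code_def Let_def by (intro cmp_intro)

lemma inner_code: "cmod (complex_rational_enum (inner_code a b k) - cinner (\<alpha> a) (\<alpha> b)) \<le> 2 * (1 / 2) ^ k"
proof -
  define K where "K = k + norm_bound a + norm_bound b + 4"
  let ?r = "\<lambda>b. rational_enum (rat_code ((norm_approx a 0 K)\<^sup>2 + (norm_approx b 0 K)\<^sup>2)
    ((norm_approx a b K)\<^sup>2) (2 * (2 ^ K * 2 ^ K)))"
  have r: "\<bar>?r b' - Re (cinner (\<alpha> a) (\<alpha> b'))\<bar> \<le> (1 / 2) ^ k" if "norm (\<alpha> b') \<le> real (norm_bound b)" for b'
    unfolding Re_cinner_polar
    using norm_approx[of a 0 K] norm_approx[of b' 0 K] norm_approx[of a b' K] norm_bound[of a]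
      norm_triangle_ineq4[of "\<alpha> a" "\<alpha> b'"] that
    by (subst rational_enum_rat_code, simp)
       (intro polar_approx[OF _ _ norm_bound(1) _ _ that _ _ _ norm_bound(2) K_def]; simp)
  have "cmod (complex_rational_enum (inner_code a b k) - cinner (\<alpha> a) (\<alpha> b)) \<le>
    \<bar>?r b - Re (cinner (\<alpha> a) (\<alpha> b))\<bar> + \<bar>?r (i_mult_list b) - Im (cinner (\<alpha> a) (\<alpha> b))\<bar>"
    using cmod_le[of "complex_rational_enum (inner_code a b k) - cinner (\<alpha> a) (\<alpha> b)"]
    by (simp add: inner_code_def Let_def complex_rational_enum_code K_def)
  also have "\<dots> \<le> (1 / 2) ^ k + (1 / 2) ^ k"
    using r[of b] r[of "i_mult_list b"] norm_bound(1)[of b]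
    by (intro add_mono) (simp_all add: lincomb_enum_i_mult_list norm_scaleC Im_cinner)
  finally show ?thesis by simp
qed

subsection \<open>From vectors to functionals\<close>

text \<open>\<open>v\<close> is a prefix of the argument's name, and \<open>u = 0\<close> means that
  its entry \<open>J\<close> is not yet available. \<open>J\<close> depends on the prefix only
  through its first entry and hence is stable once that entry is known; on the empty prefix the
  value of \<open>J\<close> is immaterial, since \<open>u = 0\<close> anyway.\<close>

definition functional_name :: "name \<Rightarrow> name" where
  "functional_name y m = (let n = pfst m; v = psnd m;
     J = n + (norm_bound (lhd v) + norm_bound (y 0) + 2) + 4; u = ldrop J v
     in if u = 0 then 0 else Suc (inner_code (lhd u) (y J) (n + 4)))"

lemma hilbert_rep_norm:
  assumes "hilbert_rep e y x"
  shows "norm x \<le> real (norm_bound (y 0)) + 1" "norm (x - \<alpha> (y k)) \<le> (1 / 2) ^ k"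
proof -
  have *: "norm (x - \<alpha> (y k)) \<le> (1 / 2) ^ k" for k
    using cauchy_rep_dist[OF assms[unfolded hilbert_rep_def], of k] by (simp add: dist_norm norm_minus_commute)
  then show "norm (x - \<alpha> (y k)) \<le> (1 / 2) ^ k" .
  show "norm x \<le> real (norm_bound (y 0)) + 1"
    using *[of 0] norm_bound(1)[of "y 0"] norm_triangle_sub[of x "\<alpha> (y 0)"] by simp
qed

lemma functional_name:
  assumes y: "hilbert_rep e y z"
  shows "fun_rep (hilbert_rep e) complex_rep (functional_name y) (riesz_functional z)"
  unfolding fun_rep_def
proof (intro allI impI)
  fix p x
  assume p: "hilbert_rep e p x"
  define B where "B = norm_bound (p 0) + norm_bound (y 0) + 2"
  define J where "J n = n + B + 4" for n
  define r where "r n = inner_code (p (J n)) (y (J n)) (n + 4)" for n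
  have "functional_name y (prod_encode (n, list_encode (map p [0..<j]))) = 0" if "j < Suc (J n)" for n j
  proof (cases j)
    case 0
    then show ?thesis
      using ldrop_list_encode[of _ "[]"] by (simp add: functional_name_def Let_def)
  next
    case (Suc j')
    have "lhd (list_encode (map p [0..<j])) = p 0"
      using Suc by (simp add: upt_conv_Cons lhd_def del: upt_Suc)
    then show ?thesis
      using that ldrop_list_encode[of "J n" "map p [0..<j]"]
      by (simp add: functional_name_def Let_def J_def B_def)
  qed
  moreover have "functional_name y (prod_encode (n, list_encode (map p [0..<Suc (J n)]))) = Suc (r n)" for n
  proof -
    have 1: "lhd (list_encode (map p [0..<Suc (J n)])) = p 0"
      by (simp add: upt_conv_Cons lhd_def del: upt_Suc)
    have "ldrop (J n) (list_encode (map p [0..<Suc (J n)])) = list_encode [p (J n)]"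
      by (simp add: ldrop_list_encode)
    then have "ldrop (n + (norm_bound (p 0) + norm_bound (y 0) + 2) + 4)
      (list_encode (map p [0..<Suc (J n)])) = list_encode [p (J n)]"
      by (simp only: J_def B_def)
    then show ?thesis
      unfolding functional_name_def Let_def prod_encode_inverse fst_conv snd_conv 1
      by (simp add: lhd_def r_def J_def B_def)
  qed
  ultimately have "associate (functional_name y) p r"
    unfolding associate_def by blast
  moreover have "complex_rep r (riesz_functional z x)"
    unfolding complex_rep_def
  proof (rule cauchy_repI)
    fix n
    let ?x = "\<alpha> (p (J n))" and ?z = "\<alpha> (y (J n))" and ?d = "(1 / 2 :: real) ^ J n"
    have d: "0 \<le> ?d" "?d \<le> 1" by (simp_all add: power_le_one)
    \<comment> \<open>The 2 in \<open>B\<close> arises here: one unit from comparing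
      \<open>x\<close> with its first approximation, one from replacing \<open>x\<close> by
      \<open>?x\<close>.\<close>
    have nz: "norm z \<le> real B" and nx: "norm ?x \<le> real B"
      using hilbert_rep_norm[OF y] hilbert_rep_norm(1)[OF p] hilbert_rep_norm(2)[OF p, of "J n"]
        norm_triangle_sub[of ?x x] norm_minus_commute[of x ?x] d(2)
      by (simp_all add: B_def)
    have "cinner x z - cinner ?x ?z = cinner (x - ?x) z + cinner ?x (z - ?z)"
      by (simp add: cinner_diff_left cinner_diff_right)
    then have "cmod (cinner x z - cinner ?x ?z) \<le> cmod (cinner (x - ?x) z) + cmod (cinner ?x (z - ?z))"
      by (metis norm_triangle_ineq)
    also have "\<dots> \<le> norm (x - ?x) * norm z + norm ?x * norm (z - ?z)"
      by (intro add_mono cinner_Cauchy_Schwarz)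
    also have "\<dots> \<le> ?d * real B + real B * ?d"
      using nz nx d hilbert_rep_norm(2)[OF y] hilbert_rep_norm(2)[OF p] by (intro add_mono mult_mono) auto
    also have "\<dots> = 2 * (real B * ?d)" by simp
    also have "real B * ?d \<le> 2 ^ B * ?d"
      using d by (intro mult_right_mono less_imp_le[OF of_nat_less_two_power])
    also have "2 ^ B * ?d = (1 / 2) ^ (n + 4)"
      by (simp add: J_def half_power power_add)
    finally have 1: "cmod (cinner x z - cinner ?x ?z) \<le> 2 * (1 / 2) ^ (n + 4)" by simp
    have "dist (complex_rational_enum (r n)) (riesz_functional z x) \<le>
      cmod (complex_rational_enum (r n) - cinner ?x ?z) + cmod (cinner x z - cinner ?x ?z)"
      unfolding riesz_functional_def dist_norm
      by (metis norm_triangle_ineq4 diff_diff_eq2 diff_add_cancel add_diff_cancel)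
    also have "\<dots> \<le> 2 * (1 / 2) ^ (n + 4) + 2 * (1 / 2) ^ (n + 4)"
      using inner_code[of "p (J n)" "y (J n)" "n + 4"] 1 unfolding r_def by (intro add_mono)
    also have "\<dots> = (1 / 2) ^ (n + 2)" by (simp add: half_power power_add)
    finally show "dist (complex_rational_enum (r n)) (riesz_functional z x) \<le> (1 / 2) ^ (n + 2)" .
  qed
  ultimately show "\<exists>r. associate (functional_name y) p r \<and> complex_rep r (riesz_functional z x)"
    by blast
qed

definition norm_name_of :: "name \<Rightarrow> name" where
  "norm_name_of y k = rat_code (norm_approx (y (k + 3)) 0 (k + 5)) 0 (2 ^ (k + 5))"

lemma norm_name_of:
  assumes "hilbert_rep e y z"
  shows "real_rep (norm_name_of y) (norm z)"
  unfolding real_rep_def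
proof (rule cauchy_repI)
  fix k
  let ?z = "\<alpha> (y (k + 3))" and ?N = "real (norm_approx (y (k + 3)) 0 (k + 5))"
  have "\<bar>?N - 2 ^ (k + 5) * norm ?z\<bar> / 2 ^ (k + 5) \<le> 2 / 2 ^ (k + 5)"
    using norm_approx[of "y (k + 3)" 0 "k + 5"] by (intro divide_right_mono) auto
  moreover have "?N / 2 ^ (k + 5) - norm ?z = (?N - 2 ^ (k + 5) * norm ?z) / 2 ^ (k + 5)"
    by (simp add: diff_divide_distrib)
  ultimately have "\<bar>?N / 2 ^ (k + 5) - norm ?z\<bar> \<le> 2 / 2 ^ (k + 5)"
    by (simp only: abs_divide) simp
  moreover have "\<bar>norm z - norm ?z\<bar> \<le> (1 / 2) ^ (k + 3)"
    using norm_triangle_ineq3[of z ?z] hilbert_rep_norm(2)[OF assms, of "k + 3"] by simp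
  ultimately have "\<bar>?N / 2 ^ (k + 5) - norm z\<bar> \<le> 2 / 2 ^ (k + 5) + (1 / 2) ^ (k + 3)"
    by linarith
  \<comment> \<open>The precisions \<open>k + 5\<close> and \<open>k + 3\<close> contribute
    \<open>(1 / 2) ^ (k + 4)\<close> and \<open>(1 / 2) ^ (k + 3)\<close>, together below
    \<open>(1 / 2) ^ (k + 2)\<close>.\<close>
  also have "\<dots> \<le> (1 / 2) ^ (k + 2)"
    by (simp add: half_power power_add divide_simps)
  finally show "dist (rational_enum (norm_name_of y k)) (norm z) \<le> (1 / 2) ^ (k + 2)"
    unfolding norm_name_of_def by (subst rational_enum_rat_code) (simp_all add: dist_real_def)
qed

definition dual_name :: "name \<Rightarrow> name" where
  "dual_name y n = (if even n then functional_name y (n div 2) else norm_name_of y (n div 2))"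

lemma dual_name:
  assumes "hilbert_rep e y z"
  shows "dual_rep e (dual_name y) (riesz_functional z)"
proof -
  have "(\<lambda>n. dual_name y (2 * n)) = functional_name y" "(\<lambda>n. dual_name y (2 * n + 1)) = norm_name_of y"
    by (simp_all add: dual_name_def fun_eq_iff)
  then show ?thesis
    using functional_name[OF assms] norm_name_of[OF assms]
    by (simp add: dual_rep_def dual_space_def bounded_clinear_riesz pair_rep_def onorm_riesz)
qed

lemma frame_map_computable:
  "computable_on (Collect frame) (seq_rep (hilbert_rep e)) (seq_rep (dual_rep e)) frame_map"
proof -
  define D where "D = {p. \<exists>F. seq_rep (hilbert_rep e) p F}"
  have ev: "cmp D f \<Longrightarrow> cmp D g \<Longrightarrow> cmp D (\<lambda>p n. const_eval p (f p n) (g p n))" for f g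
    by (rule cmp_seq_eval) (auto simp: D_def)
  have "cmp D (\<lambda>p. seq_name (\<lambda>i. dual_name (const_eval p i)))"
    unfolding seq_name_def dual_name_def functional_name_def norm_name_of_def Let_def
    by (intro cmp_intro ev)
  then obtain M where M: "\<And>p. p \<in> D \<Longrightarrow> transforms M p (seq_name (\<lambda>i. dual_name (const_eval p i)))"
    using cmp_machine by blast
  show ?thesis
    unfolding computable_on_def
  proof (intro exI[of _ M] ballI allI impI)
    fix F p
    assume p: "seq_rep (hilbert_rep e) p F"
    have "seq_rep (dual_rep e) (seq_name (\<lambda>i. dual_name (const_eval p i))) (frame_map F)"
      unfolding frame_map_def
      by (rule seq_rep_seq_name) (rule dual_name[OF seq_rep_const_eval(2)[OF p]])
    then show "\<exists>q. transforms M p q \<and> seq_rep (dual_rep e) q (frame_map F)"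
      using M[of p] p by (auto simp: D_def)
  qed
qed

subsection \<open>From functionals to vectors\<close>

text \<open>\<open>l a\<close> is a name of \<open>\<langle>\<alpha> a, y\<rangle>\<close> and \<open>r\<close> one of \<open>\<parallel>y\<parallel>\<close>. The value is \<open>0\<close> if the approximation of
  \<open>\<parallel>\<alpha> a\<parallel>\<^sup>2 + \<parallel>y\<parallel>\<^sup>2 - 2 Re \<langle>\<alpha> a, y\<rangle> = \<parallel>\<alpha> a - y\<parallel>\<^sup>2\<close> is small enough.\<close>

definition close_test :: "(nat \<Rightarrow> name) \<Rightarrow> name \<Rightarrow> nat \<Rightarrow> nat \<Rightarrow> nat" where
  "close_test l r k a = (let K = 2 * k + (norm_bound a + (pos_approx (r 0) 0 + 2) + 1) + 10; c = pfst (l a K)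
     in (norm_approx a 0 K)\<^sup>2 + (pos_approx (r K) K)\<^sup>2 + 2 * (2 ^ K * neg_approx c K)
       - (2 * (2 ^ K * pos_approx c K) + 2 ^ (2 * K - (2 * k + 5))))"

text \<open>Scaled by \<open>s\<^sup>2\<close>, the squared distance is known up to
  \<open>1 / 2 ^ (2 * k + 6)\<close> and compared with \<open>1 / 2 ^ (2 * k + 5)\<close>.
  Acceptance therefore bounds it by \<open>1 / 2 ^ (2 * k + 4)\<close>, while values up to
  \<open>1 / 2 ^ (2 * k + 6)\<close> are always accepted. The gap makes the test decidable although
  equality of reals is not.\<close>

lemma close_test:
  assumes l: "\<And>a. complex_rep (l a) (riesz_functional y (\<alpha> a))" and r: "real_rep r (norm y)"
  shows "close_test l r k a = 0 \<Longrightarrow> norm (\<alpha> a - y) \<le> (1 / 2) ^ (k + 2)"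
    and "norm (\<alpha> a - y) \<le> (1 / 2) ^ (k + 3) \<Longrightarrow> close_test l r k a = 0"
proof -
  have r': "\<bar>real (pos_approx (r K) K) - 2 ^ K * norm y\<bar> \<le> 2" for K
    using cauchy_rep_dist[OF r[unfolded real_rep_def], of K]
    by (intro pos_approx_nonneg) (auto simp: dist_real_def)
  \<comment> \<open>The 2 turns the approximation of the norm of \<open>y\<close> into an upper
    bound; the 1 leaves room for the error of the inner product.\<close>
  define b where "b = norm_bound a + (pos_approx (r 0) 0 + 2) + 1"
  define K where "K = 2 * k + b + 10"
  define s :: real where "s = 2 ^ K"
  define c where "c = pfst (l a K)"
  define X where "X = real (norm_approx a 0 K)"
  define Y where "Y = real (pos_approx (r K) K)"
  define R where "R = real (pos_approx c K) - real (neg_approx c K)"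
  define T where "T = X\<^sup>2 + Y\<^sup>2 - 2 * s * R"
  have s: "1 \<le> s" "0 < s" by (simp_all add: s_def)
  have b: "norm (\<alpha> a) + norm y + 1 \<le> real b" "1 \<le> real b"
    using norm_bound[of a] r'[of 0] by (auto simp: b_def)
  have X: "\<bar>X\<^sup>2 - s\<^sup>2 * (norm (\<alpha> a))\<^sup>2\<bar> \<le> 4 * s * norm (\<alpha> a) + 4"
    using norm_approx[of a 0 K] s by (intro sq_approx) (auto simp: X_def s_def)
  have Y: "\<bar>Y\<^sup>2 - s\<^sup>2 * (norm y)\<^sup>2\<bar> \<le> 4 * s * norm y + 4"
    using r'[of K] s by (intro sq_approx) (auto simp: Y_def s_def)
  have R: "\<bar>R - s * Re (cinner (\<alpha> a) y)\<bar> \<le> 2"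
  proof -
    have "\<bar>Re (complex_rational_enum (l a K) - cinner (\<alpha> a) y)\<bar> \<le> (1 / 2) ^ K"
      using cauchy_rep_dist[OF l[unfolded complex_rep_def], of a K]
        abs_Re_le_cmod[of "complex_rational_enum (l a K) - cinner (\<alpha> a) y"]
      by (simp add: dist_norm riesz_functional_def)
    then have "\<bar>rational_enum c - Re (cinner (\<alpha> a) y)\<bar> \<le> (1 / 2) ^ K"
      by (simp add: c_def complex_rational_enum_def split: prod.splits)
    then have "s * \<bar>rational_enum c - Re (cinner (\<alpha> a) y)\<bar> \<le> s * (1 / 2) ^ K"
      using s by (intro mult_left_mono) auto
    also have "\<dots> = 1" by (simp add: s_def half_power)
    also have "s * \<bar>rational_enum c - Re (cinner (\<alpha> a) y)\<bar> = \<bar>s * rational_enum c - s * Re (cinner (\<alpha> a) y)\<bar>"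
      using s by (simp add: abs_mult flip: right_diff_distrib)
    finally show ?thesis
      using approx_rational[of c K] unfolding R_def s_def by linarith
  qed
  have "T - s\<^sup>2 * (norm (\<alpha> a - y))\<^sup>2 = (X\<^sup>2 - s\<^sup>2 * (norm (\<alpha> a))\<^sup>2) + (Y\<^sup>2 - s\<^sup>2 * (norm y)\<^sup>2)
    - 2 * s * (R - s * Re (cinner (\<alpha> a) y))"
    unfolding T_def norm_diff_sq by (simp add: power2_eq_square algebra_simps)
  moreover have "\<bar>2 * s * (R - s * Re (cinner (\<alpha> a) y))\<bar> \<le> 4 * s"
    using mult_left_mono[OF R, of "2 * s"] s by (simp add: abs_mult)
  ultimately have "\<bar>T - s\<^sup>2 * (norm (\<alpha> a - y))\<^sup>2\<bar> \<le> 4 * s * (norm (\<alpha> a) + norm y + 1) + 8"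
    using X Y by (simp add: distrib_left)
  also have "4 * s * (norm (\<alpha> a) + norm y + 1) \<le> 4 * s * real b"
    using b s by (intro mult_left_mono) auto
  also have "4 * s * real b + 8 \<le> 16 * (s * real b)"
    using mult_mono[of 1 s 1 "real b"] s b by simp
  also have "\<dots> \<le> 16 * (s * 2 ^ b)"
    using s less_imp_le[OF of_nat_less_two_power[of b, where 'a = real]] by (intro mult_left_mono) auto
  also have "\<dots> = s\<^sup>2 / 2 ^ (2 * k + 6)"
    by (simp add: s_def K_def power_add power2_eq_square)
  finally have T: "\<bar>T - s\<^sup>2 * (norm (\<alpha> a - y))\<^sup>2\<bar> \<le> s\<^sup>2 / 2 ^ (2 * k + 6)" by simp
  have p2: "(2 :: real) ^ (2 * K - (2 * k + 5)) = s\<^sup>2 / 2 ^ (2 * k + 5)"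
  proof -
    have "2 * k + 5 \<le> 2 * K" by (simp add: K_def)
    then have "(2 :: real) ^ (2 * K - (2 * k + 5)) = 2 ^ (2 * K) / 2 ^ (2 * k + 5)"
      by (simp only: power_diff)
    also have "(2 :: real) ^ (2 * K) = s\<^sup>2"
      by (simp add: s_def power_even_eq)
    finally show ?thesis .
  qed
  \<comment> \<open>Truncated subtraction vanishes exactly when the inequality holds; terms of
    negative sign have been moved to the other side to stay within the natural numbers.\<close>
  have "close_test l r k a = 0 \<longleftrightarrow>
    real ((norm_approx a 0 K)\<^sup>2 + (pos_approx (r K) K)\<^sup>2 + 2 * (2 ^ K * neg_approx c K)) \<le>
    real (2 * (2 ^ K * pos_approx c K) + 2 ^ (2 * K - (2 * k + 5)))"
    unfolding of_nat_le_iff by (simp add: close_test_def Let_def K_def c_def b_def)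
  also have "\<dots> \<longleftrightarrow> T \<le> s\<^sup>2 / 2 ^ (2 * k + 5)"
    unfolding of_nat_add of_nat_mult of_nat_power of_nat_numeral p2 T_def X_def Y_def R_def s_def[symmetric]
    by (simp add: algebra_simps)
  finally have test: "close_test l r k a = 0 \<longleftrightarrow> T \<le> s\<^sup>2 / 2 ^ (2 * k + 5)" .
  show "norm (\<alpha> a - y) \<le> (1 / 2) ^ (k + 2)" if "close_test l r k a = 0"
  proof -
    have "s\<^sup>2 * (norm (\<alpha> a - y))\<^sup>2 \<le> s\<^sup>2 / 2 ^ (2 * k + 5) + s\<^sup>2 / 2 ^ (2 * k + 6)"
      using that T unfolding test by linarith
    also have "\<dots> \<le> s\<^sup>2 * (1 / 2 ^ (2 * k + 4))"
      by (simp add: power_add field_simps)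
    finally have "(norm (\<alpha> a - y))\<^sup>2 \<le> 1 / 2 ^ (2 * k + 4)"
      by (rule mult_left_le_imp_le) (use s in simp)
    also have "\<dots> = ((1 / 2) ^ (k + 2))\<^sup>2"
      by (simp add: half_power power_divide power_add power2_eq_square power_even_eq)
    finally show ?thesis by (rule power2_le_imp_le) simp
  qed
  show "close_test l r k a = 0" if "norm (\<alpha> a - y) \<le> (1 / 2) ^ (k + 3)"
  proof -
    have "(norm (\<alpha> a - y))\<^sup>2 \<le> ((1 / 2) ^ (k + 3))\<^sup>2"
      using that by (rule power_mono) simp
    also have "\<dots> = 1 / 2 ^ (2 * k + 6)"
      by (simp add: half_power power_divide power_add power2_eq_square power_even_eq)
    finally have "s\<^sup>2 * (norm (\<alpha> a - y))\<^sup>2 \<le> s\<^sup>2 * (1 / 2 ^ (2 * k + 6))"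
      by (rule mult_left_mono) simp
    then have "T \<le> s\<^sup>2 / 2 ^ (2 * k + 6) + s\<^sup>2 / 2 ^ (2 * k + 6)"
      using T by (simp only: times_divide_eq_right mult_1_right)
    also have "\<dots> = s\<^sup>2 / 2 ^ (2 * k + 5)" by (simp add: power_add field_simps)
    finally show ?thesis by (simp add: test)
  qed
qed

lemma const_name: "hilbert_rep e (\<lambda>_. a) (\<alpha> a)"
  by (simp add: hilbert_rep_def cauchy_rep_def)

definition vector_name :: "name \<Rightarrow> name" where
  "vector_name p k = (LEAST a. close_test (const_eval (\<lambda>m. p (2 * m))) (\<lambda>j. p (2 * j + 1)) k a = 0)"

lemma dual_rep_names:
  assumes "dual_rep e p (riesz_functional y)"
  shows "\<exists>r. associate (\<lambda>m. p (2 * m)) (\<lambda>_. a) r"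
    "complex_rep (const_eval (\<lambda>m. p (2 * m)) a) (riesz_functional y (\<alpha> a))"
    "real_rep (\<lambda>j. p (2 * j + 1)) (norm y)"
proof -
  have 1: "fun_rep (hilbert_rep e) complex_rep (\<lambda>m. p (2 * m)) (riesz_functional y)"
    and 2: "real_rep (\<lambda>j. p (2 * j + 1)) (norm y)"
    using assms by (auto simp: dual_rep_def pair_rep_def onorm_riesz)
  show "real_rep (\<lambda>j. p (2 * j + 1)) (norm y)" by (rule 2)
  obtain r where r: "associate (\<lambda>m. p (2 * m)) (\<lambda>_. a) r" "complex_rep r (riesz_functional y (\<alpha> a))"
    using 1 const_name[of a] unfolding fun_rep_def by blast
  then show "\<exists>r. associate (\<lambda>m. p (2 * m)) (\<lambda>_. a) r" by blast
  have "const_eval (\<lambda>m. p (2 * m)) a = r" using const_eval_eq[OF r(1)] by blast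
  then show "complex_rep (const_eval (\<lambda>m. p (2 * m)) a) (riesz_functional y (\<alpha> a))" using r(2) by simp
qed

lemma vector_name:
  assumes "dual_rep e p (riesz_functional y)"
  shows "\<exists>a. close_test (const_eval (\<lambda>m. p (2 * m))) (\<lambda>j. p (2 * j + 1)) k a = 0"
    "hilbert_rep e (vector_name p) y"
proof -
  note test = close_test[OF dual_rep_names(2,3)[OF assms]]
  show ex: "\<exists>a. close_test (const_eval (\<lambda>m. p (2 * m))) (\<lambda>j. p (2 * j + 1)) k a = 0" for k
  proof -
    obtain a where "norm (\<alpha> a - y) < (1 / 2) ^ (k + 3)"
      using dense[of "(1 / 2) ^ (k + 3)" y] by auto
    then show ?thesis using test(2)[of a k] by (intro exI[of _ a]) simp
  qed
  show "hilbert_rep e (vector_name p) y"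
    unfolding hilbert_rep_def
  proof (rule cauchy_repI)
    fix k
    have "close_test (const_eval (\<lambda>m. p (2 * m))) (\<lambda>j. p (2 * j + 1)) k (vector_name p k) = 0"
      unfolding vector_name_def using ex by (rule LeastI_ex)
    then show "dist (\<alpha> (vector_name p k)) y \<le> (1 / 2) ^ (k + 2)"
      using test(1) by (simp add: dist_norm)
  qed
qed

lemma frame_map_inverse_computable:
  "computable_on (frame_map ` Collect frame) (seq_rep (dual_rep e)) (seq_rep (hilbert_rep e))
     (inv_into (Collect frame) frame_map)"
proof -
  \<comment> \<open>On these names every entry is a functional with a representing vector, which
    guarantees that the search in \<open>vector_name\<close> succeeds.\<close>
  define D where "D = {p. \<exists>F. seq_rep (dual_rep e) p (frame_map F)}"
  have dual: "\<exists>y. dual_rep e (const_eval p i) (riesz_functional y)" if "p \<in> D" for p i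
    using that seq_rep_const_eval(2)[of "dual_rep e" p _ i] unfolding D_def frame_map_def by blast
  have ev: "cmp D f \<Longrightarrow> cmp D g \<Longrightarrow> cmp D (\<lambda>p n. const_eval p (f p n) (g p n))" for f g
    by (rule cmp_seq_eval) (auto simp: D_def)
  \<comment> \<open>A nested evaluation: entry \<open>f p n\<close> of the sequence is a name of a
    functional, whose even part is an associate to be evaluated at a point of the dense
    sequence.\<close>
  have ev2: "cmp D (\<lambda>p n. const_eval (\<lambda>m. const_eval p (f p n) (2 * m)) (g p n) (h p n))"
    if "cmp D f" "cmp D g" "cmp D h" for f g h
  proof (rule cmp_const_eval[where A = "\<lambda>p i m. const_eval p i (2 * m)", OF _ _ that])
    show "cmp D (\<lambda>p n. const_eval p (pfst n) (2 * psnd n))"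
      by (intro cmp_intro ev)
    show "\<exists>r. associate (\<lambda>m. const_eval p i (2 * m)) (\<lambda>_. a) r" if "p \<in> D" for p i a
      using dual[OF that, of i] dual_rep_names(1) by blast
  qed
  have "cmp D (\<lambda>p n. vector_name (const_eval p (pfst n)) (psnd n))"
    unfolding vector_name_def
  proof (rule cmp_Least)
    show "cmp D (\<lambda>p n. close_test (const_eval (\<lambda>m. const_eval p (pfst (pfst n)) (2 * m)))
        (\<lambda>j. const_eval p (pfst (pfst n)) (2 * j + 1)) (psnd (pfst n)) (psnd n))"
      unfolding close_test_def Let_def by (intro cmp_intro ev ev2)
    show "\<exists>a. close_test (const_eval (\<lambda>m. const_eval p (pfst n) (2 * m)))
        (\<lambda>j. const_eval p (pfst n) (2 * j + 1)) (psnd n) a = 0" if "p \<in> D" for p n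
      using dual[OF that, of "pfst n"] vector_name(1) by blast
  qed
  from cmp_subst2[where F = "\<lambda>p i k. vector_name (const_eval p i) k", OF this]
  have vec: "cmp D f \<Longrightarrow> cmp D g \<Longrightarrow> cmp D (\<lambda>p n. vector_name (const_eval p (f p n)) (g p n))" for f g .
  have "cmp D (\<lambda>p. seq_name (\<lambda>i. vector_name (const_eval p i)))"
    unfolding seq_name_def by (intro cmp_intro vec)
  then obtain M where M: "\<And>p. p \<in> D \<Longrightarrow> transforms M p (seq_name (\<lambda>i. vector_name (const_eval p i)))"
    using cmp_machine by blast
  show ?thesis
    unfolding computable_on_def
  proof (intro exI[of _ M] ballI allI impI)
    fix G p
    assume "G \<in> frame_map ` Collect frame" and p: "seq_rep (dual_rep e) p G"
    then obtain F where F: "frame F" "G = frame_map F" by blast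
    have "inj_on frame_map (Collect frame :: (nat \<Rightarrow> 'a) set)"
      by (simp add: inj_on_def frame_map_inject)
    then have inv: "inv_into (Collect frame) frame_map G = F"
      using F by (simp add: inv_into_f_f)
    have "dual_rep e (const_eval p i) (riesz_functional (F i))" for i
      using seq_rep_const_eval(2)[OF p, of i] by (simp add: F(2) frame_map_def)
    then have "seq_rep (hilbert_rep e) (seq_name (\<lambda>i. vector_name (const_eval p i))) F"
      by (intro seq_rep_seq_name vector_name(2))
    then show "\<exists>q. transforms M p q \<and> seq_rep (hilbert_rep e) q (inv_into (Collect frame) frame_map G)"
      using M[of p] p F unfolding inv by (auto simp: D_def)
  qed
qed

end

theorem theorem3p2:
  fixes e :: "nat \<Rightarrow> 'a::complex_hilbert"
  assumes "computable_hilbert e"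
  shows "(\<forall>F :: nat \<Rightarrow> 'a. frame F \<longrightarrow> g_frame (frame_map F)) \<and>
    inj_on (frame_map :: (nat \<Rightarrow> 'a) \<Rightarrow> nat \<Rightarrow> 'a \<Rightarrow> complex) (Collect frame) \<and>
    computable_on (Collect frame) (seq_rep (hilbert_rep e)) (seq_rep (dual_rep e)) frame_map \<and>
    computable_on (frame_map ` Collect frame) (seq_rep (dual_rep e)) (seq_rep (hilbert_rep e))
      (inv_into (Collect frame) frame_map)"
proof -
  obtain M where M: "\<And>n m p. pair_rep nat_rep nat_rep p (n, m) \<Longrightarrow>
      \<exists>q. transforms M p q \<and> real_rep q (norm (lincomb_enum e n - lincomb_enum e m))"
    using assms unfolding computable_hilbert_def computable_on_def by fastforce
  \<comment> \<open>Any name of the pair would do for \<open>M\<close>; this one is zero after two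
    entries, so its tape is decidable by \<open>input_bit\<close>.\<close>
  have "pair_rep nat_rep nat_rep (pair_name a b) (a, b)" for a b
    by (simp add: pair_rep_def nat_rep_def pair_name_def)
  then have "\<forall>a b. \<exists>q. transforms M (pair_name a b) q \<and>
      real_rep q (norm (lincomb_enum e a - lincomb_enum e b))"
    using M by blast
  \<comment> \<open>The names are merely chosen, but each is the output of \<open>M\<close> on
    \<open>pair_name a b\<close>; their computability is recovered by the simulation.\<close>
  then obtain q where q: "\<And>a b. transforms M (pair_name a b) (q a b)"
    "\<And>a b. real_rep (q a b) (norm (lincomb_enum e a - lincomb_enum e b))"
    by metis
  interpret norm_oracle e q
  proof
    show "cmp D (\<lambda>p n. q (f p n) (g p n) (h p n))" if "cmp D f" "cmp D g" "cmp D h" for D f g h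
      using that by (rule cmp_machine_value[OF q(1)])
    show "\<exists>n. norm (lincomb_enum e n - y) < \<epsilon>" if "0 < \<epsilon>" for \<epsilon> y
      using assms that unfolding computable_hilbert_def by (intro lincomb_enum_dense) auto
  qed (rule q(2))
  show ?thesis
    using frame_map_computable frame_map_inverse_computable
    by (simp add: inj_on_def frame_map_inject g_frame_frame_map)
qed

end
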